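(* Let $1\le p<\infty$ and let $\varphi\colon\mathbb{D}\to\mathbb{D}$ be analytic, $C_\varphi\colon H^p\to H^p$, $C_\varphi f=f\circ\varphi$. (1) If $\overline{\varphi(\mathbb{D})}\subseteq\mathbb{D}$, then $\beta(C_\varphi)=\lim_{n\to\infty}[a_n(C_\varphi)]^{1/n}$ exists and equals $\exp\big(-1/\operatorname{Cap}[\varphi(\mathbb{D})]\big)$. (2) If $\|\varphi\|_\infty=1$, then $\beta(C_\varphi)=\lim_{n\to\infty}[a_n(C_\varphi)]^{1/n}$ exists and equals $1$.
   Context: $H^p$ is the Hardy space of the unit disk. Approximation numbers: $a_n(T)=\inf\{\|T-R\|:\operatorname{rank}R<n\}$. Green capacity: $g(z,w)=\log\left|\frac{1-\bar wz}{z-w}\right|$, $I(\mu)=\iint g\,d\mu\,d\mu$, $V(E)=\inf I(\mu)$ over probability measures supported by a compact subset of $E\subseteq\mathbb{D}$, $\operatorname{Cap}(E)=1/V(E)$. *)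

theory Defs
  imports "HOL-Probability.Probability"
begin

definition disk :: "complex set" where
  "disk = ball 0 1"

definition int_mean :: "real \<Rightarrow> (complex \<Rightarrow> complex) \<Rightarrow> real \<Rightarrow> real" where
  "int_mean p f r = (1 / (2 * pi)) * integral {0..2*pi} (\<lambda>t. cmod (f (complex_of_real r * cis t)) powr p)"

text \<open>Hardy space H^p of the disk. Elements are represented as functions
  that are holomorphic on the disk and (normalised to be) zero outside it.\<close>
definition Hp :: "real \<Rightarrow> (complex \<Rightarrow> complex) set" where
  "Hp p = {f. f holomorphic_on disk \<and> (\<forall>z. z \<notin> disk \<longrightarrow> f z = 0)
              \<and> bdd_above (int_mean p f ` {0..<1})}"

definition hp_norm :: "real \<Rightarrow> (complex \<Rightarrow> complex) \<Rightarrow> real" where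
  "hp_norm p f = (SUP r\<in>{0..<1}. int_mean p f r) powr (1 / p)"

definition comp_op :: "(complex \<Rightarrow> complex) \<Rightarrow> (complex \<Rightarrow> complex) \<Rightarrow> (complex \<Rightarrow> complex)" where
  "comp_op \<phi> f = (\<lambda>z. if z \<in> disk then f (\<phi> z) else 0)"

definition bounded_op :: "real \<Rightarrow> ((complex \<Rightarrow> complex) \<Rightarrow> (complex \<Rightarrow> complex)) \<Rightarrow> bool" where
  "bounded_op p T \<longleftrightarrow>
     (\<forall>f\<in>Hp p. T f \<in> Hp p) \<and>
     (\<forall>f\<in>Hp p. \<forall>g\<in>Hp p. T (\<lambda>z. f z + g z) = (\<lambda>z. T f z + T g z)) \<and>
     (\<forall>c::complex. \<forall>f\<in>Hp p. T (\<lambda>z. c * f z) = (\<lambda>z. c * T f z)) \<and>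
     (\<exists>C. \<forall>f\<in>Hp p. hp_norm p (T f) \<le> C * hp_norm p f)"

definition op_norm :: "real \<Rightarrow> ((complex \<Rightarrow> complex) \<Rightarrow> (complex \<Rightarrow> complex)) \<Rightarrow> real" where
  "op_norm p T = (SUP f\<in>{f\<in>Hp p. hp_norm p f \<le> 1}. hp_norm p (T f))"

definition rank_lt :: "real \<Rightarrow> ((complex \<Rightarrow> complex) \<Rightarrow> (complex \<Rightarrow> complex)) \<Rightarrow> nat \<Rightarrow> bool" where
  "rank_lt p R n \<longleftrightarrow> (\<exists>m<n. \<exists>g :: nat \<Rightarrow> complex \<Rightarrow> complex.
      \<forall>f\<in>Hp p. \<exists>c :: nat \<Rightarrow> complex. R f = (\<lambda>z. \<Sum>i<m. c i * g i z))"

definition approx_num :: "real \<Rightarrow> ((complex \<Rightarrow> complex) \<Rightarrow> (complex \<Rightarrow> complex)) \<Rightarrow> nat \<Rightarrow> real" where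
  "approx_num p T n = Inf {op_norm p (\<lambda>f z. T f z - R f z) | R. bounded_op p R \<and> rank_lt p R n}"

definition green :: "complex \<Rightarrow> complex \<Rightarrow> ennreal" where
  "green z w = (if z = w then \<infinity> else ennreal (ln (cmod ((1 - cnj w * z) / (z - w)))))"

definition green_energy :: "complex measure \<Rightarrow> ennreal" where
  "green_energy \<mu> = (\<integral>\<^sup>+ z. (\<integral>\<^sup>+ w. green z w \<partial>\<mu>) \<partial>\<mu>)"

definition adm_measures :: "complex set \<Rightarrow> complex measure set" where
  "adm_measures E = {\<mu>. sets \<mu> = sets borel \<and> prob_space \<mu> \<and>
      (\<exists>K. compact K \<and> K \<subseteq> E \<and> emeasure \<mu> K = 1)}"

definition green_V :: "complex set \<Rightarrow> ennreal" where
  "green_V E = (INF \<mu>\<in>adm_measures E. green_energy \<mu>)"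

definition green_cap :: "complex set \<Rightarrow> ennreal" where
  "green_cap E = 1 / green_V E"

definition exp_neg_inv :: "ennreal \<Rightarrow> real" where
  "exp_neg_inv c = (if c = 0 then 0 else if c = \<infinity> then 1 else exp (- 1 / enn2real c))"

end

theory Submission
  imports Defs "HOL-Complex_Analysis.Complex_Analysis" "HOL-Real_Asymp.Real_Asymp"
begin

text \<open>
  Everything rests on one averaging estimate for the pseudo-hyperbolic distance $\rho$. Since
  $\rho(x,z) \ge |s-y|/(1-sy)$ with $s = \rho(w,x)$ and $y = \rho(w,z)$, the average of
  $\log 1/\rho(x,z)$ over points $x$ of a connected set, one on each circle $\rho(w,x) = s$ with
  $\eta \le s \le d$ and $s$ distributed according to $ds/s$, exceeds $\log 1/\rho(w,z)$ by at most
  $4/\log(d/\eta)$, uniformly in $z$. This replaces all potential theory: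

  \<^item> The Fekete points of the continuum $K = \varphi(r\overline{D})$ all carry nearly the same
    potential, and a Blaschke product that is small on $K$ is small on the whole of $\varphi(D)$
    once $K$ is sufficiently dense in it.
  \<^item> Spreading each Fekete point over a short arc produces a measure on the open set $\varphi(D)$
    whose Green energy is close to the discrete energy.

  The upper bound for $a_n$ comes from interpolating $f$ at the zeros of a Blaschke product by the
  Hermite remainder formula. The lower bound comes from an $n$-dimensional space of Blaschke
  products on which an operator of rank less than $n$ has a kernel. If $\|\varphi\|_\infty = 1$,
  averaging over hyperbolic length along $\varphi(r\overline{D})$ shows that the Green energy tends
  to $0$.
\<close>

section \<open>Pseudo-hyperbolic distance and averaging over a continuum\<close>

text \<open>Only exponential rates survive the n-th root, so constants, powers of n and factors
  exp(\<epsilon> n) are given away freely. This is why the limit does not depend on p: H^p norms are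
  only compared with sup norms from above and with point values on a compact disk from below. The
  obstacle is that extremality speaks about averages and about compact sets. The energy of n points
  bounds the sum of their potentials, while the lower bound for a_n needs each of them;
  near-extremality bounds a Blaschke product on a compact continuum, while the upper bound needs all
  of \<phi>(D). Both gaps close for the same reason: a connected set reaching from within \<eta> of
  w out to distance d meets every circle in between, so for the average it is as good as a geodesic
  arc. Taking \<eta> = d exp(-4/\<epsilon>) makes the loss exp(\<epsilon> n), and since \<eta>
  depends on \<epsilon> but not on n, it enters the final bounds only through a constant.\<close>

definition pdist :: "complex \<Rightarrow> complex \<Rightarrow> real" where
  "pdist z w = cmod ((z - w) / (1 - cnj w * z))"

text \<open>The disk automorphism carrying 0 to w. For real s in [0,1) it runs along a hyperbolic
  radius issuing from w and picks one point of each circle \<rho>(w,x) = s.\<close>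

definition moebius :: "complex \<Rightarrow> complex \<Rightarrow> complex" where
  "moebius w s = (s + w) / (1 + cnj w * s)"

lemma mem_disk_iff: "z \<in> disk \<longleftrightarrow> cmod z < 1"
  by (simp add: disk_def)

lemma one_minus_cnj_mult_nz:
  assumes "z \<in> disk" "w \<in> disk"
  shows "1 - cnj w * z \<noteq> 0"
proof
  assume "1 - cnj w * z = 0"
  then have "cmod w * cmod z = 1"
    by (metis complex_mod_cnj eq_iff_diff_eq_0 norm_mult norm_one)
  moreover have "cmod w * cmod z < 1 * 1"
    using assms by (intro mult_strict_mono') (auto simp: mem_disk_iff)
  ultimately show False by simp
qed

lemma one_plus_cnj_mult_nz:
  assumes "z \<in> disk" "w \<in> disk"
  shows "1 + cnj w * z \<noteq> 0"
  using one_minus_cnj_mult_nz[of z "-w"] assms by (simp add: mem_disk_iff)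

lemma pdist_nonneg [simp]: "0 \<le> pdist z w"
  by (simp add: pdist_def)

lemma pdist_commute: "pdist z w = pdist w z"
proof -
  have "1 - cnj z * w = cnj (1 - cnj w * z)"
    by (simp add: mult.commute)
  then have "cmod (1 - cnj w * z) = cmod (1 - cnj z * w)"
    by (simp only: complex_mod_cnj)
  then show ?thesis
    by (simp add: pdist_def norm_divide norm_minus_commute)
qed

lemma pdist_eq_0_iff:
  assumes "z \<in> disk" "w \<in> disk"
  shows "pdist z w = 0 \<longleftrightarrow> z = w"
  using one_minus_cnj_mult_nz[OF assms] by (simp add: pdist_def)

lemma pdist_pos:
  assumes "z \<in> disk" "w \<in> disk" "z \<noteq> w"
  shows "pdist z w > 0"
  using pdist_eq_0_iff[OF assms(1,2)] assms(3) pdist_nonneg[of z w] by linarith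

lemma pdist_zero_left [simp]: "pdist 0 z = cmod z"
  by (simp add: pdist_def)

lemma cmod_one_minus_cnj_mult_sq:
  "(cmod (1 - cnj w * z))\<^sup>2 = (cmod (z - w))\<^sup>2 + (1 - (cmod z)\<^sup>2) * (1 - (cmod w)\<^sup>2)"
  unfolding cmod_power2 by (simp add: algebra_simps power2_eq_square)

lemma one_minus_pdist_sq:
  assumes "z \<in> disk" "w \<in> disk"
  shows "1 - (pdist z w)\<^sup>2 = (1 - (cmod z)\<^sup>2) * (1 - (cmod w)\<^sup>2) / (cmod (1 - cnj w * z))\<^sup>2"
proof -
  have "(cmod (1 - cnj w * z))\<^sup>2 \<noteq> 0"
    using one_minus_cnj_mult_nz[OF assms] by simp
  then show ?thesis
    unfolding pdist_def norm_divide power_divide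
    using cmod_one_minus_cnj_mult_sq[of w z] by (simp add: field_simps)
qed

lemma pdist_less_1:
  assumes "z \<in> disk" "w \<in> disk"
  shows "pdist z w < 1"
proof -
  have "0 < (1 - (cmod z)\<^sup>2) * (1 - (cmod w)\<^sup>2) / (cmod (1 - cnj w * z))\<^sup>2"
    using assms one_minus_cnj_mult_nz[OF assms]
    by (auto intro!: divide_pos_pos mult_pos_pos simp: mem_disk_iff power_less_one_iff)
  then have "(pdist z w)\<^sup>2 < 1"
    using one_minus_pdist_sq[OF assms] by linarith
  then show ?thesis
    by (simp add: power_less_one_iff)
qed

text \<open>By \<open>one_minus_pdist_sq\<close>, for fixed moduli \<rho> is smallest when |1 - cnj
  w * z| is, and that minimum is 1 - |z||w|, attained when z and w lie on one ray.\<close>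

lemma pdist_ge_radial:
  assumes "z \<in> disk" "w \<in> disk"
  shows "\<bar>cmod z - cmod w\<bar> / (1 - cmod z * cmod w) \<le> pdist z w"
proof -
  define a b where "a = cmod z" and "b = cmod w"
  have ab: "0 \<le> a" "a < 1" "0 \<le> b" "b < 1"
    using assms by (auto simp: a_def b_def mem_disk_iff)
  have abl: "a * b < 1"
    using ab mult_strict_mono'[of a 1 b 1] by simp
  have le: "1 - a * b \<le> cmod (1 - cnj w * z)"
    using norm_triangle_ineq2[of 1 "cnj w * z"] by (simp add: a_def b_def norm_mult mult.commute)
  have "1 - (pdist z w)\<^sup>2 \<le> (1 - a\<^sup>2) * (1 - b\<^sup>2) / (1 - a * b)\<^sup>2"
    unfolding one_minus_pdist_sq[OF assms] a_def[symmetric] b_def[symmetric]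
    using ab abl le
    by (intro divide_left_mono mult_nonneg_nonneg power_mono mult_pos_pos zero_less_power)
       (auto simp: power_le_one_iff)
  also have "\<dots> = 1 - (\<bar>a - b\<bar> / (1 - a * b))\<^sup>2"
    using abl by (simp add: power_divide divide_simps) (simp add: algebra_simps power2_eq_square)
  finally have "(\<bar>a - b\<bar> / (1 - a * b))\<^sup>2 \<le> (pdist z w)\<^sup>2"
    by simp
  then show ?thesis
    unfolding a_def b_def by (rule power2_le_imp_le) simp
qed

lemma norm_moebius: "cmod (moebius (- w) z) = pdist z w"
  by (simp add: moebius_def pdist_def)

lemma moebius_in_disk: "z \<in> disk \<Longrightarrow> w \<in> disk \<Longrightarrow> moebius w z \<in> disk"
  using norm_moebius[of "-w" z] pdist_less_1[of z "-w"] by (simp add: mem_disk_iff)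

lemma pdist_moebius_moebius:
  assumes "z \<in> disk" "x \<in> disk" "w \<in> disk"
  shows "pdist (moebius w x) (moebius w z) = pdist x z"
proof -
  define A B where "A = 1 + cnj w * x" and "B = 1 + cnj w * z"
  have nz: "A \<noteq> 0" "B \<noteq> 0" and nzw: "1 - cnj w * w \<noteq> 0"
    and nzz: "1 - cnj z * x \<noteq> 0"
    using assms one_plus_cnj_mult_nz one_minus_cnj_mult_nz by (auto simp: A_def B_def)
  have nzc: "cnj B \<noteq> 0" using nz by simp
  have 1: "moebius w x - moebius w z = (1 - cnj w * w) * (x - z) / (A * B)"
    using nz unfolding moebius_def A_def[symmetric] B_def[symmetric]
    by (simp add: divide_simps) (simp add: A_def B_def algebra_simps)
  have 2: "1 - cnj (moebius w z) * moebius w x = (1 - cnj w * w) * (1 - cnj z * x) / (A * cnj B)"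
    using nz nzc unfolding moebius_def A_def[symmetric] B_def[symmetric] complex_cnj_divide
    by (simp add: divide_simps) (simp add: A_def B_def algebra_simps)
  have "cmod (1 - cnj w * w) \<noteq> 0" "cmod A \<noteq> 0" "cmod B \<noteq> 0" "cmod (1 - cnj z * x) \<noteq> 0"
    using nz nzw nzz by auto
  then show ?thesis
    unfolding pdist_def 1 2 by (simp add: norm_divide norm_mult)
qed

lemma pdist_ge_radial_center:
  assumes "z \<in> disk" "x \<in> disk" "w \<in> disk"
  shows "\<bar>pdist w x - pdist w z\<bar> / (1 - pdist w x * pdist w z) \<le> pdist x z"
proof -
  have w: "- w \<in> disk" using assms by (simp add: mem_disk_iff)
  show ?thesis
    using pdist_ge_radial[of "moebius (-w) x" "moebius (-w) z"] assms w
    by (simp add: norm_moebius pdist_moebius_moebius moebius_in_disk pdist_commute[of w])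
qed

lemma pdist_moebius_real:
  assumes "w \<in> disk" "0 \<le> s" "s < 1"
  shows "pdist w (moebius w (of_real s)) = s"
  using pdist_moebius_moebius[of "of_real s" 0 w] assms by (simp add: moebius_def mem_disk_iff)

text \<open>Controls Euclidean displacement by the pseudo-hyperbolic radius; this keeps short arcs
  inside an open set that is known only through Euclidean balls.\<close>

lemma dist_moebius_le:
  assumes "w \<in> disk" "0 \<le> s" "s < 1"
  shows "cmod (moebius w (of_real s) - w) \<le> 2 * s"
proof -
  have w: "cmod w < 1" using assms by (simp add: mem_disk_iff)
  have nz: "1 + cnj w * of_real s \<noteq> 0"
    using one_plus_cnj_mult_nz[of "of_real s" w] assms by (simp add: mem_disk_iff)
  have "moebius w (of_real s) - w = of_real s * (1 - cnj w * w) / (1 + cnj w * of_real s)"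
    using nz by (simp add: moebius_def divide_simps) (simp add: algebra_simps)
  moreover have "1 - cnj w * w = of_real (1 - (cmod w)\<^sup>2)"
    by (simp only: mult.commute[of "cnj w"] complex_norm_square[symmetric]) simp
  ultimately have eq: "cmod (moebius w (of_real s) - w) = s * (1 - (cmod w)\<^sup>2) / cmod (1 + cnj w * of_real s)"
    using assms w by (simp add: norm_divide norm_mult power_le_one_iff del: of_real_diff)
  have "cmod w * s \<le> cmod w * 1"
    using assms by (intro mult_left_mono) auto
  then have ge: "1 - cmod w \<le> cmod (1 + cnj w * of_real s)"
    using norm_diff_ineq[of 1 "cnj w * of_real s"] assms by (simp add: norm_mult)
  have "s * (1 - (cmod w)\<^sup>2) / cmod (1 + cnj w * of_real s) \<le> s * (1 - (cmod w)\<^sup>2) / (1 - cmod w)"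
    using ge assms w nz by (intro divide_left_mono mult_nonneg_nonneg mult_pos_pos) (auto simp: power_le_one_iff)
  also have "\<dots> = s * (1 + cmod w)"
    using w by (simp add: divide_simps power2_eq_square) (simp add: algebra_simps)
  also have "\<dots> \<le> s * 2"
    using w assms by (intro mult_left_mono) auto
  finally show ?thesis using eq by (simp add: mult.commute)
qed

text \<open>With v = sqrt (1 - u) the claim is 1/v - v + 2 ln v \<ge> 0 on (0,1]: the left side
  vanishes at 1 and its derivative is -(1/v - 1)^2. The inverse square root is chosen because,
  unlike the logarithm divided by s, it has an elementary primitive.\<close>

lemma minus_ln_one_minus_le:
  fixes u :: real
  assumes "0 \<le> u" "u < 1"
  shows "- ln (1 - u) \<le> u / sqrt (1 - u)"
proof -
  define v where "v = sqrt (1 - u)"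
  have v: "0 < v" "v \<le> 1" and v2: "v\<^sup>2 = 1 - u"
    using assms by (auto simp: v_def)
  have "1 / v - v + 2 * ln v \<ge> 1 / 1 - 1 + 2 * ln (1::real)"
  proof (rule DERIV_nonpos_imp_nonincreasing[where f = "\<lambda>v. 1 / v - v + 2 * ln v"])
    show "v \<le> 1" by fact
    fix x :: real assume "v \<le> x" "x \<le> 1"
    then have x: "x > 0" using v by simp
    have "((\<lambda>v. 1 / v - v + 2 * ln v) has_real_derivative (- (1 / x\<^sup>2) - 1 + 2 / x)) (at x)"
      using x by (auto intro!: derivative_eq_intros simp: power2_eq_square)
    moreover have "- (1 / x\<^sup>2) - 1 + 2 / x = - (1 / x - 1)\<^sup>2"
      using x by (simp add: power2_eq_square field_simps)
    ultimately show "\<exists>y. DERIV (\<lambda>v. 1 / v - v + 2 * ln v) x :> y \<and> y \<le> 0"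
      by auto
  qed
  then have "- 2 * ln v \<le> 1 / v - v" by simp
  also have "1 / v - v = (1 - v\<^sup>2) / v"
    using v by (simp add: power2_eq_square field_simps)
  finally have "- (2 * ln v) \<le> u / v" using v2 by simp
  moreover have "ln (1 - u) = 2 * ln v"
    using v v2 by (metis ln_realpow of_nat_numeral)
  ultimately show ?thesis by (simp add: v_def)
qed

text \<open>
  An antiderivative of a majorant of $s \mapsto -\log|1 - s/y| / s$. It stays between $-2$ and $2$,
  which bounds the averages uniformly in $y$.
\<close>
definition center_prim :: "real \<Rightarrow> real \<Rightarrow> real" where
  "center_prim y s = (if s \<le> y then - 2 * sqrt (1 - s / y) else 2 * sqrt (1 - y / s))"

definition center_dens :: "real \<Rightarrow> real \<Rightarrow> real" where
  "center_dens y s = (if s < y then 1 / (y * sqrt (1 - s / y)) else y / (s\<^sup>2 * sqrt (1 - y / s)))"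

lemma center_dens_nonneg: "0 < y \<Longrightarrow> 0 < s \<Longrightarrow> 0 \<le> center_dens y s"
  by (auto simp: center_dens_def)

text \<open>The density is unbounded at s = y, but the primitive is continuous there, so the
  fundamental theorem applies with the single exceptional point y.\<close>

lemma center_dens_has_integral:
  assumes "0 < y" "0 < a" "a \<le> b"
  shows "(center_dens y has_integral (center_prim y b - center_prim y a)) {a..b}"
proof (rule fundamental_theorem_of_calculus_interior_strong[where S = "{y}"])
  show "continuous_on {a..b} (center_prim y)"
    unfolding center_prim_def
  proof (rule continuous_on_cases_le)
    show "continuous_on {t \<in> {a..b}. t \<le> y} (\<lambda>s. - 2 * sqrt (1 - s / y))"
      using assms by (auto intro!: continuous_intros)
    show "continuous_on {t \<in> {a..b}. y \<le> t} (\<lambda>s. 2 * sqrt (1 - y / s))"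
      using assms by (auto intro!: continuous_intros)
  qed (use assms in auto)
  fix x assume "x \<in> {a<..<b} - {y}"
  then have x: "x > 0" "x \<noteq> y" using assms by auto
  show "(center_prim y has_vector_derivative center_dens y x) (at x)"
  proof (cases "x < y")
    case True
    have "((\<lambda>s. - 2 * sqrt (1 - s / y)) has_real_derivative center_dens y x) (at x)"
      using True x assms by (auto intro!: derivative_eq_intros simp: center_dens_def field_simps)
    then have "(center_prim y has_real_derivative center_dens y x) (at x)"
      by (rule has_field_derivative_transform_within_open[where S = "{..<y}"])
         (use True in \<open>auto simp: center_prim_def\<close>)
    then show ?thesis by (simp add: has_real_derivative_iff_has_vector_derivative)
  next
    case False
    then have xy: "y < x" using x by simp
    have "((\<lambda>s. 2 * sqrt (1 - y / s)) has_real_derivative center_dens y x) (at x)"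
      using xy x assms by (auto intro!: derivative_eq_intros simp: center_dens_def field_simps power2_eq_square)
    then have "(center_prim y has_real_derivative center_dens y x) (at x)"
      by (rule has_field_derivative_transform_within_open[where S = "{y<..}"])
         (use xy in \<open>auto simp: center_prim_def\<close>)
    then show ?thesis by (simp add: has_real_derivative_iff_has_vector_derivative)
  qed
qed (use assms in auto)

lemma center_prim_diff_less:
  assumes "0 < y" "0 < a" "a \<le> b"
  shows "center_prim y b - center_prim y a < 4"
proof -
  have "center_prim y s < 2" "center_prim y s > - 2" if "s > 0" for s
  proof -
    have "sqrt (1 - s / y) < 1" "sqrt (1 - y / s) < 1" 
      using that assms by (auto simp: real_sqrt_lt_1_iff)
    moreover have "sqrt (1 - s / y) \<ge> 0" if "s \<le> y"
      using that assms by simp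
    moreover have "sqrt (1 - y / s) \<ge> 0" if "\<not> s \<le> y"
      using that \<open>s > 0\<close> by simp
    ultimately show "center_prim y s < 2" "center_prim y s > - 2"
      unfolding center_prim_def by (cases "s \<le> y"; simp only: if_True if_False; linarith)+
  qed
  from this[of a] this[of b] assms show ?thesis by auto
qed

lemma minus_ln_pdist_le_center:
  assumes "z \<in> disk" "x \<in> disk" "w \<in> disk" "w \<noteq> z" "w \<noteq> x" "pdist w x \<noteq> pdist w z"
  shows "- ln (pdist x z) \<le> - ln (pdist w z) + pdist w x * center_dens (pdist w z) (pdist w x)"
proof -
  define s y where "s = pdist w x" and "y = pdist w z"
  have sy: "0 < s" "s < 1" "0 < y" "y < 1" "s \<noteq> y"
    using assms pdist_pos pdist_less_1 by (auto simp: s_def y_def)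
  have sy1: "s * y < 1"
    using sy mult_strict_mono'[of s 1 y 1] by simp
  \<comment> \<open>Dropping the denominator, which is at most 1, leaves a function of s/y or y/s up
    to scaling, to which the square-root bound applies.\<close>
  have "\<bar>s - y\<bar> / 1 \<le> \<bar>s - y\<bar> / (1 - s * y)"
    using sy sy1 by (intro divide_left_mono) auto
  also have "\<dots> \<le> pdist x z"
    using pdist_ge_radial_center[OF assms(1-3)] by (simp add: s_def y_def)
  finally have "\<bar>s - y\<bar> \<le> pdist x z" by simp
  then have "- ln (pdist x z) \<le> - ln \<bar>s - y\<bar>"
    using sy by simp
  also have "- ln \<bar>s - y\<bar> \<le> - ln y + s * center_dens y s"
  proof (cases "s < y")
    case True
    have "- ln \<bar>s - y\<bar> = - ln y - ln (1 - s / y)"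
      using True sy by (subst ln_div[symmetric] ln_mult_pos[symmetric] | simp add: field_simps)+
    also have "\<dots> \<le> - ln y + (s / y) / sqrt (1 - s / y)"
      using minus_ln_one_minus_le[of "s / y"] True sy by simp
    also have "\<dots> = - ln y + s * center_dens y s"
      using True by (simp add: center_dens_def)
    finally show ?thesis .
  next
    case False
    then have ys: "y < s" using sy by simp
    have "ln y \<le> ln s" "0 \<le> y / s" "y / s < 1" using ys sy by auto
    have "s - y = s * (1 - y / s)" using sy by (simp add: field_simps)
    moreover have "ln (s * (1 - y / s)) = ln s + ln (1 - y / s)"
      using sy ys by (intro ln_mult_pos) auto
    ultimately have "- ln \<bar>s - y\<bar> = - ln s - ln (1 - y / s)"
      using ys by simp
    also have "\<dots> \<le> - ln y + (y / s) / sqrt (1 - y / s)"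
      using minus_ln_one_minus_le[of "y / s"] \<open>0 \<le> y / s\<close> \<open>y / s < 1\<close> \<open>ln y \<le> ln s\<close> by simp
    also have "\<dots> = - ln y + s * center_dens y s"
      using ys sy by (simp add: center_dens_def power2_eq_square)
    finally show ?thesis .
  qed
  finally show ?thesis by (simp add: s_def y_def)
qed

text \<open>Suppose every point of K on these circles gave a smaller product. Taking logarithms, the
  sum of the densities \<open>center_dens\<close> would be at least 4 n / (L s) at all but finitely
  many radii s, with n = card I and L = ln (d/\<eta>); integrating over [\<eta>,d] gives 4 n on one
  side and less than 4 n on the other. Arguing by contradiction keeps the points out of the
  integrals, so they need not depend measurably on s.\<close>

lemma exists_prod_pdist_ge_center:
  assumes "finite I" "\<And>i. i \<in> I \<Longrightarrow> z i \<in> disk" "w \<in> disk" "K \<subseteq> disk"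
    and d: "0 < \<eta>" "\<eta> < d"
    and K: "\<And>s. \<eta> \<le> s \<Longrightarrow> s \<le> d \<Longrightarrow> \<exists>x\<in>K. pdist w x = s"
  shows "\<exists>x\<in>K. \<eta> \<le> pdist w x \<and>
           exp (- 4 * real (card I) / ln (d / \<eta>)) * (\<Prod>i\<in>I. pdist w (z i)) \<le> (\<Prod>i\<in>I. pdist x (z i))"
proof (cases "I = {} \<or> w \<in> z ` I")
  \<comment> \<open>Here the left-hand product is 0, or it is empty and both sides are 1, so any
    point of K at distance d will do.\<close>
  case True
  obtain x where x: "x \<in> K" "pdist w x = d" using K[of d] d by auto
  have "(\<Prod>i\<in>I. pdist w (z i)) = 0" if "I \<noteq> {}"
    using True that assms by (auto intro!: prod_zero simp: pdist_def)
  then show ?thesis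
    using x d True by (cases "I = {}") (auto intro!: bexI[of _ x] prod_nonneg)
next
  case False
  define y where "y i = pdist w (z i)" for i
  have y: "0 < y i" if "i \<in> I" for i
    using that False assms by (auto simp: y_def intro!: pdist_pos)
  define L where "L = ln (d / \<eta>)"
  have L: "L > 0" using d by (simp add: L_def)
  define n where "n = card I"
  show ?thesis
  proof (rule ccontr)
    assume neg: "\<not> ?thesis"
    have key: "4 * n / L * (1 / s) \<le> (\<Sum>i\<in>I. center_dens (y i) s)" if s: "s \<in> {\<eta>..d} - y ` I" for s
    proof -
      obtain x where x: "x \<in> K" "pdist w x = s" using K[of s] s by auto
      have xd: "x \<in> disk" using x assms by auto
      have s0: "s > 0" using s d by auto
      have wx: "w \<noteq> x" using x s0 by (auto simp: pdist_def)
      have xz: "x \<noteq> z i" if "i \<in> I" for i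
        using s x that by (auto simp: y_def)
      have "(\<Prod>i\<in>I. pdist x (z i)) < exp (- 4 * real n / L) * (\<Prod>i\<in>I. y i)"
        using neg x s by (force simp: y_def n_def L_def)
      moreover have "0 < (\<Prod>i\<in>I. pdist x (z i))"
        using xz assms xd by (intro prod_pos) (auto intro!: pdist_pos)
      ultimately have "ln (\<Prod>i\<in>I. pdist x (z i)) \<le> ln (exp (- 4 * real n / L) * (\<Prod>i\<in>I. y i))"
        by (intro ln_mono) auto
      also have "\<dots> = - 4 * real n / L + (\<Sum>i\<in>I. ln (y i))"
        using y assms by (subst ln_mult_pos) (auto intro!: prod_pos ln_prod dest!: y)
      also have "ln (\<Prod>i\<in>I. pdist x (z i)) = (\<Sum>i\<in>I. ln (pdist x (z i)))"
        using xz assms xd by (intro ln_prod) (auto dest!: pdist_eq_0_iff[THEN iffD1, rotated 2] intro!: pdist_pos)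
      finally have "4 * real n / L \<le> (\<Sum>i\<in>I. - ln (pdist x (z i)) + ln (y i))"
        by (simp add: sum_subtractf)
      also have "\<dots> \<le> (\<Sum>i\<in>I. s * center_dens (y i) s)"
      proof (rule sum_mono)
        fix i assume i: "i \<in> I"
        have "pdist w x \<noteq> pdist w (z i)" "w \<noteq> z i" using s x i False by (auto simp: y_def)
        then show "- ln (pdist x (z i)) + ln (y i) \<le> s * center_dens (y i) s"
          using minus_ln_pdist_le_center[of "z i" x w] assms xd wx i x by (simp add: y_def)
      qed
      finally show ?thesis
        using s0 pos_divide_le_eq[OF s0, of "4 * real n / L"]
        by (simp add: sum_distrib_left[symmetric] mult.commute)
    qed
    have i1: "((\<lambda>s. 4 * n / L * (1 / s)) has_integral (4 * n / L * (ln d - ln \<eta>))) {\<eta>..d}"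
    proof (intro has_integral_mult_right fundamental_theorem_of_calculus)
      fix x assume "x \<in> {\<eta>..d}"
      then show "(ln has_vector_derivative 1 / x) (at x within {\<eta>..d})"
        using d by (auto intro!: derivative_eq_intros simp flip: has_real_derivative_iff_has_vector_derivative)
    qed (use d in auto)
    have i2: "((\<lambda>s. \<Sum>i\<in>I. center_dens (y i) s) has_integral (\<Sum>i\<in>I. center_prim (y i) d - center_prim (y i) \<eta>)) {\<eta>..d}"
      using assms y d by (intro has_integral_sum center_dens_has_integral) auto
    have i3: "((\<lambda>s. if s \<in> y ` I then 4 * n / L * (1 / s) else (\<Sum>i\<in>I. center_dens (y i) s)) has_integral (\<Sum>i\<in>I. center_prim (y i) d - center_prim (y i) \<eta>)) {\<eta>..d}"
      by (rule has_integral_spike_finite[OF _ _ i2, where S = "y ` I"]) (use assms in auto)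
    have "4 * n / L * (ln d - ln \<eta>) \<le> (\<Sum>i\<in>I. center_prim (y i) d - center_prim (y i) \<eta>)"
      by (rule has_integral_le[OF i1 i3]) (use key in auto)
    also have "\<dots> < (\<Sum>i\<in>I. 4)"
      using False assms y d by (intro sum_strict_mono center_prim_diff_less) auto
    also have "\<dots> = 4 * n" by (simp add: n_def)
    finally show False
      using L d by (simp add: L_def ln_div)
  qed
qed

text \<open>
  The analogue for hyperbolic length: with $\tau = |s-y|/(1-sy)$ one has
  $d\tau/(1-\tau^2) = \pm ds/(1-s^2)$ and $-\log\tau \le (1-\tau)/\sqrt\tau$.
\<close>
definition radial_prim :: "real \<Rightarrow> real \<Rightarrow> real" where
  "radial_prim y s = (if s \<le> y then - 2 * sqrt ((y - s) / (1 - s * y)) else 2 * sqrt ((s - y) / (1 - s * y)))"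

text \<open>The factor (1 - y^2)/(1 - s y)^2 is the modulus of d\<tau>/ds, so this is the derivative
  of 2 sqrt \<tau> up to sign.\<close>

definition radial_dens :: "real \<Rightarrow> real \<Rightarrow> real" where
  "radial_dens y s = (1 - y\<^sup>2) / ((1 - s * y)\<^sup>2 * sqrt (\<bar>s - y\<bar> / (1 - s * y)))"

lemma radial_dens_has_integral:
  assumes "0 \<le> y" "y < 1" "0 \<le> a" "a \<le> b" "b < 1"
  shows "(radial_dens y has_integral (radial_prim y b - radial_prim y a)) {a..b}"
proof (rule fundamental_theorem_of_calculus_interior_strong[where S = "{y}"])
  have sy: "s * y < 1" if "0 \<le> s" "s \<le> b" for s
    using that assms mult_strict_mono'[of s 1 y 1] by simp
  have nz: "\<forall>s\<in>S. 1 - s * y \<noteq> 0" if "S \<subseteq> {a..b}" for S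
    using that assms sy by (metis atLeastAtMost_iff diff_gt_0_iff_gt less_irrefl order_trans subsetD)
  show "continuous_on {a..b} (radial_prim y)"
    unfolding radial_prim_def
  proof (rule continuous_on_cases_le)
    show "continuous_on {t \<in> {a..b}. t \<le> y} (\<lambda>s. - 2 * sqrt ((y - s) / (1 - s * y)))"
      by (intro continuous_intros nz) auto
    show "continuous_on {t \<in> {a..b}. y \<le> t} (\<lambda>s. 2 * sqrt ((s - y) / (1 - s * y)))"
      by (intro continuous_intros nz) auto
  qed (use assms in auto)
  fix x assume "x \<in> {a<..<b} - {y}"
  then have x: "x > 0" "x \<noteq> y" and xy1: "x * y < 1" using assms sy by auto
  have radial_dens_eq: "radial_dens y x = (1 - y\<^sup>2) / (1 - x * y)\<^sup>2 * inverse (sqrt (\<bar>x - y\<bar> / (1 - x * y)))"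
    unfolding radial_dens_def by (simp only: divide_inverse inverse_mult_distrib mult.assoc)
  show "(radial_prim y has_vector_derivative radial_dens y x) (at x)"
  proof (cases "x < y")
    case True
    have "((\<lambda>s. (y - s) / (1 - s * y)) has_real_derivative (- (1 - y\<^sup>2) / (1 - x * y)\<^sup>2)) (at x)"
      using xy1 by (intro DERIV_cong[OF DERIV_divide[where D = "-1" and E = "- y"]])
        (auto intro!: derivative_eq_intros simp: algebra_simps power2_eq_square)
    from DERIV_chain2[OF DERIV_real_sqrt this]
    have "((\<lambda>s. sqrt ((y - s) / (1 - s * y))) has_real_derivative
        (inverse (sqrt ((y - x) / (1 - x * y))) / 2 * (- (1 - y\<^sup>2) / (1 - x * y)\<^sup>2))) (at x)"
      using True xy1 by simp
    then have "((\<lambda>s. - 2 * sqrt ((y - s) / (1 - s * y))) has_real_derivative radial_dens y x) (at x)"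
      by (rule DERIV_cong[OF DERIV_cmult]) (use True in \<open>simp add: radial_dens_eq left_diff_distrib right_diff_distrib diff_divide_distrib mult.commute\<close>)
    then have "(radial_prim y has_real_derivative radial_dens y x) (at x)"
      by (rule has_field_derivative_transform_within_open[where S = "{..<y}"])
         (use True in \<open>auto simp: radial_prim_def\<close>)
    then show ?thesis by (simp add: has_real_derivative_iff_has_vector_derivative)
  next
    case False
    then have xy: "y < x" using x by simp
    have "((\<lambda>s. (s - y) / (1 - s * y)) has_real_derivative ((1 - y\<^sup>2) / (1 - x * y)\<^sup>2)) (at x)"
      using xy1 by (intro DERIV_cong[OF DERIV_divide[where D = 1 and E = "- y"]])
        (auto intro!: derivative_eq_intros simp: algebra_simps power2_eq_square)
    from DERIV_chain2[OF DERIV_real_sqrt this]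
    have "((\<lambda>s. sqrt ((s - y) / (1 - s * y))) has_real_derivative
        (inverse (sqrt ((x - y) / (1 - x * y))) / 2 * ((1 - y\<^sup>2) / (1 - x * y)\<^sup>2))) (at x)"
      using xy xy1 by simp
    then have "((\<lambda>s. 2 * sqrt ((s - y) / (1 - s * y))) has_real_derivative radial_dens y x) (at x)"
      by (rule DERIV_cong[OF DERIV_cmult]) (use xy in \<open>simp add: radial_dens_eq\<close>)
    then have "(radial_prim y has_real_derivative radial_dens y x) (at x)"
      by (rule has_field_derivative_transform_within_open[where S = "{y<..}"])
         (use xy in \<open>auto simp: radial_prim_def\<close>)
    then show ?thesis by (simp add: has_real_derivative_iff_has_vector_derivative)
  qed
qed (use assms in auto)

lemma abs_diff_div_less_1:
  fixes s y :: real
  assumes "0 \<le> y" "y < 1" "0 \<le> s" "s < 1"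
  shows "\<bar>s - y\<bar> / (1 - s * y) < 1"
  using pdist_less_1[of "of_real s" "of_real y"] assms
    pdist_ge_radial[of "of_real s" "of_real y"] by (simp add: mem_disk_iff)

lemma radial_prim_diff_less:
  assumes "0 \<le> y" "y < 1" "0 \<le> a" "a \<le> b" "b < 1"
  shows "radial_prim y b - radial_prim y a < 4"
proof -
  have "radial_prim y s < 2" "radial_prim y s > - 2" if s: "0 \<le> s" "s < 1" for s
  proof -
    have "s * y < 1" using s assms mult_strict_mono'[of s 1 y 1] by simp
    then have "sqrt (\<bar>s - y\<bar> / (1 - s * y)) < 1" "sqrt (\<bar>s - y\<bar> / (1 - s * y)) \<ge> 0"
      using abs_diff_div_less_1[of y s] assms s by auto
    moreover have "radial_prim y s = (if s \<le> y then -2 else 2) * sqrt (\<bar>s - y\<bar> / (1 - s * y))"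
      by (simp add: radial_prim_def)
    ultimately show "radial_prim y s < 2" "radial_prim y s > - 2"
      by (cases "s \<le> y"; simp only: if_True if_False; linarith)+
  qed
  from this[of a] this[of b] assms show ?thesis by auto
qed

lemma minus_ln_pdist_le_radial:
  assumes "z \<in> disk" "x \<in> disk" "cmod x \<noteq> cmod z"
  shows "- ln (pdist x z) \<le> (1 - (cmod x)\<^sup>2) * radial_dens (cmod z) (cmod x)"
proof -
  define s y where "s = cmod x" and "y = cmod z"
  have sy: "0 \<le> s" "s < 1" "0 \<le> y" "y < 1" "s \<noteq> y"
    using assms by (auto simp: s_def y_def mem_disk_iff)
  have sy1: "s * y < 1"
    using sy mult_strict_mono'[of s 1 y 1] by simp
  define t where "t = \<bar>s - y\<bar> / (1 - s * y)"
  have t: "0 < t" "t < 1" using sy sy1 abs_diff_div_less_1[of y s] by (auto simp: t_def)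
  have "t \<le> pdist x z" using pdist_ge_radial[OF assms(2,1)] by (simp add: t_def s_def y_def)
  then have "- ln (pdist x z) \<le> - ln t" using t by simp
  also have "\<dots> \<le> (1 - t) / sqrt t"
    using minus_ln_one_minus_le[of "1 - t"] t by simp
  \<comment> \<open>Passing from 1 - t to 1 - t^2 costs at most a factor 2 and makes the factor 1 -
    s^2 split off.\<close>
  also have "\<dots> \<le> (1 - t\<^sup>2) / sqrt t"
    using t by (intro divide_right_mono) (auto simp: power2_eq_square mult_le_cancel_left1)
  also have "1 - t\<^sup>2 = (1 - s\<^sup>2) * ((1 - y\<^sup>2) / (1 - s * y)\<^sup>2)"
    using sy1 by (simp add: t_def power_divide divide_simps) (simp add: algebra_simps power2_eq_square)
  finally show ?thesis
    by (simp add: radial_dens_def s_def y_def t_def)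
qed

text \<open>The contradiction of \<open>exists_prod_pdist_ge_center\<close> with the weight 1/(1 -
  s) for hyperbolic length. The primitives again contribute 4 per point and 1 - s^2 \<le> 2 (1 - s)
  a further factor 2, whence 8. The bound is absolute, with no reference product at a centre: on a
  long continuum the exponential rate is arbitrarily small.\<close>

lemma exists_prod_pdist_ge_radial:
  assumes "finite I" "\<And>i. i \<in> I \<Longrightarrow> z i \<in> disk" "K \<subseteq> disk"
    and d: "0 \<le> a" "a < b" "b < 1"
    and K: "\<And>s. a \<le> s \<Longrightarrow> s \<le> b \<Longrightarrow> \<exists>x\<in>K. cmod x = s"
  shows "\<exists>x\<in>K. exp (- 8 * real (card I) / ln ((1 - a) / (1 - b))) \<le> (\<Prod>i\<in>I. pdist x (z i))"
proof (cases "I = {}")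
  case True
  then show ?thesis using K[of a] d by auto
next
  case False
  define y where "y i = cmod (z i)" for i
  have y: "0 \<le> y i" "y i < 1" if "i \<in> I" for i
    using that assms by (auto simp: y_def mem_disk_iff)
  define L where "L = ln ((1 - a) / (1 - b))"
  have L: "L > 0" using d by (simp add: L_def)
  define n where "n = card I"
  show ?thesis
  proof (rule ccontr)
    assume neg: "\<not> ?thesis"
    have key: "4 * n / L * (1 / (1 - s)) \<le> (\<Sum>i\<in>I. radial_dens (y i) s)" if s: "s \<in> {a..b} - y ` I" for s
    proof -
      obtain x where x: "x \<in> K" "cmod x = s" using K[of s] s by auto
      have xd: "x \<in> disk" using x assms by auto
      have s0: "s \<ge> 0" "s < 1" using s d by auto
      have xz: "x \<noteq> z i" if "i \<in> I" for i
        using s x that by (auto simp: y_def)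
      have "(\<Prod>i\<in>I. pdist x (z i)) < exp (- 8 * real n / L)"
        using neg x s by (force simp: n_def L_def)
      moreover have "0 < (\<Prod>i\<in>I. pdist x (z i))"
        using xz assms xd by (intro prod_pos) (auto intro!: pdist_pos)
      ultimately have "ln (\<Prod>i\<in>I. pdist x (z i)) \<le> ln (exp (- 8 * real n / L))"
        by (intro ln_mono) auto
      also have "ln (\<Prod>i\<in>I. pdist x (z i)) = (\<Sum>i\<in>I. ln (pdist x (z i)))"
        using xz assms xd by (intro ln_prod) (auto dest!: pdist_eq_0_iff[THEN iffD1, rotated 2] intro!: pdist_pos)
      finally have "8 * real n / L \<le> (\<Sum>i\<in>I. - ln (pdist x (z i)))"
        by (simp add: sum_negf)
      also have "\<dots> \<le> (\<Sum>i\<in>I. (1 - s\<^sup>2) * radial_dens (y i) s)"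
      proof (rule sum_mono)
        fix i assume i: "i \<in> I"
        have "cmod x \<noteq> cmod (z i)" using s x i by (auto simp: y_def)
        then show "- ln (pdist x (z i)) \<le> (1 - s\<^sup>2) * radial_dens (y i) s"
          using minus_ln_pdist_le_radial[of "z i" x] assms xd i x by (simp add: y_def)
      qed
      also have "\<dots> = (1 - s\<^sup>2) * (\<Sum>i\<in>I. radial_dens (y i) s)"
        by (simp add: sum_distrib_left)
      also have "\<dots> \<le> 2 * (1 - s) * (\<Sum>i\<in>I. radial_dens (y i) s)"
      proof (rule mult_right_mono)
        have "1 - s\<^sup>2 = (1 + s) * (1 - s)" by (simp add: power2_eq_square algebra_simps)
        also have "\<dots> \<le> 2 * (1 - s)" using s0 by (intro mult_right_mono) auto
        finally show "1 - s\<^sup>2 \<le> 2 * (1 - s)" .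
        show "0 \<le> (\<Sum>i\<in>I. radial_dens (y i) s)"
        proof (rule sum_nonneg)
          fix i assume "i \<in> I"
          then have "s * y i < 1" "(y i)\<^sup>2 \<le> 1"
            using s0 y[of i] mult_strict_mono'[of s 1 "y i" 1] by (auto simp: power_le_one_iff)
          then show "0 \<le> radial_dens (y i) s" by (auto simp: radial_dens_def intro!: divide_nonneg_nonneg mult_nonneg_nonneg)
        qed
      qed
      finally show ?thesis
        using s0 L by (simp add: field_simps)
    qed
    have i1: "((\<lambda>s. 4 * n / L * (1 / (1 - s))) has_integral (4 * n / L * (- ln (1 - b) - - ln (1 - a)))) {a..b}"
    proof (intro has_integral_mult_right fundamental_theorem_of_calculus)
      fix x assume "x \<in> {a..b}"
      then show "((\<lambda>s. - ln (1 - s)) has_vector_derivative 1 / (1 - x)) (at x within {a..b})"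
        using d by (auto intro!: derivative_eq_intros simp flip: has_real_derivative_iff_has_vector_derivative)
    qed (use d in auto)
    have i2: "((\<lambda>s. \<Sum>i\<in>I. radial_dens (y i) s) has_integral (\<Sum>i\<in>I. radial_prim (y i) b - radial_prim (y i) a)) {a..b}"
      using assms y d by (intro has_integral_sum radial_dens_has_integral) auto
    have i3: "((\<lambda>s. if s \<in> y ` I then 4 * n / L * (1 / (1 - s)) else (\<Sum>i\<in>I. radial_dens (y i) s)) has_integral (\<Sum>i\<in>I. radial_prim (y i) b - radial_prim (y i) a)) {a..b}"
      by (rule has_integral_spike_finite[OF _ _ i2, where S = "y ` I"]) (use assms in auto)
    have "4 * n / L * (- ln (1 - b) - - ln (1 - a)) \<le> (\<Sum>i\<in>I. radial_prim (y i) b - radial_prim (y i) a)"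
      by (rule has_integral_le[OF i1 i3]) (use key in auto)
    also have "\<dots> < (\<Sum>i\<in>I. 4)"
      using False assms y d by (intro sum_strict_mono radial_prim_diff_less) auto
    also have "\<dots> = 4 * n" by (simp add: n_def)
    finally show False
      using L d by (simp add: L_def ln_div)
  qed
qed

section \<open>Hardy spaces and boundedness of composition operators\<close>

definition pkernel :: "real \<Rightarrow> complex \<Rightarrow> real \<Rightarrow> real" where
  "pkernel R w t = (R\<^sup>2 - (cmod w)\<^sup>2) / (cmod (of_real R * cis t - w))\<^sup>2"

lemma circle_minus_nz:
  assumes "cmod w < R"
  shows "of_real R * cis t - w \<noteq> 0"
proof
  assume "of_real R * cis t - w = 0"
  then have "cmod (of_real R * cis t) = cmod w" by simp
  then show False using assms norm_ge_zero[of w] by (simp add: norm_mult)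
qed

lemma pkernel_nonneg: "cmod w < R \<Longrightarrow> 0 \<le> pkernel R w t"
  unfolding pkernel_def by (intro divide_nonneg_nonneg) (auto simp: power_mono)

lemma pkernel_le:
  assumes "cmod w < R"
  shows "pkernel R w t \<le> (R + cmod w) / (R - cmod w)"
proof -
  have R: "R > 0" using assms norm_ge_zero[of w] by linarith
  have "R - cmod w \<le> cmod (of_real R * cis t - w)"
    using norm_triangle_ineq2[of "of_real R * cis t" w] R by (simp add: norm_mult)
  then have "(R - cmod w)\<^sup>2 \<le> (cmod (of_real R * cis t - w))\<^sup>2"
    using assms by (intro power_mono) auto
  then have "pkernel R w t \<le> (R\<^sup>2 - (cmod w)\<^sup>2) / (R - cmod w)\<^sup>2"
    unfolding pkernel_def using assms circle_minus_nz[OF assms]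
    by (intro divide_left_mono mult_pos_pos) (auto simp: power_mono)
  also have "R\<^sup>2 - (cmod w)\<^sup>2 = (R + cmod w) * (R - cmod w)"
    by (simp add: power2_eq_square algebra_simps)
  finally show ?thesis using assms by (simp add: power2_eq_square)
qed

lemma pkernel_eq_Re:
  assumes "cmod w < R"
  shows "pkernel R w t = Re ((of_real R * cis t + w) / (of_real R * cis t - w))"
proof -
  let ?z = "of_real R * cis t"
  have "Re ((?z + w) / (?z - w)) = Re ((?z + w) * cnj (?z - w)) / (cmod (?z - w))\<^sup>2"
    by (simp add: complex_div_cnj[of "?z + w"] Re_divide_of_real flip: of_real_power)
  also have "Re ((?z + w) * cnj (?z - w)) = (cmod ?z)\<^sup>2 - (cmod w)\<^sup>2"
    unfolding cmod_power2 by (simp add: algebra_simps power2_eq_square)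
  also have "(cmod ?z)\<^sup>2 = R\<^sup>2" by (simp add: norm_mult)
  finally show ?thesis by (simp add: pkernel_def)
qed

lemma circle_in_disk: "0 \<le> R \<Longrightarrow> R < 1 \<Longrightarrow> of_real R * cis t \<in> disk"
  by (simp add: mem_disk_iff norm_mult)

lemma continuous_on_circle:
  assumes "continuous_on disk f" "0 \<le> R" "R < 1"
  shows "continuous_on S (\<lambda>t. f (of_real R * cis t))"
  by (rule continuous_on_compose2[OF assms(1)])
     (auto intro!: continuous_intros circle_in_disk assms(2,3))

text \<open>Cauchy's formula at w for h, which is f times a factor equal to 1 at w; that factor is
  holomorphic on the closed disk of radius R and turns the Cauchy kernel on the circle into the
  Poisson kernel.\<close>

lemma Poisson_has_integral:
  assumes f: "f holomorphic_on disk" and w: "cmod w < R" and R: "R < 1"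
  shows "((\<lambda>t. of_real (pkernel R w t) * f (of_real R * cis t)) has_integral (2 * of_real pi * f w)) {0..2*pi}"
proof -
  have R0: "R > 0" using w norm_ge_zero[of w] by linarith
  define h where "h z = f z * (of_real (R\<^sup>2 - (cmod w)\<^sup>2) / (of_real (R\<^sup>2) - cnj w * z))" for z
  have nz: "of_real (R\<^sup>2) - cnj w * z \<noteq> 0" if "cmod z \<le> R" for z
  proof
    assume "of_real (R\<^sup>2) - cnj w * z = 0"
    then have "of_real (R\<^sup>2) = cnj w * z" by simp
    from arg_cong[OF this, of cmod] have "R\<^sup>2 = cmod w * cmod z"
      using R0 by (simp add: norm_mult norm_power)
    also have "\<dots> \<le> cmod w * R" using that by (intro mult_left_mono) auto
    also have "\<dots> < R * R" using w R0 by (intro mult_strict_right_mono) auto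
    finally show False by (simp add: power2_eq_square)
  qed
  have fc: "f holomorphic_on cball 0 R"
    by (rule holomorphic_on_subset[OF f]) (use R in \<open>auto simp: mem_disk_iff\<close>)
  have hh: "h holomorphic_on cball 0 R"
    unfolding h_def by (intro holomorphic_intros fc) (use nz in auto)
  have "((\<lambda>u. h u / (u - w)) has_contour_integral (2 * of_real pi * \<i> * h w)) (circlepath 0 R)"
    using hh w by (intro Cauchy_integral_circlepath holomorphic_on_imp_continuous_on)
      (auto intro: holomorphic_on_subset)
  then have "((\<lambda>t. h (of_real R * cis t) / (of_real R * cis t - w) * of_real R * \<i> * cis t) has_integral
       (2 * of_real pi * \<i> * h w)) {0..2*pi}"
    unfolding circlepath_def by (subst (asm) has_contour_integral_part_circlepath_iff) auto
  from has_integral_mult_right[OF this, of "- \<i>"]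
  have "((\<lambda>t. h (of_real R * cis t) / (of_real R * cis t - w) * of_real R * cis t) has_integral
       (2 * of_real pi * h w)) {0..2*pi}"
    by (simp add: algebra_simps)
  moreover have "h w = f w"
  proof -
    have "cnj w * w = of_real ((cmod w)\<^sup>2)"
      by (simp only: mult.commute[of "cnj w"] complex_norm_square[symmetric] of_real_power)
    then show ?thesis using nz[of w] w by (simp add: h_def)
  qed
  moreover have "h (of_real R * cis t) / (of_real R * cis t - w) * of_real R * cis t
      = of_real (pkernel R w t) * f (of_real R * cis t)" for t
  proof -
    define u where "u = of_real R * cis t"
    have u: "u \<noteq> 0" "cmod u = R" using R0 by (auto simp: u_def norm_mult)
    have uw: "u - w \<noteq> 0" using circle_minus_nz[OF w] by (simp add: u_def)
    have RR: "of_real (R\<^sup>2) = u * cnj u"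
      using u by (simp only: complex_norm_square[symmetric] of_real_power)
    have 1: "of_real (R\<^sup>2) - cnj w * u = u * cnj (u - w)"
      unfolding RR by (simp add: algebra_simps)
    have 2: "of_real ((cmod (u - w))\<^sup>2) = (u - w) * cnj (u - w)"
      by (simp only: complex_norm_square[symmetric] of_real_power)
    have "h u / (u - w) * u = of_real (R\<^sup>2 - (cmod w)\<^sup>2) / ((u - w) * cnj (u - w)) * f u"
      unfolding h_def 1 using u by (simp add: mult_ac)
    also have "\<dots> = of_real (pkernel R w t) * f u"
      unfolding pkernel_def u_def[symmetric] 2[symmetric] by (simp only: of_real_divide)
    finally show ?thesis by (simp add: u_def mult.assoc)
  qed
  ultimately show ?thesis by simp
qed

lemma pkernel_has_integral:
  assumes "cmod w < R" "R < 1"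
  shows "(pkernel R w has_integral 2 * pi) {0..2*pi}"
  using has_integral_Re[OF Poisson_has_integral[of "\<lambda>_. 1" w R]] assms
  by (simp add: holomorphic_on_const)

lemma continuous_on_pkernel: "cmod w < R \<Longrightarrow> continuous_on S (pkernel R w)"
  unfolding pkernel_def using circle_minus_nz[of w R]
  by (intro continuous_intros) auto

text \<open>Tangent line of the convex function x^p at a; integrated against a probability density
  it yields Jensen's inequality. The value x = 0 lies outside the open half-line used for convexity
  and is checked by hand.\<close>

lemma powr_ge_tangent:
  fixes a x p :: real
  assumes "a > 0" "x \<ge> 0" "p \<ge> 1"
  shows "a powr p + p * a powr (p - 1) * (x - a) \<le> x powr p"
proof (cases "x = 0")
  case True
  have "a powr (p - 1) * a = a powr p"
    using assms by (simp add: powr_diff)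
  then have "a powr p + p * a powr (p - 1) * (x - a) = (1 - p) * a powr p"
    using True by (simp add: algebra_simps)
  also have "\<dots> \<le> 0" using assms by (intro mult_nonpos_nonneg) auto
  finally show ?thesis using True by simp
next
  case False
  have "p * a powr (p - 1) * (x - a) \<le> x powr p - a powr p"
    by (rule convex_on_imp_above_tangent[where A = "{0<..}", OF powr_convex[OF assms(3)]])
       (use assms False in \<open>auto intro!: derivative_eq_intros simp: interior_open\<close>)
  then show ?thesis by simp
qed

lemma continuous_on_cmod_powr:
  assumes "continuous_on S f" "p > 0"
  shows "continuous_on S (\<lambda>x. cmod (f x) powr p)"
  using assms by (intro continuous_on_powr' continuous_intros) auto

text \<open>Subharmonicity of |f|^p: with a = |f w| > 0, average the tangent inequality at a against
  the Poisson kernel and use that the average of |f| is at least a, the slope being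
  nonnegative.\<close>

lemma cmod_powr_le_Poisson:
  assumes f: "f holomorphic_on disk" and w: "cmod w < R" and R: "R < 1" and p: "p \<ge> 1"
  shows "2 * pi * cmod (f w) powr p \<le> integral {0..2*pi} (\<lambda>t. pkernel R w t * cmod (f (of_real R * cis t)) powr p)"
proof (cases "f w = 0")
  case True
  have "0 \<le> integral {0..2*pi} (\<lambda>t. pkernel R w t * cmod (f (of_real R * cis t)) powr p)"
    using p by (intro Henstock_Kurzweil_Integration.integral_nonneg mult_nonneg_nonneg pkernel_nonneg w
       integrable_continuous_real continuous_on_mult continuous_on_pkernel continuous_on_cmod_powr
       continuous_on_circle holomorphic_on_imp_continuous_on f R
       order.strict_implies_order[OF le_less_trans[OF norm_ge_zero w]]) auto
  then show ?thesis using True by simp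
next
  case False
  have R0: "R \<ge> 0" using w norm_ge_zero[of w] by linarith
  have cf: "continuous_on S (\<lambda>t. f (of_real R * cis t))" for S
    by (rule continuous_on_circle[OF holomorphic_on_imp_continuous_on[OF f] R0 R])
  define F where "F t = cmod (f (of_real R * cis t))" for t
  have cF: "continuous_on S F" for S unfolding F_def by (intro continuous_intros cf)
  have cFp: "continuous_on S (\<lambda>t. F t powr p)" for S
    unfolding F_def by (intro continuous_on_cmod_powr cf) (use p in simp)
  define a where "a = cmod (f w)"
  have a: "a > 0" using False by (simp add: a_def)
  define A where "A = integral {0..2*pi} (\<lambda>t. pkernel R w t * F t)"
  have iA: "((\<lambda>t. pkernel R w t * F t) has_integral A) {0..2*pi}"
    unfolding A_def by (intro integrable_integral integrable_continuous_real continuous_intros continuous_on_pkernel w cF)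
  have P: "((\<lambda>t. of_real (pkernel R w t) * f (of_real R * cis t)) has_integral (2 * of_real pi * f w)) {0..2*pi}"
    by (rule Poisson_has_integral[OF f w R])
  have "cmod (2 * of_real pi * f w) \<le> A"
    unfolding integral_unique[OF P, symmetric] A_def
    by (rule integral_norm_bound_integral)
       (use P iA pkernel_nonneg[OF w] in \<open>auto simp: F_def norm_mult\<close>)
  then have Age: "2 * pi * a \<le> A" by (simp add: a_def norm_mult)
  have "((\<lambda>t. (a powr p - p * a powr (p - 1) * a) * pkernel R w t + p * a powr (p - 1) * (pkernel R w t * F t))
      has_integral ((a powr p - p * a powr (p - 1) * a) * (2 * pi) + p * a powr (p - 1) * A)) {0..2*pi}"
    by (intro has_integral_add has_integral_mult_right pkernel_has_integral iA w R)
  then have "(a powr p - p * a powr (p - 1) * a) * (2 * pi) + p * a powr (p - 1) * A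
      \<le> integral {0..2*pi} (\<lambda>t. pkernel R w t * F t powr p)"
  proof (rule has_integral_le)
    show "((\<lambda>t. pkernel R w t * F t powr p) has_integral integral {0..2*pi} (\<lambda>t. pkernel R w t * F t powr p)) {0..2*pi}"
      by (intro integrable_integral integrable_continuous_real continuous_intros continuous_on_pkernel w cFp)
    fix t
    have "pkernel R w t * (a powr p + p * a powr (p - 1) * (F t - a)) \<le> pkernel R w t * F t powr p"
      by (intro mult_left_mono powr_ge_tangent a p pkernel_nonneg w) (simp add: F_def)
    then show "(a powr p - p * a powr (p - 1) * a) * pkernel R w t + p * a powr (p - 1) * (pkernel R w t * F t)
        \<le> pkernel R w t * F t powr p"
      by (simp add: algebra_simps)
  qed
  moreover have "p * a powr (p - 1) * (2 * pi * a) \<le> p * a powr (p - 1) * A"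
    using Age p by (intro mult_left_mono) auto
  ultimately show ?thesis
    by (simp add: a_def F_def algebra_simps)
qed

lemma int_mean_nonneg:
  assumes "f holomorphic_on disk" "0 \<le> r" "r < 1" "p \<ge> 1"
  shows "0 \<le> int_mean p f r"
  unfolding int_mean_def
  by (intro mult_nonneg_nonneg Henstock_Kurzweil_Integration.integral_nonneg integrable_continuous_real
       continuous_on_cmod_powr continuous_on_circle holomorphic_on_imp_continuous_on assms)
     (use assms in auto)

lemma cmod_powr_le_int_mean:
  assumes f: "f holomorphic_on disk" and w: "cmod w < R" and R: "R < 1" and p: "p \<ge> 1"
  shows "cmod (f w) powr p \<le> (R + cmod w) / (R - cmod w) * int_mean p f R"
proof -
  have R0: "R \<ge> 0" using w norm_ge_zero[of w] by linarith
  have cF: "continuous_on S (\<lambda>t. cmod (f (of_real R * cis t)) powr p)" for S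
    using p by (intro continuous_on_cmod_powr continuous_on_circle holomorphic_on_imp_continuous_on f R0 R) auto
  have "2 * pi * cmod (f w) powr p \<le> integral {0..2*pi} (\<lambda>t. pkernel R w t * cmod (f (of_real R * cis t)) powr p)"
    by (rule cmod_powr_le_Poisson[OF assms])
  also have "\<dots> \<le> integral {0..2*pi} (\<lambda>t. (R + cmod w) / (R - cmod w) * cmod (f (of_real R * cis t)) powr p)"
    by (intro integral_le integrable_continuous_real continuous_intros continuous_on_pkernel w cF
        mult_right_mono pkernel_le) auto
  also have "\<dots> = (R + cmod w) / (R - cmod w) * (2 * pi * int_mean p f R)"
    by (simp add: int_mean_def)
  also have "\<dots> = 2 * pi * ((R + cmod w) / (R - cmod w) * int_mean p f R)"
    by (rule mult.left_commute)
  finally show ?thesis by (rule mult_left_le_imp_le) simp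
qed

section \<open>Elementary estimates for the H^p norm\<close>

lemma Hp_holo: "f \<in> Hp p \<Longrightarrow> f holomorphic_on disk"
  and Hp_bdd: "f \<in> Hp p \<Longrightarrow> bdd_above (int_mean p f ` {0..<1})"
  by (auto simp: Hp_def)

lemma hp_norm_nonneg [simp]: "0 \<le> hp_norm p f"
  by (simp add: hp_norm_def)

lemma int_mean_le_hp_norm:
  assumes f: "f \<in> Hp p" and p: "p \<ge> 1" and r: "0 \<le> r" "r < 1"
  shows "int_mean p f r \<le> hp_norm p f powr p"
proof -
  have "int_mean p f r \<le> (SUP r\<in>{0..<1}. int_mean p f r)"
    using r by (intro cSUP_upper Hp_bdd f) auto
  moreover have "0 \<le> int_mean p f r"
    by (rule int_mean_nonneg[OF Hp_holo[OF f] r p])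
  ultimately show ?thesis
    using p by (simp add: hp_norm_def powr_powr)
qed

lemma hp_norm_le:
  assumes p: "p \<ge> 1" and C: "C \<ge> 0" and f: "f holomorphic_on disk"
    and le: "\<And>r. 0 \<le> r \<Longrightarrow> r < 1 \<Longrightarrow> int_mean p f r \<le> C powr p"
  shows "hp_norm p f \<le> C"
proof -
  have bdd: "bdd_above (int_mean p f ` {0..<1})"
    using le by (intro bdd_aboveI[of _ "C powr p"]) auto
  have "0 \<le> int_mean p f 0" by (rule int_mean_nonneg[OF f _ _ p]) auto
  also have "\<dots> \<le> (SUP r\<in>{0..<1}. int_mean p f r)"
    using bdd by (intro cSUP_upper) auto
  finally have "0 \<le> (SUP r\<in>{0..<1}. int_mean p f r)" .
  moreover have "(SUP r\<in>{0..<1}. int_mean p f r) \<le> C powr p"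
    using le by (intro cSUP_least) auto
  ultimately have "hp_norm p f \<le> (C powr p) powr (1 / p)"
    unfolding hp_norm_def using p by (intro powr_mono2) auto
  also have "\<dots> = C" using p C by (simp add: powr_powr)
  finally show ?thesis .
qed

text \<open>The mean over the circle halfway between r and 1 bounds |f w|^p by 4/(1 - r) times the
  p-th power of the norm. As 4/(1 - r) \<ge> 1, it may be replaced by its own p-th power, which
  gives a constant free of p.\<close>

lemma cmod_le_hp_norm:
  assumes f: "f \<in> Hp p" and p: "p \<ge> 1" and w: "cmod w \<le> r" "r < 1"
  shows "cmod (f w) \<le> 4 / (1 - r) * hp_norm p f"
proof -
  have r0: "0 \<le> r" using w norm_ge_zero[of w] by linarith
  define R where "R = (1 + r) / 2"
  have R: "cmod w < R" "R < 1" "0 \<le> R" using w r0 by (auto simp: R_def)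
  have "cmod (f w) powr p \<le> (R + cmod w) / (R - cmod w) * int_mean p f R"
    by (rule cmod_powr_le_int_mean[OF Hp_holo[OF f] R(1,2) p])
  also have "\<dots> \<le> 2 / ((1 - r) / 2) * hp_norm p f powr p"
  proof (rule mult_mono)
    show "(R + cmod w) / (R - cmod w) \<le> 2 / ((1 - r) / 2)"
      using R w r0 by (intro frac_le) (auto simp: R_def field_simps)
    show "int_mean p f R \<le> hp_norm p f powr p"
      by (rule int_mean_le_hp_norm[OF f p R(3,2)])
  qed (use R w in \<open>auto intro!: int_mean_nonneg Hp_holo[OF f] p\<close>)
  also have "\<dots> = 4 / (1 - r) * hp_norm p f powr p" by simp
  also have "\<dots> \<le> (4 / (1 - r)) powr p * hp_norm p f powr p"
  proof (rule mult_right_mono)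
    have "4 / (1 - r) \<ge> 1" using w r0 by simp
    then show "4 / (1 - r) \<le> (4 / (1 - r)) powr p"
      using p w powr_mono[of 1 p "4 / (1 - r)"] by simp
  qed simp
  also have "\<dots> = (4 / (1 - r) * hp_norm p f) powr p"
    by (rule powr_mult[symmetric])
  finally have le: "cmod (f w) powr p \<le> (4 / (1 - r) * hp_norm p f) powr p" .
  show ?thesis
  proof (rule ccontr)
    assume "\<not> ?thesis"
    then have "(4 / (1 - r) * hp_norm p f) powr p < cmod (f w) powr p"
      using p w by (intro powr_less_mono2) auto
    then show False using le by simp
  qed
qed

lemma bounded_holomorphic_in_Hp:
  assumes p: "p \<ge> 1" and f: "f holomorphic_on disk" and out: "\<And>z. z \<notin> disk \<Longrightarrow> f z = 0"
    and M: "\<And>z. z \<in> disk \<Longrightarrow> cmod (f z) \<le> M"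
  shows "f \<in> Hp p" "hp_norm p f \<le> M"
proof -
  have "cmod (f 0) \<le> M" using M[of 0] by (simp add: mem_disk_iff)
  then have M0: "0 \<le> M" by (rule order_trans[OF norm_ge_zero])
  have le: "int_mean p f r \<le> M powr p" if r: "0 \<le> r" "r < 1" for r
  proof -
    have "integral {0..2*pi} (\<lambda>t. cmod (f (of_real r * cis t)) powr p) \<le> integral {0..2*pi} (\<lambda>t. M powr p)"
      using p M0 r by (intro integral_le integrable_continuous_real continuous_on_cmod_powr continuous_on_circle
           holomorphic_on_imp_continuous_on f powr_mono2 M circle_in_disk) auto
    also have "\<dots> = 2 * pi * M powr p" by simp
    finally show ?thesis by (simp add: int_mean_def field_simps)
  qed
  show "f \<in> Hp p" using f out le by (auto simp: Hp_def intro!: bdd_aboveI[of _ "M powr p"])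
  show "hp_norm p f \<le> M" by (rule hp_norm_le[OF p M0 f le])
qed

lemma int_mean_diff_le:
  assumes f: "f holomorphic_on disk" and g: "g holomorphic_on disk" and p: "p \<ge> 1" and r: "0 \<le> r" "r < 1"
  shows "int_mean p (\<lambda>z. f z - g z) r \<le> 2 powr p * (int_mean p f r + int_mean p g r)"
proof -
  have c: "continuous_on S (\<lambda>t. cmod (h (of_real r * cis t)) powr p)" if "h holomorphic_on disk" for h S
    using p by (intro continuous_on_cmod_powr continuous_on_circle holomorphic_on_imp_continuous_on that r) auto
  have "integral {0..2*pi} (\<lambda>t. cmod (f (of_real r * cis t) - g (of_real r * cis t)) powr p)
      \<le> integral {0..2*pi} (\<lambda>t. 2 powr p * (cmod (f (of_real r * cis t)) powr p + cmod (g (of_real r * cis t)) powr p))"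
  proof (rule integral_le)
    show "(\<lambda>t. cmod (f (of_real r * cis t) - g (of_real r * cis t)) powr p) integrable_on {0..2 * pi}"
      using c[of "\<lambda>z. f z - g z"] f g by (intro integrable_continuous_real) (simp add: holomorphic_on_diff)
    show "(\<lambda>t. 2 powr p * (cmod (f (of_real r * cis t)) powr p + cmod (g (of_real r * cis t)) powr p)) integrable_on {0..2 * pi}"
      by (intro integrable_continuous_real continuous_on_mult continuous_on_add continuous_on_const c f g)
    fix t
    let ?a = "cmod (f (of_real r * cis t))" and ?b = "cmod (g (of_real r * cis t))"
    have "cmod (f (of_real r * cis t) - g (of_real r * cis t)) \<le> 2 * max ?a ?b"
      using norm_triangle_ineq4[of "f (of_real r * cis t)" "g (of_real r * cis t)"] by linarith
    then have "cmod (f (of_real r * cis t) - g (of_real r * cis t)) powr p \<le> (2 * max ?a ?b) powr p"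
      using p by (intro powr_mono2) auto
    also have "\<dots> = 2 powr p * max ?a ?b powr p" by (simp add: powr_mult le_max_iff_disj)
    also have "\<dots> \<le> 2 powr p * (?a powr p + ?b powr p)"
      by (intro mult_left_mono) (auto simp: max_def)
    finally show "cmod (f (of_real r * cis t) - g (of_real r * cis t)) powr p \<le> 2 powr p * (?a powr p + ?b powr p)" .
  qed
  also have "\<dots> = 2 powr p * (2 * pi * (int_mean p f r + int_mean p g r))"
    unfolding int_mean_def integral_mult_right
    by (subst integral_add) (intro integrable_continuous_real c f g | simp add: field_simps)+
  also have "\<dots> = 2 * pi * (2 powr p * (int_mean p f r + int_mean p g r))"
    by (rule mult.left_commute)
  also have "integral {0..2*pi} (\<lambda>t. cmod (f (of_real r * cis t) - g (of_real r * cis t)) powr p)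
      = 2 * pi * int_mean p (\<lambda>z. f z - g z) r"
    by (simp add: int_mean_def)
  finally show ?thesis by (rule mult_left_le_imp_le) simp
qed

text \<open>Crude form of Minkowski's inequality: (x + y)^p \<le> 2^p max(x,y)^p and 2 \<le> 2^p
  give the constant 4. It serves to show that the suprema in \<open>op_norm\<close> are
  finite.\<close>

lemma hp_norm_diff_le:
  assumes f: "f \<in> Hp p" and g: "g \<in> Hp p" and p: "p \<ge> 1"
  shows "hp_norm p (\<lambda>z. f z - g z) \<le> 4 * (hp_norm p f + hp_norm p g)"
proof (rule hp_norm_le[OF p])
  show "(\<lambda>z. f z - g z) holomorphic_on disk" using f g by (intro holomorphic_intros Hp_holo)
  fix r :: real assume r: "0 \<le> r" "r < 1"
  let ?m = "hp_norm p f + hp_norm p g"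
  have "int_mean p (\<lambda>z. f z - g z) r \<le> 2 powr p * (int_mean p f r + int_mean p g r)"
    by (rule int_mean_diff_le[OF Hp_holo[OF f] Hp_holo[OF g] p r])
  also have "\<dots> \<le> 2 powr p * (?m powr p + ?m powr p)"
  proof (intro mult_left_mono add_mono)
    show "int_mean p f r \<le> ?m powr p"
      using int_mean_le_hp_norm[OF f p r] powr_mono2[of p "hp_norm p f" ?m] p by simp
    show "int_mean p g r \<le> ?m powr p"
      using int_mean_le_hp_norm[OF g p r] powr_mono2[of p "hp_norm p g" ?m] p by simp
  qed simp
  also have "\<dots> = 2 powr p * 2 powr 1 * ?m powr p" by simp
  also have "\<dots> \<le> 2 powr p * 2 powr p * ?m powr p"
    using p by (intro mult_right_mono mult_left_mono powr_mono) auto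
  also have "\<dots> = (4 * ?m) powr p"
    by (simp add: powr_mult[symmetric])
  finally show "int_mean p (\<lambda>z. f z - g z) r \<le> (4 * ?m) powr p" .
qed simp

text \<open>In its centre variable the Poisson kernel is the real part of a holomorphic function, so
  composed with \<phi> it is harmonic and has the mean value property.\<close>

lemma pkernel_comp_has_integral:
  assumes \<phi>: "\<phi> holomorphic_on disk" and r: "0 \<le> r" "r < 1"
    and R: "\<And>z. cmod z \<le> r \<Longrightarrow> cmod (\<phi> z) < R"
  shows "((\<lambda>s. pkernel R (\<phi> (of_real r * cis s)) t) has_integral 2 * pi * pkernel R (\<phi> 0) t) {0..2*pi}"
proof (cases "r = 0")
  case True
  show ?thesis using True has_integral_const_real[of "pkernel R (\<phi> 0) t" 0 "2 * pi"] by simp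
next
  case False
  have r0: "r > 0" using r False by simp
  define h where "h z = (of_real R * cis t + \<phi> z) / (of_real R * cis t - \<phi> z)" for z
  have fc: "\<phi> holomorphic_on cball 0 r"
    by (rule holomorphic_on_subset[OF \<phi>]) (use r in \<open>auto simp: mem_disk_iff\<close>)
  have hh: "h holomorphic_on cball 0 r"
    unfolding h_def by (intro holomorphic_intros fc) (use circle_minus_nz R in auto)
  have "((\<lambda>u. h u / (u - 0)) has_contour_integral (2 * of_real pi * \<i> * h 0)) (circlepath 0 r)"
    using hh r0 by (intro Cauchy_integral_circlepath holomorphic_on_imp_continuous_on)
      (auto intro: holomorphic_on_subset)
  then have "((\<lambda>s. h (of_real r * cis s) / (of_real r * cis s) * of_real r * \<i> * cis s) has_integral
       (2 * of_real pi * \<i> * h 0)) {0..2*pi}"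
    unfolding circlepath_def by (subst (asm) has_contour_integral_part_circlepath_iff) auto
  from has_integral_mult_right[OF this, of "- \<i>"]
  have int: "((\<lambda>s. h (of_real r * cis s)) has_integral (2 * of_real pi * h 0)) {0..2*pi}"
    using r0 by (simp add: algebra_simps)
  have Re_eq: "Re (of_real (2 * pi) * h 0) = 2 * pi * Re (h 0)"
    by (simp only: times_complex.sel Re_complex_of_real Im_complex_of_real mult_zero_left diff_zero)
  from int have "((\<lambda>s. Re (h (of_real r * cis s))) has_integral Re (of_real (2 * pi) * h 0)) {0..2*pi}"
    by (intro has_integral_Re) simp
  then show ?thesis
    unfolding Re_eq using pkernel_eq_Re[OF R] r by (simp add: h_def norm_mult)
qed

text \<open>Littlewood's subordination principle: majorise |f(\<phi>)|^p by a Poisson integral over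
  |u| = R, exchange the integrals, apply the mean value property in z, and bound the remaining
  kernel with centre \<phi>(0).\<close>

lemma int_mean_comp_le:
  assumes p: "p \<ge> 1" and \<phi>: "\<phi> holomorphic_on disk" "\<phi> ` disk \<subseteq> disk"
    and f: "f \<in> Hp p" and r: "0 \<le> r" "r < 1"
  shows "int_mean p (comp_op \<phi> f) r \<le> 4 / (1 - cmod (\<phi> 0)) * hp_norm p f powr p"
proof -
  define q where "q = cmod (\<phi> 0)"
  have q: "0 \<le> q" "q < 1" using \<phi>(2) by (auto simp: q_def mem_disk_iff image_subset_iff)
  have sub: "cball 0 r \<subseteq> disk" using r by (auto simp: mem_disk_iff)
  have "compact ((\<lambda>z. cmod (\<phi> z)) ` cball 0 r)"
    using sub \<phi>(1) by (intro compact_continuous_image continuous_intros holomorphic_on_imp_continuous_on)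
      (auto intro: holomorphic_on_subset)
  then obtain z0 where z0: "z0 \<in> cball 0 r" "\<And>z. z \<in> cball 0 r \<Longrightarrow> cmod (\<phi> z) \<le> cmod (\<phi> z0)"
    using compact_attains_sup[of "(\<lambda>z. cmod (\<phi> z)) ` cball 0 r"] r by fastforce
  have z01: "cmod (\<phi> z0) < 1" using \<phi>(2) z0(1) sub by (auto simp: mem_disk_iff image_subset_iff)
  \<comment> \<open>R lies above the maximum of |\<phi>| on the disk of radius r, yet R - q \<ge> (1
    - q)/2, so the kernel bound does not depend on r.\<close>
  define R where "R = (1 + max q (cmod (\<phi> z0))) / 2"
  have R: "R < 1" "0 \<le> R" "cmod (\<phi> z0) < R" "R - q \<ge> (1 - q) / 2" "q < R"
    using z01 q by (auto simp: R_def)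
  have lt: "cmod (\<phi> z) < R" if "cmod z \<le> r" for z
    using z0(2)[of z] that R by simp
  define F where "F t = cmod (f (of_real R * cis t)) powr p" for t
  have cF: "continuous_on S F" for S
    unfolding F_def using p R
    by (intro continuous_on_cmod_powr continuous_on_circle holomorphic_on_imp_continuous_on Hp_holo[OF f]) auto
  define c where "c s = \<phi> (of_real r * cis s)" for s
  have cc: "continuous_on S c" for S
    unfolding c_def by (intro continuous_on_circle holomorphic_on_imp_continuous_on \<phi> r)
  have clt: "cmod (c s) < R" for s unfolding c_def by (intro lt) (use r in \<open>simp add: norm_mult\<close>)
  have c2: "continuous_on T (\<lambda>(s, t). pkernel R (c s) t * F t)" for T
    unfolding pkernel_def split_beta using circle_minus_nz[OF clt]
    by (intro continuous_intros continuous_on_compose2[OF cc[of UNIV]] continuous_on_compose2[OF cF[of UNIV]]) auto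
  have "2 * pi * integral {0..2*pi} (\<lambda>s. cmod (f (c s)) powr p)
      = integral {0..2*pi} (\<lambda>s. 2 * pi * cmod (f (c s)) powr p)" by simp
  also have "\<dots> \<le> integral {0..2*pi} (\<lambda>s. integral {0..2*pi} (\<lambda>t. pkernel R (c s) t * F t))"
  proof (rule integral_le)
    have "continuous_on {0..2*pi} (\<lambda>s. f (c s))"
      by (rule continuous_on_compose2[OF holomorphic_on_imp_continuous_on[OF Hp_holo[OF f]] cc])
         (use less_trans[OF clt R(1)] in \<open>auto simp: mem_disk_iff\<close>)
    then show "(\<lambda>s. 2 * pi * cmod (f (c s)) powr p) integrable_on {0..2*pi}"
      using p by (intro integrable_continuous_real continuous_intros continuous_on_cmod_powr) auto
    show "(\<lambda>s. integral {0..2*pi} (\<lambda>t. pkernel R (c s) t * F t)) integrable_on {0..2*pi}"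
      using integral_continuous_on_param[of "cbox 0 (2*pi)" 0 "2*pi" "\<lambda>s t. pkernel R (c s) t * F t"] c2
      by (intro integrable_continuous_real) (simp add: cbox_interval)
    fix s
    show "2 * pi * cmod (f (c s)) powr p \<le> integral {0..2*pi} (\<lambda>t. pkernel R (c s) t * F t)"
      unfolding F_def by (rule cmod_powr_le_Poisson[OF Hp_holo[OF f] clt R(1) p])
  qed
  also have "\<dots> = integral {0..2*pi} (\<lambda>t. integral {0..2*pi} (\<lambda>s. pkernel R (c s) t * F t))"
    using integral_swap_continuous[of 0 0 "2*pi" "2*pi" "\<lambda>s t. pkernel R (c s) t * F t"] c2
    by (simp add: cbox_interval)
  also have "\<dots> = integral {0..2*pi} (\<lambda>t. 2 * pi * (pkernel R (\<phi> 0) t * F t))"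
    using integral_unique[OF pkernel_comp_has_integral[OF \<phi>(1) r lt]] by (simp add: c_def mult.assoc)
  also have "\<dots> \<le> integral {0..2*pi} (\<lambda>t. 2 * pi * (4 / (1 - q) * F t))"
  proof (intro integral_le integrable_continuous_real continuous_intros continuous_on_pkernel cF mult_left_mono mult_right_mono)
    show "cmod (\<phi> 0) < R" using R by (simp add: q_def)
    fix t
    have "pkernel R (\<phi> 0) t \<le> (R + q) / (R - q)"
      unfolding q_def by (rule pkernel_le) (use R in \<open>simp add: q_def\<close>)
    also have "\<dots> \<le> 2 / ((1 - q) / 2)" using R q by (intro frac_le) auto
    finally show "pkernel R (\<phi> 0) t \<le> 4 / (1 - q)" by simp
  qed (auto simp: F_def)
  also have "\<dots> = 2 * pi * (4 / (1 - q) * (2 * pi * int_mean p f R))"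
    by (simp add: int_mean_def F_def)
  also have "\<dots> \<le> 2 * pi * (4 / (1 - q) * (2 * pi * hp_norm p f powr p))"
    using q R by (intro mult_left_mono int_mean_le_hp_norm f p) auto
  also have "\<dots> = 2 * pi * (2 * pi * (4 / (1 - q) * hp_norm p f powr p))"
    by (simp only: mult.left_commute)
  finally have "integral {0..2*pi} (\<lambda>s. cmod (f (c s)) powr p) \<le> 2 * pi * (4 / (1 - q) * hp_norm p f powr p)"
    by (rule mult_left_le_imp_le) simp
  moreover have "int_mean p (comp_op \<phi> f) r = integral {0..2*pi} (\<lambda>s. cmod (f (c s)) powr p) / (2 * pi)"
    using circle_in_disk[OF r] by (simp add: int_mean_def comp_op_def c_def)
  ultimately have "2 * pi * int_mean p (comp_op \<phi> f) r \<le> 2 * pi * (4 / (1 - q) * hp_norm p f powr p)"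
    by simp
  then show ?thesis
    unfolding q_def by (rule mult_left_le_imp_le) simp
qed

lemma comp_op_holomorphic:
  assumes "\<phi> holomorphic_on disk" "\<phi> ` disk \<subseteq> disk" "f holomorphic_on disk"
  shows "comp_op \<phi> f holomorphic_on disk"
proof -
  have "(f \<circ> \<phi>) holomorphic_on disk"
    by (rule holomorphic_on_compose_gen[OF assms(1,3,2)])
  then show ?thesis
    by (rule holomorphic_transform) (simp add: comp_op_def)
qed

lemma bounded_op_comp_op:
  assumes p: "p \<ge> 1" and \<phi>: "\<phi> holomorphic_on disk" "\<phi> ` disk \<subseteq> disk"
  shows "bounded_op p (comp_op \<phi>)"
proof -
  have q: "cmod (\<phi> 0) < 1" using \<phi>(2) by (auto simp: mem_disk_iff image_subset_iff)
  have "4 / (1 - cmod (\<phi> 0)) \<ge> 1" using q norm_ge_zero[of "\<phi> 0"] by (simp add: del: norm_ge_zero)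
  then have C: "4 / (1 - cmod (\<phi> 0)) \<le> (4 / (1 - cmod (\<phi> 0))) powr p"
    using p q powr_mono[of 1 p "4 / (1 - cmod (\<phi> 0))"] by simp
  have im: "int_mean p (comp_op \<phi> f) r \<le> (4 / (1 - cmod (\<phi> 0)) * hp_norm p f) powr p"
    if "f \<in> Hp p" "0 \<le> r" "r < 1" for f r
  proof -
    have "int_mean p (comp_op \<phi> f) r \<le> 4 / (1 - cmod (\<phi> 0)) * hp_norm p f powr p"
      by (rule int_mean_comp_le[OF p \<phi> that])
    also have "\<dots> \<le> (4 / (1 - cmod (\<phi> 0))) powr p * hp_norm p f powr p"
      by (intro mult_right_mono C) simp
    also have "\<dots> = (4 / (1 - cmod (\<phi> 0)) * hp_norm p f) powr p"
      by (rule powr_mult[symmetric])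
    finally show ?thesis .
  qed
  have "comp_op \<phi> f \<in> Hp p" if "f \<in> Hp p" for f
    using im[OF that] comp_op_holomorphic[OF \<phi> Hp_holo[OF that]]
    by (auto simp: Hp_def comp_op_def intro!: bdd_aboveI[of _ "(4 / (1 - cmod (\<phi> 0)) * hp_norm p f) powr p"])
  moreover have "hp_norm p (comp_op \<phi> f) \<le> 4 / (1 - cmod (\<phi> 0)) * hp_norm p f" if "f \<in> Hp p" for f
    by (rule hp_norm_le[OF p _ comp_op_holomorphic[OF \<phi> Hp_holo[OF that]] im[OF that]]) (use q in auto)
  ultimately show ?thesis
    unfolding bounded_op_def
    by (intro conjI exI[of _ "4 / (1 - cmod (\<phi> 0))"]) (auto simp: comp_op_def fun_eq_iff)
qed

section \<open>Fekete points and Green energy\<close>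

definition point_prod :: "nat \<Rightarrow> (nat \<Rightarrow> complex) \<Rightarrow> nat \<Rightarrow> real" where
  "point_prod n w j = (\<Prod>i\<in>{..<n}-{j}. pdist (w j) (w i))"

text \<open>The product runs over ordered pairs, so each pair counts twice. Its natural scale is
  c^(n^2), that of a single \<open>point_prod\<close> is c^n.\<close>

definition fekete :: "nat \<Rightarrow> (nat \<Rightarrow> complex) \<Rightarrow> real" where
  "fekete n w = (\<Prod>j<n. point_prod n w j)"

text \<open>The j-th point meets every other point twice, once in its own factor and once in the
  other's; what remains does not involve it. This lets one point be exchanged for another.\<close>

lemma fekete_split:
  assumes "j < n"
  shows "fekete n v = (point_prod n v j)\<^sup>2 * (\<Prod>k\<in>{..<n}-{j}. \<Prod>i\<in>{..<n}-{j}-{k}. pdist (v k) (v i))"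
proof -
  have "fekete n v = point_prod n v j * (\<Prod>k\<in>{..<n}-{j}. point_prod n v k)"
    unfolding fekete_def using assms by (intro prod.remove) auto
  also have "(\<Prod>k\<in>{..<n}-{j}. point_prod n v k) = (\<Prod>k\<in>{..<n}-{j}. pdist (v j) (v k) * (\<Prod>i\<in>{..<n}-{j}-{k}. pdist (v k) (v i)))"
  proof (rule prod.cong[OF refl])
    fix k assume k: "k \<in> {..<n}-{j}"
    have "point_prod n v k = pdist (v k) (v j) * (\<Prod>i\<in>{..<n}-{k}-{j}. pdist (v k) (v i))"
      unfolding point_prod_def using assms k by (intro prod.remove) auto
    moreover have "{..<n}-{k}-{j} = {..<n}-{j}-{k}" by auto
    ultimately show "point_prod n v k = pdist (v j) (v k) * (\<Prod>i\<in>{..<n}-{j}-{k}. pdist (v k) (v i))"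
      by (simp add: pdist_commute)
  qed
  also have "\<dots> = point_prod n v j * (\<Prod>k\<in>{..<n}-{j}. \<Prod>i\<in>{..<n}-{j}-{k}. pdist (v k) (v i))"
    by (simp add: prod.distrib point_prod_def)
  finally show ?thesis by (simp add: power2_eq_square)
qed

lemma fekete_eq_square: "fekete n w = (\<Prod>i<n. \<Prod>j<i. pdist (w i) (w j))\<^sup>2"
proof (induction n)
  case 0
  then show ?case by (simp add: fekete_def)
next
  case (Suc n)
  have s: "{..<Suc n} - {n} = {..<n}" by auto
  have "(\<Prod>k<n. \<Prod>i\<in>{..<n}-{k}. pdist (w k) (w i)) = fekete n w"
    by (simp add: fekete_def point_prod_def)
  moreover have "point_prod (Suc n) w n = (\<Prod>j<n. pdist (w n) (w j))"
    unfolding point_prod_def s ..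
  ultimately show ?case
    using fekete_split[of n "Suc n" w] Suc.IH by (simp add: s power_mult_distrib mult.commute)
qed

lemma point_prod_nonneg: "0 \<le> point_prod n w j"
  unfolding point_prod_def by (intro prod_nonneg) auto

lemma fekete_pos:
  assumes "\<And>i. i < n \<Longrightarrow> w i \<in> disk" "inj_on w {..<n}"
  shows "0 < fekete n w"
  unfolding fekete_def point_prod_def
  by (intro prod_pos ballI pdist_pos) (use assms in \<open>auto dest: inj_onD\<close>)

lemma prod_pdist_le_1:
  assumes "\<And>i. i \<in> I \<Longrightarrow> z i \<in> disk" "x \<in> disk"
  shows "(\<Prod>i\<in>I. pdist x (z i)) \<le> 1"
  using assms by (intro prod_le_1) (auto intro: less_imp_le pdist_less_1)

lemma fekete_le_1:
  assumes "\<And>i. i < n \<Longrightarrow> w i \<in> disk"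
  shows "fekete n w \<le> 1"
  unfolding fekete_def point_prod_def using assms by (intro prod_le_1 conjI prod_nonneg prod_pdist_le_1) auto

text \<open>Maximisers up to a factor suffice, so no compactness is needed.\<close>
lemma near_Fekete:
  assumes K: "K \<subseteq> disk" "infinite K"
  obtains w where "\<And>i. i < n \<Longrightarrow> w i \<in> K" "inj_on w {..<n}"
    "\<And>v. (\<And>i. i < n \<Longrightarrow> v i \<in> K) \<Longrightarrow> fekete n v \<le> 4 * fekete n w"
    "\<And>z j. z \<in> K \<Longrightarrow> j < n \<Longrightarrow> (\<Prod>i\<in>{..<n}-{j}. pdist z (w i)) \<le> 2 * point_prod n w j"
proof -
  define W where "W = {v. \<forall>i<n. v i \<in> K}"
  define S where "S = (SUP v\<in>W. fekete n v)"
  have bdd: "bdd_above (fekete n ` W)"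
    using K fekete_le_1[of n] by (intro bdd_aboveI[of _ 1]) (auto simp: W_def)
  obtain e :: "nat \<Rightarrow> complex" where e: "inj e" "range e \<subseteq> K"
    using infinite_countable_subset[OF K(2)] by auto
  have eW: "e \<in> W" using e by (auto simp: W_def)
  have "0 < fekete n e"
    using e K by (intro fekete_pos) (auto intro: inj_on_subset)
  also have "\<dots> \<le> S" unfolding S_def by (intro cSUP_upper bdd eW)
  finally have S: "S > 0" .
  \<comment> \<open>The factor 4 is taken as a square: one point enters \<open>fekete\<close>
    quadratically, so exchanging it costs the root 2.\<close>
  then have "S / 4 < (SUP v\<in>W. fekete n v)" by (simp add: S_def)
  then obtain w where w: "w \<in> W" "S / 4 < fekete n w"
    using eW by (subst (asm) less_cSUP_iff[OF _ bdd]) auto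
  have le: "fekete n v \<le> 4 * fekete n w" if "v \<in> W" for v
    using cSUP_upper[OF that bdd] w(2) by (simp add: S_def)
  have pos: "0 < fekete n w" using S w by linarith
  show thesis
  proof (rule that[of w])
    show "w i \<in> K" if "i < n" for i using w(1) that by (auto simp: W_def)
    show "inj_on w {..<n}"
    proof (rule ccontr)
      assume "\<not> inj_on w {..<n}"
      then obtain i j where ij: "i < n" "j < n" "i \<noteq> j" "w i = w j" by (auto simp: inj_on_def)
      have "point_prod n w i = 0" unfolding point_prod_def using ij by (intro prod_zero bexI[of _ j]) (auto simp: pdist_def)
      then have "fekete n w = 0" unfolding fekete_def using ij by (intro prod_zero) auto
      then show False using pos by simp
    qed
    show "fekete n v \<le> 4 * fekete n w" if "\<And>i. i < n \<Longrightarrow> v i \<in> K" for v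
      by (rule le) (use that in \<open>auto simp: W_def\<close>)
    fix z j assume z: "z \<in> K" "j < n"
    \<comment> \<open>Exchange the j-th point for z: the factor \<open>Q\<close> of the remaining
      points is unchanged and positive, so it cancels.\<close>
    define v where "v = w(j := z)"
    define Q where "Q u = (\<Prod>k\<in>{..<n}-{j}. \<Prod>i\<in>{..<n}-{j}-{k}. pdist (u k) (u i))" for u
    have "Q v = Q w" unfolding Q_def v_def by (intro prod.cong) auto
    moreover have "fekete n v \<le> 4 * fekete n w" by (rule le) (use w z in \<open>auto simp: W_def v_def\<close>)
    ultimately have "(point_prod n v j)\<^sup>2 * Q w \<le> 4 * ((point_prod n w j)\<^sup>2 * Q w)"
      using fekete_split[OF z(2), of v] fekete_split[OF z(2), of w] by (simp add: Q_def)
    moreover have "Q w \<ge> 0" unfolding Q_def by (intro prod_nonneg) auto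
    moreover have "fekete n w = (point_prod n w j)\<^sup>2 * Q w" unfolding Q_def by (rule fekete_split[OF z(2)])
    then have "Q w \<noteq> 0" using pos by auto
    ultimately have "(point_prod n v j)\<^sup>2 \<le> (2 * point_prod n w j)\<^sup>2"
      by (simp add: power_mult_distrib)
    then have "point_prod n v j \<le> 2 * point_prod n w j"
      by (rule power2_le_imp_le) (simp add: point_prod_nonneg)
    moreover have "point_prod n v j = (\<Prod>i\<in>{..<n}-{j}. pdist z (w i))"
      unfolding point_prod_def v_def by (intro prod.cong) auto
    ultimately show "(\<Prod>i\<in>{..<n}-{j}. pdist z (w i)) \<le> 2 * point_prod n w j" by simp
  qed
qed

lemma exists_point_prod_le_fekete_root:
  assumes "n > 0" "fekete n w \<le> c ^ n" "c > 0"
  shows "\<exists>j<n. point_prod n w j \<le> c"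
proof (rule ccontr)
  assume "\<not> ?thesis"
  then have "(\<Prod>j<n. c) < (\<Prod>j<n. point_prod n w j)"
    using assms by (intro prod_mono_strict) (auto simp: not_le intro: less_imp_le)
  then show False using assms by (simp add: fekete_def)
qed

lemma exists_point_prod_ge_fekete_root:
  assumes "n > 0" "c ^ n \<le> fekete n w" "c > 0"
  shows "\<exists>j<n. c \<le> point_prod n w j"
proof (rule ccontr)
  assume "\<not> ?thesis"
  then have "(\<Prod>j<n. point_prod n w j) < (\<Prod>j<n. c)"
    using assms by (intro prod_mono_strict) (auto simp: not_le point_prod_nonneg)
  then show False using assms by (simp add: fekete_def)
qed

section \<open>From a measure of finite energy to a discrete configuration\<close>

lemma green_eq_pdist:
  assumes "z \<in> disk" "w \<in> disk" "z \<noteq> w"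
  shows "green z w = ennreal (- ln (pdist z w))"
proof -
  have "cmod ((1 - cnj w * z) / (z - w)) = inverse (pdist z w)"
    by (simp add: pdist_def norm_divide)
  then show ?thesis
    using assms pdist_pos[OF assms] by (simp add: green_def ln_inverse)
qed

lemma green_commute:
  assumes "z \<in> disk" "w \<in> disk"
  shows "green z w = green w z"
  using assms green_eq_pdist[of z w] green_eq_pdist[of w z]
  by (cases "z = w") (auto simp: pdist_commute)

lemma measurable_cnj [measurable]: "cnj \<in> borel_measurable borel"
  by (intro borel_measurable_continuous_onI continuous_intros)

lemma measurable_green: "(\<lambda>x. green (fst x) (snd x)) \<in> borel_measurable (borel \<Otimes>\<^sub>M borel)"
  unfolding green_def by measurable

lemma measurable_green_comp [measurable (raw)]:
  assumes "f \<in> borel_measurable M" "g \<in> borel_measurable M"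
  shows "(\<lambda>x. green (f x) (g x)) \<in> borel_measurable M"
  using measurable_compose[OF measurable_Pair[OF assms] measurable_green] by simp

text \<open>First moment method: a function exceeding c on a set of full measure would have integral
  above c. An infinite c cannot be exceeded, so the strict comparison of integrals is made for
  finite c.\<close>

lemma exists_le_nn_integral:
  assumes "prob_space \<mu>" "f \<in> borel_measurable \<mu>" "K \<in> sets \<mu>" "emeasure \<mu> K = 1"
    and "(\<integral>\<^sup>+z. f z \<partial>\<mu>) \<le> c"
  shows "\<exists>z\<in>K. f z \<le> (c::ennreal)"
proof (rule ccontr)
  assume neg: "\<not> ?thesis"
  interpret prob_space \<mu> by fact
  have K: "AE z in \<mu>. z \<in> K"
    using assms(3,4) by (subst AE_in_set_eq_1) (auto simp: measure_def)
  have lt: "AE z in \<mu>. c < f z"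
    using K by eventually_elim (use neg in auto)
  have "c \<noteq> \<infinity>"
  proof
    assume "c = \<infinity>"
    then have "AE z in \<mu>. False" using lt by auto
    then show False by simp
  qed
  have "(\<integral>\<^sup>+z. c \<partial>\<mu>) < (\<integral>\<^sup>+z. f z \<partial>\<mu>)"
  proof (rule nn_integral_less)
    show "\<not> (AE x in \<mu>. f x \<le> c)"
    proof
      assume "AE x in \<mu>. f x \<le> c"
      with lt have "AE x in \<mu>. False" by eventually_elim auto
      then show False by simp
    qed
    show "AE x in \<mu>. c \<le> f x" using lt by eventually_elim auto
  qed (use \<open>c \<noteq> \<infinity>\<close> assms in \<open>auto simp: emeasure_space_1\<close>)
  then show False using assms(5) by (simp add: emeasure_space_1)
qed

text \<open>
  The points are chosen one at a time, each not exceeding the conditional expectation of the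
  energy when the remaining points are independent with law $\mu$.
\<close>
lemma exists_points_low_energy:
  fixes \<mu> :: "complex measure"
  assumes "prob_space \<mu>" and sets [measurable_cong]: "sets \<mu> = sets borel"
    and K: "compact K" "emeasure \<mu> K = 1" and "k \<le> n"
  shows "\<exists>w. (\<forall>i<k. w i \<in> K) \<and>
     (\<Sum>i<k. \<Sum>j<i. green (w i) (w j)) + of_nat (n - k) * (\<Sum>i<k. \<integral>\<^sup>+z. green z (w i) \<partial>\<mu>)
      \<le> of_nat (\<Sum>i<k. n - 1 - i) * green_energy \<mu>"
  using \<open>k \<le> n\<close>
proof (induction k)
  case 0
  then show ?case by simp
next
  case (Suc k)
  interpret prob_space \<mu> by fact
  have space: "space \<mu> = UNIV" using sets_eq_imp_space_eq[OF sets] by simp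
  define U where "U z = (\<integral>\<^sup>+w. green w z \<partial>\<mu>)" for z
  obtain w where w: "\<And>i. i < k \<Longrightarrow> w i \<in> K" and
    le: "(\<Sum>i<k. \<Sum>j<i. green (w i) (w j)) + of_nat (n - k) * (\<Sum>i<k. U (w i))
       \<le> of_nat (\<Sum>i<k. n - 1 - i) * green_energy \<mu>"
    using Suc unfolding U_def by fastforce
  define m where "m = n - Suc k"
  have m: "n - k = Suc m" "n - 1 - k = m" using Suc.prems by (auto simp: m_def)
  have [measurable]: "U \<in> borel_measurable \<mu>"
    unfolding U_def by measurable
  \<comment> \<open>Fubini exchanges the two variables; symmetry of \<open>green\<close> is known
    inside the disk, to which \<mu> is not confined here.\<close>
  have gU: "green_energy \<mu> = (\<integral>\<^sup>+z. U z \<partial>\<mu>)"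
  proof -
    interpret pair_sigma_finite \<mu> \<mu> ..
    show ?thesis unfolding green_energy_def U_def by (subst Fubini') auto
  qed
  \<comment> \<open>The cost of choosing z next: its interaction with the points already chosen and,
    for each of the m points still to come, its potential.\<close>
  define f where "f z = (\<Sum>i<k. green z (w i)) + of_nat m * U z" for z
  have [measurable]: "f \<in> borel_measurable \<mu>"
    unfolding f_def by measurable
  have "(\<integral>\<^sup>+z. f z \<partial>\<mu>) = (\<Sum>i<k. U (w i)) + of_nat m * green_energy \<mu>"
    unfolding f_def gU U_def[of "w _"] by (simp add: nn_integral_add nn_integral_sum nn_integral_cmult)
  then obtain z where z: "z \<in> K" "f z \<le> (\<Sum>i<k. U (w i)) + of_nat m * green_energy \<mu>"
    using exists_le_nn_integral[OF \<open>prob_space \<mu>\<close>, of f K "(\<Sum>i<k. U (w i)) + of_nat m * green_energy \<mu>"]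
      K compact_imp_closed[OF K(1)] by (auto simp: sets)
  define v where "v = w(k := z)"
  have v: "v i = w i" if "i < k" for i using that by (simp add: v_def)
  have "(\<Sum>i<Suc k. \<Sum>j<i. green (v i) (v j)) + of_nat m * (\<Sum>i<Suc k. U (v i))
     = (\<Sum>i<k. \<Sum>j<i. green (w i) (w j)) + of_nat m * (\<Sum>i<k. U (w i)) + f z"
    by (simp add: f_def v_def algebra_simps)
  also have "\<dots> \<le> (\<Sum>i<k. \<Sum>j<i. green (w i) (w j)) + of_nat m * (\<Sum>i<k. U (w i))
       + ((\<Sum>i<k. U (w i)) + of_nat m * green_energy \<mu>)"
    by (intro add_left_mono z)
  also have "\<dots> = ((\<Sum>i<k. \<Sum>j<i. green (w i) (w j)) + of_nat (n - k) * (\<Sum>i<k. U (w i)))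
       + of_nat m * green_energy \<mu>"
    unfolding m by (simp add: algebra_simps)
  also have "\<dots> \<le> of_nat (\<Sum>i<k. n - 1 - i) * green_energy \<mu> + of_nat m * green_energy \<mu>"
    by (intro add_right_mono le)
  also have "\<dots> = of_nat (\<Sum>i<Suc k. n - 1 - i) * green_energy \<mu>"
    using m by (simp add: distrib_right[symmetric] del: diff_diff_left)
  finally show ?case
    using w z by (intro exI[of _ v]) (auto simp: v_def less_Suc_eq U_def m_def)
qed

text \<open>With all n points chosen, n (n - 1) / 2 pairs carry energy at most n^2 / 2 times I, and
  \<open>fekete\<close> is the square of the product over pairs, whence exp(-I n^2). Finite energy
  forces the points to be distinct, as \<open>green\<close> is infinite on the diagonal.\<close>

lemma exists_points_fekete_ge:
  fixes \<mu> :: "complex measure"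
  assumes "prob_space \<mu>" "sets \<mu> = sets borel" "compact K" "emeasure \<mu> K = 1" "K \<subseteq> disk"
    and I: "green_energy \<mu> = ennreal I" "I \<ge> 0"
  shows "\<exists>w. (\<forall>i<n. w i \<in> K) \<and> exp (- I) ^ (n * n) \<le> fekete n w"
proof -
  obtain w where w: "\<And>i. i < n \<Longrightarrow> w i \<in> K"
    and le: "(\<Sum>i<n. \<Sum>j<i. green (w i) (w j)) \<le> of_nat (\<Sum>i<n. n - 1 - i) * ennreal I"
    using exists_points_low_energy[OF assms(1-4), of n n] I by auto
  have wd: "w i \<in> disk" if "i < n" for i using w[OF that] assms by auto
  have fin: "(\<Sum>i<n. \<Sum>j<i. green (w i) (w j)) < \<infinity>"
    using le by (rule le_less_trans) (simp add: ennreal_mult_less_top ennreal_of_nat_eq_real_of_nat)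
  have ne: "w i \<noteq> w j" if "i < n" "j < i" for i j
    using fin that by (force simp: green_def)
  have nn: "0 \<le> - ln (pdist (w i) (w j))" if "i < n" "j < i" for i j
    using pdist_pos[of "w i" "w j"] pdist_less_1[of "w i" "w j"] ne[OF that] wd[of i] wd[of j] that by simp
  have "(\<Sum>i<n. \<Sum>j<i. green (w i) (w j)) = (\<Sum>i<n. \<Sum>j<i. ennreal (- ln (pdist (w i) (w j))))"
    using ne wd by (intro sum.cong refl green_eq_pdist) auto
  also have "\<dots> = (\<Sum>i<n. ennreal (\<Sum>j<i. - ln (pdist (w i) (w j))))"
    by (intro sum.cong refl sum_ennreal nn) auto
  also have "\<dots> = ennreal (\<Sum>i<n. \<Sum>j<i. - ln (pdist (w i) (w j)))"
    by (intro sum_ennreal sum_nonneg nn) auto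
  finally have "ennreal (\<Sum>i<n. \<Sum>j<i. - ln (pdist (w i) (w j))) \<le> ennreal (real (\<Sum>i<n. n - 1 - i) * I)"
    using le I by (simp add: ennreal_mult ennreal_of_nat_eq_real_of_nat del: of_nat_sum)
  then have "(\<Sum>i<n. \<Sum>j<i. - ln (pdist (w i) (w j))) \<le> real (\<Sum>i<n. n - 1 - i) * I"
    using I by (subst (asm) ennreal_le_iff) (auto simp del: of_nat_sum)
  also have "2 * real (\<Sum>i<n. n - 1 - i) \<le> real (n * n)"
  proof -
    have "2 * (\<Sum>i<n. n - 1 - i) = (\<Sum>i<n. n - 1 - i) + (\<Sum>i<n. i)"
      using sum.nat_diff_reindex[of "\<lambda>i. i" n] by simp
    also have "\<dots> \<le> (\<Sum>i<n. n)" unfolding sum.distrib[symmetric] by (intro sum_mono) auto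
    also have "\<dots> = n * n" by simp
    finally show ?thesis by (metis of_nat_le_iff of_nat_mult of_nat_numeral)
  qed
  then have "real (\<Sum>i<n. n - 1 - i) * I \<le> real (n * n) / 2 * I"
    using I by (intro mult_right_mono) auto
  finally have *: "- (real (n * n) / 2 * I) \<le> (\<Sum>i<n. \<Sum>j<i. ln (pdist (w i) (w j)))"
    by (simp add: sum_negf)
  have pos: "0 < pdist (w i) (w j)" if "i < n" "j < i" for i j
    using that ne wd by (intro pdist_pos) auto
  have "(\<Sum>i<n. \<Sum>j<i. ln (pdist (w i) (w j))) = ln (\<Prod>i<n. \<Prod>j<i. pdist (w i) (w j))"
  proof -
    have "ln (\<Prod>i<n. \<Prod>j<i. pdist (w i) (w j)) = (\<Sum>i<n. ln (\<Prod>j<i. pdist (w i) (w j)))"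
      by (intro ln_prod prod_pos) (force intro!: prod_pos pos dest!: pos)+
    also have "\<dots> = (\<Sum>i<n. \<Sum>j<i. ln (pdist (w i) (w j)))"
      by (intro sum.cong refl ln_prod) (use pos in force)+
    finally show ?thesis ..
  qed
  moreover have "0 < (\<Prod>i<n. \<Prod>j<i. pdist (w i) (w j))"
    using pos by (intro prod_pos ballI) auto
  ultimately have "exp (- (real (n * n) / 2 * I)) \<le> (\<Prod>i<n. \<Prod>j<i. pdist (w i) (w j))"
    using * ln_ge_iff[of "\<Prod>i<n. \<Prod>j<i. pdist (w i) (w j)" "- (real (n * n) / 2 * I)"] by simp
  then have "exp (- (real (n * n) / 2 * I))^2 \<le> fekete n w"
    unfolding fekete_eq_square by (intro power_mono) auto
  also have "exp (- (real (n * n) / 2 * I))^2 = exp (- I) ^ (n * n)"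
    unfolding exp_of_nat_mult[symmetric] by (simp add: algebra_simps)
  finally show ?thesis using w by auto
qed

section \<open>From a discrete configuration back to a measure on an open set\<close>

definition loguni :: "real \<Rightarrow> real \<Rightarrow> real measure" where
  "loguni \<eta> d = density lborel (\<lambda>s. ennreal (1 / (ln (d / \<eta>) * s)) * indicator {\<eta>..d} s)"

lemma sets_loguni [simp, measurable_cong]: "sets (loguni \<eta> d) = sets borel"
  and space_loguni [simp]: "space (loguni \<eta> d) = UNIV"
  by (simp_all add: loguni_def)

lemma nn_integral_loguni:
  assumes "f \<in> borel_measurable borel"
  shows "(\<integral>\<^sup>+s. f s \<partial>loguni \<eta> d) = (\<integral>\<^sup>+s. ennreal (1 / (ln (d / \<eta>) * s)) * indicator {\<eta>..d} s * f s \<partial>lborel)"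
  unfolding loguni_def using assms by (intro nn_integral_density) auto

lemma prob_space_loguni:
  assumes "0 < \<eta>" "\<eta> < d"
  shows "prob_space (loguni \<eta> d)"
proof
  have L: "ln (d / \<eta>) > 0" using assms by simp
  have "emeasure (loguni \<eta> d) UNIV = (\<integral>\<^sup>+s. 1 \<partial>loguni \<eta> d)" by simp
  also have "\<dots> = (\<integral>\<^sup>+s. ennreal (1 / (ln (d / \<eta>) * s)) * indicator {\<eta>..d} s \<partial>lborel)"
    by (subst nn_integral_loguni) auto
  also have "\<dots> = ennreal (ln d / ln (d / \<eta>) - ln \<eta> / ln (d / \<eta>))"
  proof (rule nn_integral_FTC_Icc)
    fix x assume "x \<in> {\<eta>..d}"
    then show "((\<lambda>s. ln s / ln (d / \<eta>)) has_real_derivative 1 / (ln (d / \<eta>) * x)) (at x)" "0 \<le> 1 / (ln (d / \<eta>) * x)"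
      using assms L by (auto intro!: derivative_eq_intros mult_nonneg_nonneg)
  qed (use assms in auto)
  also have "ln d / ln (d / \<eta>) - ln \<eta> / ln (d / \<eta>) = 1"
    using assms L by (simp add: ln_div diff_divide_distrib[symmetric])
  finally show "emeasure (loguni \<eta> d) (space (loguni \<eta> d)) = 1" by simp
qed

lemma AE_loguni: "AE s in loguni \<eta> d. s \<in> {\<eta>..d}"
  unfolding loguni_def by (subst AE_density) (auto simp: indicator_def)

lemma nn_integral_center_dens:
  assumes "0 < y" "0 < a" "a \<le> b"
  shows "(\<integral>\<^sup>+s. ennreal (center_dens y s) * indicator {a..b} s \<partial>lborel) \<le> ennreal 4"
proof -
  have [measurable]: "center_dens y \<in> borel_measurable borel" unfolding center_dens_def[abs_def] by measurable
  have "((\<lambda>s. if s \<in> {a..b} then center_dens y s else 0) has_integral (center_prim y b - center_prim y a)) UNIV"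
    using center_dens_has_integral[OF assms] by (simp only: has_integral_restrict_UNIV)
  then have "(\<integral>\<^sup>+s. ennreal (if s \<in> {a..b} then center_dens y s else 0) \<partial>lborel) = ennreal (center_prim y b - center_prim y a)"
    using assms by (intro nn_integral_has_integral_lborel) (auto simp: center_dens_nonneg)
  also have "\<dots> \<le> ennreal 4"
    using center_prim_diff_less[OF assms] by (intro ennreal_leI) auto
  also have "(\<integral>\<^sup>+s. ennreal (if s \<in> {a..b} then center_dens y s else 0) \<partial>lborel) = (\<integral>\<^sup>+s. ennreal (center_dens y s) * indicator {a..b} s \<partial>lborel)"
    by (intro nn_integral_cong) (auto simp: indicator_def)
  finally show ?thesis .
qed

lemma measurable_moebius [measurable (raw)]:
  assumes [measurable]: "f \<in> borel_measurable M" "g \<in> borel_measurable M"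
  shows "(\<lambda>x. moebius (f x) (g x)) \<in> borel_measurable M"
  unfolding moebius_def by measurable

text \<open>The averaging estimate along the explicit arc from w, where it is an honest integral.
  The density 1/s of \<open>loguni\<close> cancels the factor s in front of
  \<open>center_dens\<close>, whose integral is at most 4, and the normalisation supplies ln
  (d/\<eta>).\<close>

lemma nn_integral_green_moebius_le:
  assumes d: "0 < \<eta>" "\<eta> < d" "d < 1" and w: "w \<in> disk" and z: "z \<in> disk"
  shows "(\<integral>\<^sup>+s. green (moebius w (of_real s)) z \<partial>loguni \<eta> d) \<le> green w z + ennreal (4 / ln (d / \<eta>))"
proof (cases "w = z")
  case True
  then show ?thesis by (simp add: green_def)
next
  case False
  define L where "L = ln (d / \<eta>)"
  have L: "L > 0" using d by (simp add: L_def)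
  interpret prob_space "loguni \<eta> d" by (rule prob_space_loguni) (use d in auto)
  define y where "y = pdist w z"
  have y: "0 < y" "y < 1" using pdist_pos[OF w z False] pdist_less_1[OF w z] by (auto simp: y_def)
  have gm [measurable]: "center_dens y \<in> borel_measurable borel" unfolding center_dens_def[abs_def] by measurable
  have "AE s in lborel. s \<noteq> y" by (rule AE_lborel_singleton)
  then have "AE s in loguni \<eta> d. s \<noteq> y"
    unfolding loguni_def by (subst AE_density) auto
  with AE_loguni[of \<eta> d]
  have "AE s in loguni \<eta> d. green (moebius w (of_real s)) z \<le> ennreal (- ln y) + ennreal (s * center_dens y s)"
  proof eventually_elim
    case (elim s)
    have s: "0 < s" "s < 1" using elim d by auto
    have md: "moebius w (of_real s) \<in> disk" using s w by (intro moebius_in_disk) (auto simp: mem_disk_iff)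
    have pm: "pdist w (moebius w (of_real s)) = s" using pdist_moebius_real[OF w] s by auto
    have ne: "moebius w (of_real s) \<noteq> z" using pm elim by (auto simp: y_def)
    have ne2: "w \<noteq> moebius w (of_real s)" using pm s by (auto simp: pdist_def)
    have "- ln (pdist (moebius w (of_real s)) z) \<le> - ln y + s * center_dens y s"
      using minus_ln_pdist_le_center[OF z md w False ne2] elim pm by (simp add: y_def)
    then show ?case
      using green_eq_pdist[OF md z ne] y s by (simp add: ennreal_plus[symmetric] center_dens_nonneg ennreal_leI del: ennreal_plus)
  qed
  then have "(\<integral>\<^sup>+s. green (moebius w (of_real s)) z \<partial>loguni \<eta> d) \<le> (\<integral>\<^sup>+s. ennreal (- ln y) + ennreal (s * center_dens y s) \<partial>loguni \<eta> d)"
    by (rule nn_integral_mono_AE)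
  also have "\<dots> = ennreal (- ln y) + (\<integral>\<^sup>+s. ennreal (s * center_dens y s) \<partial>loguni \<eta> d)"
    using emeasure_space_1 by (subst nn_integral_add) auto
  also have "(\<integral>\<^sup>+s. ennreal (s * center_dens y s) \<partial>loguni \<eta> d)
     = (\<integral>\<^sup>+s. ennreal (1 / (L * s)) * indicator {\<eta>..d} s * ennreal (s * center_dens y s) \<partial>lborel)"
    unfolding L_def by (rule nn_integral_loguni) measurable
  also have "\<dots> = (\<integral>\<^sup>+s. ennreal (1 / L) * (ennreal (center_dens y s) * indicator {\<eta>..d} s) \<partial>lborel)"
  proof (rule nn_integral_cong)
    fix s
    show "ennreal (1 / (L * s)) * indicator {\<eta>..d} s * ennreal (s * center_dens y s) = ennreal (1 / L) * (ennreal (center_dens y s) * indicator {\<eta>..d} s)"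
      using d L y center_dens_nonneg[of y s]
      by (cases "s \<in> {\<eta>..d}") (auto simp: ennreal_mult'[symmetric])
  qed
  also have "\<dots> = ennreal (1 / L) * (\<integral>\<^sup>+s. (ennreal (center_dens y s) * indicator {\<eta>..d} s) \<partial>lborel)"
    by (rule nn_integral_cmult) measurable
  also have "\<dots> \<le> ennreal (1 / L) * ennreal 4"
    using y d by (intro mult_left_mono nn_integral_center_dens) auto
  also have "\<dots> = ennreal (4 / L)" using L by (subst ennreal_mult'[symmetric]) auto
  finally show ?thesis
    using green_eq_pdist[OF w z False] by (simp add: y_def L_def)
qed

text \<open>Choose one of the n points uniformly and move it along a hyperbolic radius to a random
  pseudo-hyperbolic distance of law \<open>loguni\<close>. As the image of a product measure it
  turns integrals into averages of one-dimensional ones.\<close>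

definition smear :: "real \<Rightarrow> real \<Rightarrow> nat \<Rightarrow> (nat \<Rightarrow> complex) \<Rightarrow> complex measure" where
  "smear \<eta> d n w = distr (measure_pmf (pmf_of_set {..<n}) \<Otimes>\<^sub>M loguni \<eta> d) borel
     (\<lambda>x. moebius (w (fst x)) (of_real (snd x)))"

lemma measurable_smear_map [measurable]:
  "(\<lambda>x. moebius (w (fst x)) (of_real (snd x))) \<in> borel_measurable (measure_pmf q \<Otimes>\<^sub>M loguni \<eta> d)"
proof -
  have [measurable]: "w \<in> borel_measurable (measure_pmf q)" by simp
  show ?thesis by measurable
qed

lemma prob_space_smear:
  assumes "0 < \<eta>" "\<eta> < d"
  shows "prob_space (smear \<eta> d n w)"
proof -
  interpret L: prob_space "loguni \<eta> d" by (rule prob_space_loguni[OF assms])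
  interpret P: prob_space "measure_pmf (pmf_of_set {..<n})" by (rule prob_space_measure_pmf)
  interpret pair_prob_space "measure_pmf (pmf_of_set {..<n})" "loguni \<eta> d" ..
  show ?thesis unfolding smear_def by (rule prob_space_distr) measurable
qed

lemma nn_integral_smear:
  assumes "0 < \<eta>" "\<eta> < d" "n > 0" and f [measurable]: "f \<in> borel_measurable borel"
  shows "(\<integral>\<^sup>+x. f x \<partial>smear \<eta> d n w) = (\<Sum>i<n. \<integral>\<^sup>+s. f (moebius (w i) (of_real s)) \<partial>loguni \<eta> d) / of_nat n"
proof -
  interpret L: prob_space "loguni \<eta> d" by (rule prob_space_loguni[OF assms(1,2)])
  have "(\<integral>\<^sup>+x. f x \<partial>smear \<eta> d n w)
     = (\<integral>\<^sup>+x. f (moebius (w (fst x)) (of_real (snd x))) \<partial>(measure_pmf (pmf_of_set {..<n}) \<Otimes>\<^sub>M loguni \<eta> d))"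
    unfolding smear_def by (subst nn_integral_distr) measurable
  also have "\<dots> = (\<integral>\<^sup>+i. \<integral>\<^sup>+s. f (moebius (w i) (of_real s)) \<partial>loguni \<eta> d \<partial>measure_pmf (pmf_of_set {..<n}))"
    by (subst L.nn_integral_fst[symmetric]) auto
  also have "\<dots> = (\<Sum>i<n. \<integral>\<^sup>+s. f (moebius (w i) (of_real s)) \<partial>loguni \<eta> d) / of_nat n"
    using assms(3) by (subst nn_integral_pmf_of_set) auto
  finally show ?thesis .
qed

lemma smear_admissible:
  assumes d: "0 < \<eta>" "\<eta> < d" "d < 1" and "n > 0"
    and w: "\<And>i. i < n \<Longrightarrow> w i \<in> K" and K: "compact K" "K \<subseteq> disk"
    and E: "\<And>x s. x \<in> K \<Longrightarrow> 0 \<le> s \<Longrightarrow> s \<le> d \<Longrightarrow> moebius x (of_real s) \<in> E"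
  shows "smear \<eta> d n w \<in> adm_measures E"
proof -
  define K' where "K' = (\<lambda>(x, s). moebius x (of_real s)) ` (K \<times> {0..d})"
  have nz: "1 + cnj x * of_real s \<noteq> 0" if "x \<in> K" "0 \<le> s" "s \<le> d" for x s
    using one_plus_cnj_mult_nz[of "of_real s" x] that K d by (auto simp: mem_disk_iff)
  have "continuous_on (K \<times> {0..d}) (\<lambda>x. moebius (fst x) (of_real (snd x)))"
    unfolding moebius_def using nz by (intro continuous_intros) auto
  then have K': "compact K'"
    unfolding K'_def using K by (intro compact_continuous_image compact_Times) (auto simp: split_def)
  have KE: "K' \<subseteq> E" using E by (auto simp: K'_def)
  have [measurable]: "K' \<in> sets borel" using K' by (simp add: compact_imp_closed)
  interpret L: prob_space "loguni \<eta> d" by (rule prob_space_loguni) (use d in auto)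
  have "emeasure (smear \<eta> d n w) K' = (\<integral>\<^sup>+x. indicator K' x \<partial>smear \<eta> d n w)"
    by (subst nn_integral_indicator) (auto simp: smear_def)
  also have "\<dots> = (\<Sum>i<n. \<integral>\<^sup>+s. indicator K' (moebius (w i) (of_real s)) \<partial>loguni \<eta> d) / of_nat n"
    using d assms(4) by (intro nn_integral_smear) auto
  also have "(\<Sum>i<n. \<integral>\<^sup>+s. indicator K' (moebius (w i) (of_real s)) \<partial>loguni \<eta> d) = (\<Sum>i<n. 1)"
  proof (rule sum.cong[OF refl])
    fix i assume i: "i \<in> {..<n}"
    have "(\<integral>\<^sup>+s. indicator K' (moebius (w i) (of_real s)) \<partial>loguni \<eta> d) = (\<integral>\<^sup>+s. 1 \<partial>loguni \<eta> d)"
    proof (rule nn_integral_cong_AE)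
      show "AE s in loguni \<eta> d. indicator K' (moebius (w i) (of_real s)) = (1::ennreal)"
        using AE_loguni[of \<eta> d] by eventually_elim (use i w d in \<open>force simp: K'_def indicator_def\<close>)
    qed
    then show "(\<integral>\<^sup>+s. indicator K' (moebius (w i) (of_real s)) \<partial>loguni \<eta> d) = 1"
      using L.emeasure_space_1 by simp
  qed
  also have "(\<Sum>i<n. 1::ennreal) / of_nat n = 1"
    using assms(4) by (simp add: ennreal_divide_self ennreal_of_nat_eq_real_of_nat)
  finally have "emeasure (smear \<eta> d n w) K' = 1" .
  then show ?thesis
    using K' KE prob_space_smear[of \<eta> d n w] d unfolding adm_measures_def
    by (auto simp: smear_def)
qed

text \<open>Smearing costs \<delta> = 4 / ln (d/\<eta>) in each of the two variables. The diagonal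
  pairs, infinite in the discrete energy, become finite because one smearing already moves the point
  to distance at least \<eta> from its origin; n terms of size -ln \<eta> among n^2 contribute (-ln
  \<eta>)/n.\<close>

lemma green_energy_smear_le:
  assumes d: "0 < \<eta>" "\<eta> < d" "d < 1" and n: "n > 0"
    and w: "\<And>i. i < n \<Longrightarrow> w i \<in> disk" "inj_on w {..<n}"
  shows "green_energy (smear \<eta> d n w) \<le> ennreal ((- ln (fekete n w) + real n * (- ln \<eta>)) / real (n * n) + 8 / ln (d / \<eta>))"
proof -
  interpret L: prob_space "loguni \<eta> d" by (rule prob_space_loguni) (use d in auto)
  define \<delta> where "\<delta> = 4 / ln (d / \<eta>)"
  have \<delta>: "\<delta> > 0" using d by (simp add: \<delta>_def)
  have lneta: "- ln \<eta> > 0" using d by simp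
  interpret S: prob_space "smear \<eta> d n w" by (rule prob_space_smear) (use d in auto)
  have sm [measurable_cong]: "sets (smear \<eta> d n w) = sets borel" by (simp add: smear_def)
  have md: "moebius (w i) (of_real s) \<in> disk" if "i < n" "s \<in> {\<eta>..d}" for i s
    using that w d by (intro moebius_in_disk) (auto simp: mem_disk_iff)
  define e where "e i j = (if i = j then - ln \<eta> else - ln (pdist (w i) (w j)))" for i j
  have e0: "e i j \<ge> 0" if "i < n" "j < n" for i j
    using that lneta w by (auto simp: e_def ln_le_zero_iff dest: inj_onD
      intro!: ln_le_zero_iff[THEN iffD2] pdist_pos less_imp_le[OF pdist_less_1])
  have ij: "(\<integral>\<^sup>+s. \<integral>\<^sup>+t. green (moebius (w i) (of_real s)) (moebius (w j) (of_real t)) \<partial>loguni \<eta> d \<partial>loguni \<eta> d)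
      \<le> ennreal (e i j + 2 * \<delta>)" if i: "i < n" and j: "j < n" for i j
  proof -
    have "(\<integral>\<^sup>+s. \<integral>\<^sup>+t. green (moebius (w i) (of_real s)) (moebius (w j) (of_real t)) \<partial>loguni \<eta> d \<partial>loguni \<eta> d)
       \<le> (\<integral>\<^sup>+s. green (moebius (w i) (of_real s)) (w j) + ennreal \<delta> \<partial>loguni \<eta> d)"
    proof (rule nn_integral_mono_AE)
      show "AE s in loguni \<eta> d. (\<integral>\<^sup>+t. green (moebius (w i) (of_real s)) (moebius (w j) (of_real t)) \<partial>loguni \<eta> d)
           \<le> green (moebius (w i) (of_real s)) (w j) + ennreal \<delta>"
        using AE_loguni[of \<eta> d]
      proof eventually_elim
        case (elim s)
        let ?z = "moebius (w i) (of_real s)"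
        have z: "?z \<in> disk" by (rule md[OF i elim])
        have "(\<integral>\<^sup>+t. green ?z (moebius (w j) (of_real t)) \<partial>loguni \<eta> d) = (\<integral>\<^sup>+t. green (moebius (w j) (of_real t)) ?z \<partial>loguni \<eta> d)"
        proof (rule nn_integral_cong_AE)
          show "AE t in loguni \<eta> d. green ?z (moebius (w j) (of_real t)) = green (moebius (w j) (of_real t)) ?z"
            using AE_loguni[of \<eta> d] by eventually_elim (intro green_commute z md j)
        qed
        also have "\<dots> \<le> green (w j) ?z + ennreal \<delta>"
          unfolding \<delta>_def by (rule nn_integral_green_moebius_le[OF d w(1)[OF j] z])
        also have "green (w j) ?z = green ?z (w j)" by (rule green_commute[OF w(1)[OF j] z])
        finally show ?case .
      qed
    qed
    also have "\<dots> = (\<integral>\<^sup>+s. green (moebius (w i) (of_real s)) (w j) \<partial>loguni \<eta> d) + ennreal \<delta>"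
      using L.emeasure_space_1 by (subst nn_integral_add) auto
    also have "(\<integral>\<^sup>+s. green (moebius (w i) (of_real s)) (w j) \<partial>loguni \<eta> d) \<le> ennreal (e i j) + ennreal \<delta>"
    proof (cases "i = j")
      case True
      have "(\<integral>\<^sup>+s. green (moebius (w i) (of_real s)) (w j) \<partial>loguni \<eta> d) \<le> (\<integral>\<^sup>+s. ennreal (- ln \<eta>) \<partial>loguni \<eta> d)"
      proof (rule nn_integral_mono_AE)
        show "AE s in loguni \<eta> d. green (moebius (w i) (of_real s)) (w j) \<le> ennreal (- ln \<eta>)"
          using AE_loguni[of \<eta> d]
        proof eventually_elim
          case (elim s)
          have s: "0 < s" "s < 1" "\<eta> \<le> s" using elim d by auto
          have pm: "pdist (moebius (w i) (of_real s)) (w j) = s"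
            using pdist_moebius_real[OF w(1)[OF i], of s] s True by (simp add: pdist_commute)
          then have "moebius (w i) (of_real s) \<noteq> w j" using s by (auto simp: pdist_def)
          then show ?case
            using green_eq_pdist[OF md[OF i elim] w(1)[OF j]] pm s d by (auto intro!: ennreal_leI)
        qed
      qed
      then show ?thesis using True L.emeasure_space_1 by (simp add: e_def add_increasing2)
    next
      case False
      then have ne: "w i \<noteq> w j" using w(2) i j by (auto dest: inj_onD)
      show ?thesis
        using nn_integral_green_moebius_le[OF d w(1)[OF i] w(1)[OF j]] green_eq_pdist[OF w(1)[OF i] w(1)[OF j] ne] False
        by (simp add: e_def \<delta>_def)
    qed
    also have "ennreal (e i j) + ennreal \<delta> + ennreal \<delta> = ennreal (e i j + 2 * \<delta>)"
      using e0[OF i j] \<delta> by (simp add: ennreal_plus[symmetric] del: ennreal_plus)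
    finally show ?thesis by (simp add: add_right_mono)
  qed
  have "green_energy (smear \<eta> d n w)
     = (\<Sum>i<n. \<integral>\<^sup>+s. (\<integral>\<^sup>+x. green (moebius (w i) (of_real s)) x \<partial>smear \<eta> d n w) \<partial>loguni \<eta> d) / of_nat n"
    unfolding green_energy_def using d n by (intro nn_integral_smear) auto
  also have "\<dots> = (\<Sum>i<n. \<integral>\<^sup>+s. ((\<Sum>j<n. \<integral>\<^sup>+t. green (moebius (w i) (of_real s)) (moebius (w j) (of_real t)) \<partial>loguni \<eta> d) / of_nat n) \<partial>loguni \<eta> d) / of_nat n"
    using d n by (subst nn_integral_smear) auto
  also have "\<dots> = (\<Sum>i<n. \<Sum>j<n. \<integral>\<^sup>+s. \<integral>\<^sup>+t. green (moebius (w i) (of_real s)) (moebius (w j) (of_real t)) \<partial>loguni \<eta> d \<partial>loguni \<eta> d) / of_nat n / of_nat n"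
    by (simp add: nn_integral_multc nn_integral_sum divide_ennreal_def sum_distrib_right)
  also have "\<dots> \<le> (\<Sum>i<n. \<Sum>j<n. ennreal (e i j + 2 * \<delta>)) / of_nat n / of_nat n"
    by (intro divide_right_mono_ennreal sum_mono ij) auto
  also have "(\<Sum>i<n. \<Sum>j<n. ennreal (e i j + 2 * \<delta>)) = ennreal (\<Sum>i<n. \<Sum>j<n. e i j + 2 * \<delta>)"
  proof -
    have "(\<Sum>i<n. \<Sum>j<n. ennreal (e i j + 2 * \<delta>)) = (\<Sum>i<n. ennreal (\<Sum>j<n. e i j + 2 * \<delta>))"
      using e0 \<delta> by (intro sum.cong refl sum_ennreal) auto
    also have "\<dots> = ennreal (\<Sum>i<n. \<Sum>j<n. e i j + 2 * \<delta>)"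
      using e0 \<delta> by (intro sum_ennreal sum_nonneg) auto
    finally show ?thesis .
  qed
  also have "(\<Sum>i<n. \<Sum>j<n. e i j + 2 * \<delta>) = (\<Sum>i<n. \<Sum>j<n. e i j) + real (n * n) * (2 * \<delta>)"
    by (simp add: sum.distrib)
  also have "(\<Sum>i<n. \<Sum>j<n. e i j) = - ln (fekete n w) + real n * (- ln \<eta>)"
  proof -
    have posw: "0 < pdist (w i) (w j)" if "i < n" "j < n" "i \<noteq> j" for i j
      using that w by (intro pdist_pos) (auto dest: inj_onD)
    have "(\<Sum>j<n. e i j) = - ln (point_prod n w i) + - ln \<eta>" if "i < n" for i
    proof -
      have "(\<Sum>j<n. e i j) = e i i + (\<Sum>j\<in>{..<n}-{i}. e i j)"
        using that by (intro sum.remove) auto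
      also have "(\<Sum>j\<in>{..<n}-{i}. e i j) = (\<Sum>j\<in>{..<n}-{i}. - ln (pdist (w i) (w j)))"
        by (intro sum.cong) (auto simp: e_def)
      also have "\<dots> = - ln (point_prod n w i)"
        unfolding point_prod_def sum_negf using that by (subst ln_prod) (force dest: posw)+
      finally show ?thesis by (simp add: e_def)
    qed
    then have "(\<Sum>i<n. \<Sum>j<n. e i j) = (\<Sum>i<n. - ln (point_prod n w i)) + real n * (- ln \<eta>)"
      by (simp add: sum_subtractf sum_negf)
    also have "(\<Sum>i<n. - ln (point_prod n w i)) = - ln (fekete n w)"
      unfolding fekete_def sum_negf
      by (subst ln_prod) (force simp: point_prod_def dest: posw intro!: prod_pos posw)+
    finally show ?thesis .
  qed
  also have "ennreal (- ln (fekete n w) + real n * (- ln \<eta>) + real (n * n) * (2 * \<delta>)) / of_nat n / of_nat n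
      = ennreal ((- ln (fekete n w) + real n * (- ln \<eta>) + real (n * n) * (2 * \<delta>)) / real n / real n)"
  proof -
    have "0 \<le> - ln (fekete n w)"
      using fekete_le_1[of n w] fekete_pos[of n w] w by simp
    then have "0 \<le> - ln (fekete n w) + real n * (- ln \<eta>) + real (n * n) * (2 * \<delta>)"
      using \<delta> lneta by (intro add_nonneg_nonneg mult_nonneg_nonneg) auto
    then show ?thesis
      using n by (simp add: divide_ennreal ennreal_of_nat_eq_real_of_nat)
  qed
  also have "(- ln (fekete n w) + real n * (- ln \<eta>) + real (n * n) * (2 * \<delta>)) / real n / real n
     = (- ln (fekete n w) + real n * (- ln \<eta>)) / real (n * n) + 8 / ln (d / \<eta>)"
    using n by (simp add: \<delta>_def add_divide_distrib)
  finally show ?thesis .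
qed

text \<open>The smeared measure competes in \<open>green_V\<close>, so its energy is at least A,
  which is then solved for \<open>fekete\<close>. Working with a real A below V also covers infinite
  V. The n-th root of the bound is what some \<open>point_prod\<close> inherits; there the diagonal
  contributes only the constant 1/\<eta>.\<close>

lemma fekete_le_of_green_V:
  assumes d: "0 < \<eta>" "\<eta> < d" "d < 1" and n: "n > 0"
    and w: "\<And>i. i < n \<Longrightarrow> w i \<in> K" "inj_on w {..<n}" and K: "compact K" "K \<subseteq> disk"
    and E: "\<And>x s. x \<in> K \<Longrightarrow> 0 \<le> s \<Longrightarrow> s \<le> d \<Longrightarrow> moebius x (of_real s) \<in> E"
    and A: "ennreal A \<le> green_V E" "A \<ge> 0"
  shows "fekete n w \<le> (exp (real n * (8 / ln (d / \<eta>) - A)) / \<eta>) ^ n"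
proof -
  have wd: "w i \<in> disk" if "i < n" for i using w K that by auto
  have "ennreal A \<le> green_V E" by fact
  also have "\<dots> \<le> green_energy (smear \<eta> d n w)"
    unfolding green_V_def by (intro INF_lower smear_admissible[OF d n w(1) K E])
  also have "\<dots> \<le> ennreal ((- ln (fekete n w) + real n * (- ln \<eta>)) / real (n * n) + 8 / ln (d / \<eta>))"
    by (rule green_energy_smear_le[OF d n wd w(2)])
  finally have le: "ennreal A \<le> ennreal ((- ln (fekete n w) + real n * (- ln \<eta>)) / real (n * n) + 8 / ln (d / \<eta>))" .
  have pos: "fekete n w > 0" by (rule fekete_pos[OF wd w(2)])
  have "0 \<le> - ln (fekete n w)" "0 \<le> - ln \<eta>"
    using fekete_le_1[of n w] pos wd d by auto
  then have "0 \<le> (- ln (fekete n w) + real n * (- ln \<eta>)) / real (n * n) + 8 / ln (d / \<eta>)"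
    using d by (intro add_nonneg_nonneg divide_nonneg_nonneg mult_nonneg_nonneg) auto
  then have "A \<le> (- ln (fekete n w) + real n * (- ln \<eta>)) / real (n * n) + 8 / ln (d / \<eta>)"
    using le by (subst (asm) ennreal_le_iff) auto
  then have "real (n * n) * (A - 8 / ln (d / \<eta>)) \<le> - ln (fekete n w) + real n * (- ln \<eta>)"
    using n by (simp add: field_simps)
  then have "ln (fekete n w) \<le> real n * (real n * (8 / ln (d / \<eta>) - A) - ln \<eta>)"
    by (simp add: algebra_simps)
  then have "fekete n w \<le> exp (real n * (real n * (8 / ln (d / \<eta>) - A) - ln \<eta>))"
    using pos by (metis exp_le_cancel_iff exp_ln)
  also have "\<dots> = exp (real n * (8 / ln (d / \<eta>) - A) - ln \<eta>) ^ n"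
    by (rule exp_of_nat_mult)
  finally show ?thesis using d by (simp add: exp_diff)
qed

section \<open>Blaschke interpolation\<close>

definition blaschke :: "complex \<Rightarrow> complex \<Rightarrow> complex" where
  "blaschke b z = (z - b) / (1 - cnj b * z)"

text \<open>The Takenaka-Malmquist functions without their normalising constants; as in Newton
  interpolation, the k-th one vanishes at the earlier nodes.\<close>

definition interp_basis :: "(nat \<Rightarrow> complex) \<Rightarrow> nat \<Rightarrow> complex \<Rightarrow> complex" where
  "interp_basis b k z = (\<Prod>i<k. blaschke (b i) z) / (1 - cnj (b k) * z)"

text \<open>Partner of \<open>interp_basis\<close> making each product a difference of consecutive
  Hermite remainders of the Cauchy kernel, so that the sum telescopes.\<close>

definition interp_dual :: "(nat \<Rightarrow> complex) \<Rightarrow> nat \<Rightarrow> complex \<Rightarrow> complex" where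
  "interp_dual b k z = (1 - cnj (b k) * b k) / ((1 - cnj (b k) * z) * (\<Prod>i<Suc k. blaschke (b i) z))"

text \<open>Written as a contour integral, the coefficient is visibly linear and bounded, and nodes
  may coincide without derivatives entering.\<close>

definition interp_coef :: "real \<Rightarrow> (nat \<Rightarrow> complex) \<Rightarrow> nat \<Rightarrow> (complex \<Rightarrow> complex) \<Rightarrow> complex" where
  "interp_coef s b k f = contour_integral (circlepath 0 s) (\<lambda>z. f z * interp_dual b k z) / (2 * of_real pi * \<i>)"

definition interp :: "real \<Rightarrow> (nat \<Rightarrow> complex) \<Rightarrow> nat \<Rightarrow> (complex \<Rightarrow> complex) \<Rightarrow> complex \<Rightarrow> complex" where
  "interp s b n f w = (\<Sum>k<n. interp_coef s b k f * interp_basis b k w)"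

lemma norm_blaschke: "cmod (blaschke b z) = pdist z b"
  by (simp add: blaschke_def pdist_def)

lemma blaschke_diff:
  assumes "z \<in> disk" "w \<in> disk" "b \<in> disk"
  shows "blaschke b z - blaschke b w = (1 - cnj b * b) * (z - w) / ((1 - cnj b * z) * (1 - cnj b * w))"
proof -
  have "1 - cnj b * z \<noteq> 0" "1 - cnj b * w \<noteq> 0"
    using assms one_minus_cnj_mult_nz by auto
  then show ?thesis
    by (simp add: blaschke_def diff_frac_eq) (simp add: algebra_simps)
qed

text \<open>
  Replacing the Cauchy kernel by the separated sum leaves the Hermite remainder, so interpolation
  at the points $b_i$ is an operator of rank at most $n$.
\<close>
lemma Cauchy_kernel_expansion:
  assumes z: "z \<in> disk" and w: "w \<in> disk" and "z \<noteq> w"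
    and b: "\<And>i. i < n \<Longrightarrow> b i \<in> disk" "\<And>i. i < n \<Longrightarrow> z \<noteq> b i"
  shows "1 / (z - w) - (\<Sum>k<n. interp_dual b k z * interp_basis b k w) = (\<Prod>i<n. blaschke (b i) w) / ((\<Prod>i<n. blaschke (b i) z) * (z - w))"
  using b
proof (induction n)
  case 0
  then show ?case by simp
next
  case (Suc n)
  define X Y where "X = (\<Prod>i<n. blaschke (b i) w)" and "Y = (\<Prod>i<n. blaschke (b i) z)"
  define p q where "p = blaschke (b n) w" and "q = blaschke (b n) z"
  define e f where "e = 1 - cnj (b n) * z" and "f = 1 - cnj (b n) * w"
  have ef: "e \<noteq> 0" "f \<noteq> 0"
    using Suc.prems one_minus_cnj_mult_nz z w by (auto simp: e_def f_def)
  have q: "q \<noteq> 0" using Suc.prems(2)[of n] ef by (auto simp: q_def blaschke_def e_def)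
  define D where "D = z - w"
  have zw: "D \<noteq> 0" using assms by (simp add: D_def)
  have d: "q - p = (1 - cnj (b n) * b n) * (z - w) / (e * f)"
    unfolding q_def p_def e_def f_def using Suc.prems z w by (intro blaschke_diff) auto
  have "interp_dual b n z * interp_basis b n w = (1 - cnj (b n) * b n) / (e * (Y * q)) * (X / f)"
    by (simp add: interp_dual_def interp_basis_def X_def Y_def q_def e_def f_def)
  also have "\<dots> = X / (Y * q * (z - w)) * ((1 - cnj (b n) * b n) * (z - w) / (e * f))"
    unfolding D_def[symmetric] using zw by (simp add: mult_ac)
  also have "\<dots> = X / (Y * q * (z - w)) * (q - p)"
    by (simp only: d)
  also have "\<dots> = X / (Y * (z - w)) - X * p / (Y * q * (z - w))"
    unfolding D_def[symmetric] using q by (simp add: right_diff_distrib[of _ q] diff_divide_distrib)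
  finally have "interp_dual b n z * interp_basis b n w = X / (Y * (z - w)) - X * p / (Y * q * (z - w))" .
  moreover have "1 / (z - w) - (\<Sum>k<n. interp_dual b k z * interp_basis b k w) = X / (Y * (z - w))"
    unfolding X_def Y_def using Suc by auto
  ultimately have "1 / (z - w) - (\<Sum>k<Suc n. interp_dual b k z * interp_basis b k w)
      = X / (Y * (z - w)) - (X / (Y * (z - w)) - X * p / (Y * q * (z - w)))"
    by (simp only: sum.lessThan_Suc diff_diff_eq[symmetric])
  then show ?case
    by (simp add: X_def Y_def p_def q_def)
qed

lemma interp_dual_continuous:
  assumes s: "0 < s" "s < 1" and b: "\<And>i. i \<le> k \<Longrightarrow> cmod (b i) < s"
  shows "continuous_on (sphere 0 s) (interp_dual b k)"
proof -
  have nz: "1 - cnj (b i) * z \<noteq> 0" "blaschke (b i) z \<noteq> 0" if "i \<le> k" "cmod z = s" for i z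
  proof -
    show *: "1 - cnj (b i) * z \<noteq> 0"
      using that b[of i] s by (intro one_minus_cnj_mult_nz) (auto simp: mem_disk_iff)
    have "z \<noteq> b i" using that b[of i] by auto
    then show "blaschke (b i) z \<noteq> 0" using * by (simp add: blaschke_def)
  qed
  have c: "continuous_on (sphere 0 s) (\<lambda>z. blaschke (b i) z)" if "i \<le> k" for i
    unfolding blaschke_def using nz(1)[OF that] by (intro continuous_intros) (auto simp: dist_norm)
  show ?thesis
    unfolding interp_dual_def
    by (intro continuous_intros c) (use nz in \<open>auto simp: dist_norm prod_zero_iff\<close>)
qed

lemma Hp_continuous_on_sphere:
  assumes "f \<in> Hp p" "s < 1"
  shows "continuous_on (sphere 0 s) f"
  by (rule continuous_on_subset[OF holomorphic_on_imp_continuous_on[OF Hp_holo[OF assms(1)]]])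
     (use assms in \<open>auto simp: mem_disk_iff\<close>)

lemma interp_coef_has_contour_integral:
  assumes "f \<in> Hp p" "0 < s" "s < 1" "\<And>i. i \<le> k \<Longrightarrow> cmod (b i) < s"
  shows "((\<lambda>z. f z * interp_dual b k z) has_contour_integral (2 * of_real pi * \<i> * interp_coef s b k f)) (circlepath 0 s)"
proof -
  have "continuous_on (sphere 0 s) (\<lambda>z. f z * interp_dual b k z)"
    by (intro continuous_on_mult Hp_continuous_on_sphere[OF assms(1)] interp_dual_continuous assms)
  then have "(\<lambda>z. f z * interp_dual b k z) contour_integrable_on (circlepath 0 s)"
    using assms by (intro contour_integrable_continuous_circlepath) simp
  then show ?thesis
    by (simp add: interp_coef_def has_contour_integral_integral)
qed

lemma interp_coef_bounded:
  assumes p: "p \<ge> 1" and s: "0 < s" "s < 1" and b: "\<And>i. i \<le> k \<Longrightarrow> cmod (b i) < s"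
  shows "\<exists>C\<ge>0. \<forall>f\<in>Hp p. cmod (interp_coef s b k f) \<le> C * hp_norm p f"
proof -
  have "compact (interp_dual b k ` sphere 0 s)"
    by (intro compact_continuous_image interp_dual_continuous assms) auto
  then obtain U where U: "U > 0" "\<And>z. z \<in> sphere 0 s \<Longrightarrow> cmod (interp_dual b k z) \<le> U"
    using bounded_pos[of "interp_dual b k ` sphere 0 s"] compact_imp_bounded[of "interp_dual b k ` sphere 0 s"]
    by (metis imageI)
  show ?thesis
  proof (intro exI[of _ "4 / (1 - s) * U * s"] conjI ballI)
    show "0 \<le> 4 / (1 - s) * U * s" using s U by simp
    fix f assume f: "f \<in> Hp p"
    have "cmod (2 * of_real pi * \<i> * interp_coef s b k f) \<le> (4 / (1 - s) * hp_norm p f * U) * (2 * pi * s)"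
    proof (rule has_contour_integral_bound_circlepath[OF interp_coef_has_contour_integral[OF f s b]])
      show "0 \<le> 4 / (1 - s) * hp_norm p f * U" using s U by simp
      fix x assume "cmod (x - 0) = s"
      then show "cmod (f x * interp_dual b k x) \<le> 4 / (1 - s) * hp_norm p f * U"
        unfolding norm_mult using U s
        by (intro mult_mono cmod_le_hp_norm f p) auto
    qed (use s in auto)
    then have "2 * pi * cmod (interp_coef s b k f) \<le> 2 * pi * (4 / (1 - s) * U * s * hp_norm p f)"
      by (simp only: norm_mult norm_ii norm_of_real norm_numeral mult_1_right abs_of_pos[OF pi_gt_zero] mult_ac)
    then show "cmod (interp_coef s b k f) \<le> 4 / (1 - s) * U * s * hp_norm p f"
      by (rule mult_left_le_imp_le) simp
  qed
qed

text \<open>Integrate the kernel expansion against f over |u| = s. The Cauchy kernel gives f w, the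
  separated sum gives the interpolant, and the remainder has the Blaschke product at w over the one
  at u; the latter is at least \<kappa>^n in modulus on the circle, and |u - w| \<ge> s - r.\<close>

lemma interp_error:
  assumes p: "p \<ge> 1" and f: "f \<in> Hp p" and s: "r < s" "s < 1" and w: "cmod w \<le> r"
    and b: "\<And>i. i < n \<Longrightarrow> cmod (b i) \<le> r"
    and \<kappa>: "0 < \<kappa>" "\<And>i z. i < n \<Longrightarrow> cmod z = s \<Longrightarrow> \<kappa> \<le> pdist z (b i)"
  shows "cmod (f w - interp s b n f w) \<le> 4 / ((1 - s) * (s - r) * \<kappa> ^ n) * (\<Prod>i<n. pdist w (b i)) * hp_norm p f"
proof -
  have r0: "0 \<le> r" using w norm_ge_zero[of w] by linarith
  have s0: "0 < s" using s r0 by simp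
  have bs: "cmod (b i) < s" if "i < n" for i using b[OF that] s by simp
  have bd: "b i \<in> disk" if "i < n" for i using bs[OF that] s by (simp add: mem_disk_iff)
  have wd: "w \<in> disk" using w s by (simp add: mem_disk_iff)
  define P where "P = (\<Prod>i<n. pdist w (b i))"
  have P0: "0 \<le> P" unfolding P_def by (intro prod_nonneg) auto
  define X where "X = 4 / (1 - s) * hp_norm p f * (P / (\<kappa> ^ n * (s - r)))"
  have X0: "0 \<le> X" using s \<kappa> P0 by (simp add: X_def)
  have "((\<lambda>u. f u / (u - w)) has_contour_integral (2 * of_real pi * \<i> * f w)) (circlepath 0 s)"
  proof (rule Cauchy_integral_circlepath)
    have h: "f holomorphic_on cball 0 s"
      by (rule holomorphic_on_subset[OF Hp_holo[OF f]]) (use s in \<open>auto simp: mem_disk_iff\<close>)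
    then show "continuous_on (cball 0 s) f" by (rule holomorphic_on_imp_continuous_on)
    show "f holomorphic_on ball 0 s" by (rule holomorphic_on_subset[OF h]) auto
    show "cmod (w - 0) < s" using w s by simp
  qed
  moreover have "((\<lambda>u. \<Sum>k<n. f u * interp_dual b k u * interp_basis b k w) has_contour_integral
      (\<Sum>k<n. 2 * of_real pi * \<i> * interp_coef s b k f * interp_basis b k w)) (circlepath 0 s)"
    by (intro has_contour_integral_sum has_contour_integral_rmul interp_coef_has_contour_integral[OF f s0 s(2)])
       (auto intro: bs)
  ultimately have "((\<lambda>u. f u / (u - w) - (\<Sum>k<n. f u * interp_dual b k u * interp_basis b k w)) has_contour_integral
      (2 * of_real pi * \<i> * f w - (\<Sum>k<n. 2 * of_real pi * \<i> * interp_coef s b k f * interp_basis b k w))) (circlepath 0 s)"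
    by (rule has_contour_integral_diff)
  then have "cmod (2 * of_real pi * \<i> * f w - (\<Sum>k<n. 2 * of_real pi * \<i> * interp_coef s b k f * interp_basis b k w)) \<le> X * (2 * pi * s)"
  proof (rule has_contour_integral_bound_circlepath)
    fix u assume "cmod (u - 0) = s"
    then have u: "cmod u = s" by simp
    have ud: "u \<in> disk" using u s by (simp add: mem_disk_iff)
    have uw: "u \<noteq> w" using u w s by auto
    have uwge: "s - r \<le> cmod (u - w)"
      using norm_triangle_ineq2[of u w] u w by simp
    have "f u / (u - w) - (\<Sum>k<n. f u * interp_dual b k u * interp_basis b k w)
        = f u * (1 / (u - w) - (\<Sum>k<n. interp_dual b k u * interp_basis b k w))"
      by (simp add: right_diff_distrib sum_distrib_left mult.assoc)
    also have "\<dots> = f u * ((\<Prod>i<n. blaschke (b i) w) / ((\<Prod>i<n. blaschke (b i) u) * (u - w)))"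
      using bd bs u by (subst Cauchy_kernel_expansion[OF ud wd uw]) auto
    also have "cmod \<dots> = cmod (f u) * (P / ((\<Prod>i<n. pdist u (b i)) * cmod (u - w)))"
      by (simp add: norm_mult norm_divide prod_norm[symmetric] norm_blaschke P_def)
    also have "\<dots> \<le> 4 / (1 - s) * hp_norm p f * (P / (\<kappa> ^ n * (s - r)))"
    proof (intro mult_mono divide_left_mono)
      show "cmod (f u) \<le> 4 / (1 - s) * hp_norm p f"
        by (rule cmod_le_hp_norm[OF f p]) (use u s in auto)
      have "\<kappa> ^ n = (\<Prod>i<n. \<kappa>)" by simp
      also have "\<dots> \<le> (\<Prod>i<n. pdist u (b i))"
        using \<kappa> u by (intro prod_mono) (auto intro: less_imp_le)
      finally show *: "\<kappa> ^ n \<le> (\<Prod>i<n. pdist u (b i))" .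
      have "0 < (\<Prod>i<n. pdist u (b i))" using * \<kappa> zero_less_power[of \<kappa> n] by linarith
      then show "0 < (\<Prod>i<n. pdist u (b i)) * cmod (u - w) * (\<kappa> ^ n * (s - r))"
        using \<kappa> s uw by (intro mult_pos_pos) auto
    qed (use uwge s P0 \<kappa> in \<open>auto intro!: prod_nonneg divide_nonneg_nonneg mult_nonneg_nonneg\<close>)
    finally show "cmod (f u / (u - w) - (\<Sum>k<n. f u * interp_dual b k u * interp_basis b k w)) \<le> X"
      by (simp add: X_def)
  qed (use X0 s0 in auto)
  moreover have "2 * of_real pi * \<i> * f w - (\<Sum>k<n. 2 * of_real pi * \<i> * interp_coef s b k f * interp_basis b k w)
      = 2 * of_real pi * \<i> * (f w - interp s b n f w)"
    by (simp add: interp_def right_diff_distrib sum_distrib_left mult.assoc)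
  ultimately have "2 * pi * cmod (f w - interp s b n f w) \<le> 2 * pi * (X * s)"
    by (simp only: norm_mult norm_ii norm_of_real norm_numeral mult_1_right abs_of_pos[OF pi_gt_zero] mult_ac)
  then have "cmod (f w - interp s b n f w) \<le> X * s"
    by (rule mult_left_le_imp_le) simp
  also have "\<dots> \<le> X * 1" using s X0 by (intro mult_left_mono) auto
  finally show ?thesis by (simp add: X_def P_def mult_ac)
qed

lemma blaschke_holomorphic: "b \<in> disk \<Longrightarrow> blaschke b holomorphic_on disk"
  unfolding blaschke_def using one_minus_cnj_mult_nz by (intro holomorphic_intros) auto

lemma interp_basis_holomorphic: "(\<And>i. i \<le> k \<Longrightarrow> b i \<in> disk) \<Longrightarrow> interp_basis b k holomorphic_on disk"
  unfolding interp_basis_def using one_minus_cnj_mult_nz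
  by (intro holomorphic_intros blaschke_holomorphic) auto

lemma norm_interp_basis_le:
  assumes "\<And>i. i \<le> k \<Longrightarrow> cmod (b i) \<le> r" "r < 1" "z \<in> disk"
  shows "cmod (interp_basis b k z) \<le> 1 / (1 - r)"
proof -
  have bd: "b i \<in> disk" if "i \<le> k" for i
    using assms(1)[OF that] assms(2) by (simp add: mem_disk_iff)
  have "cmod (b k) * cmod z \<le> r * 1"
    using assms(1)[of k] assms(3) order_trans[OF norm_ge_zero assms(1)[of k]]
    by (intro mult_mono) (auto simp: mem_disk_iff)
  then have "1 - r \<le> cmod (1 - cnj (b k) * z)"
    using norm_triangle_ineq2[of 1 "cnj (b k) * z"] by (simp add: norm_mult)
  moreover have "(\<Prod>i<k. pdist z (b i)) \<le> 1"
    using bd assms(3) by (intro prod_le_1) (auto intro: less_imp_le pdist_less_1)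
  ultimately show ?thesis
    unfolding interp_basis_def norm_divide prod_norm[symmetric] norm_blaschke using assms(2)
    by (intro frac_le) (auto intro: prod_nonneg)
qed

lemma interp_coef_add:
  assumes "f \<in> Hp p" "g \<in> Hp p" "0 < s" "s < 1" "\<And>i. i \<le> k \<Longrightarrow> cmod (b i) < s"
  shows "interp_coef s b k (\<lambda>z. f z + g z) = interp_coef s b k f + interp_coef s b k g"
proof -
  have "((\<lambda>z. f z * interp_dual b k z + g z * interp_dual b k z) has_contour_integral
     (2 * of_real pi * \<i> * interp_coef s b k f + 2 * of_real pi * \<i> * interp_coef s b k g)) (circlepath 0 s)"
    by (intro has_contour_integral_add interp_coef_has_contour_integral[OF assms(1)] interp_coef_has_contour_integral[OF assms(2)] assms(3-5))
  then show ?thesis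
    unfolding interp_coef_def[of s b k "\<lambda>z. f z + g z"]
    by (simp add: contour_integral_unique distrib_right) (simp add: field_simps)
qed

lemma interp_coef_cmult:
  assumes "f \<in> Hp p" "0 < s" "s < 1" "\<And>i. i \<le> k \<Longrightarrow> cmod (b i) < s"
  shows "interp_coef s b k (\<lambda>z. c * f z) = c * interp_coef s b k f"
proof -
  have "((\<lambda>z. c * (f z * interp_dual b k z)) has_contour_integral
     (c * (2 * of_real pi * \<i> * interp_coef s b k f))) (circlepath 0 s)"
    by (intro has_contour_integral_lmul interp_coef_has_contour_integral[OF assms(1)] assms(2-4))
  then show ?thesis
    unfolding interp_coef_def[of s b k "\<lambda>z. c * f z"]
    by (simp add: contour_integral_unique mult.assoc) (simp add: algebra_simps)
qed

lemma bounded_op_interp: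
  assumes p: "p \<ge> 1" and \<phi>: "\<phi> holomorphic_on disk" "\<phi> ` disk \<subseteq> disk"
    and s: "0 \<le> r" "r < s" "s < 1" and b: "\<And>i. i < n \<Longrightarrow> cmod (b i) \<le> r"
  shows "bounded_op p (\<lambda>f. comp_op \<phi> (interp s b n f))"
proof -
  have s0: "0 < s" using s by simp
  have bs: "cmod (b i) < s" if "i < n" for i using b[OF that] s by simp
  have bd: "b i \<in> disk" if "i < n" for i using bs[OF that] s by (simp add: mem_disk_iff)
  have "\<forall>k\<in>{..<n}. \<exists>C\<ge>0. \<forall>f\<in>Hp p. cmod (interp_coef s b k f) \<le> C * hp_norm p f"
    using bs by (intro ballI interp_coef_bounded p s0 s) auto
  then obtain C where C: "\<And>k. k < n \<Longrightarrow> C k \<ge> 0" "\<And>k f. k < n \<Longrightarrow> f \<in> Hp p \<Longrightarrow> cmod (interp_coef s b k f) \<le> C k * hp_norm p f"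
    by (subst (asm) bchoice_iff) auto
  define D where "D = (\<Sum>k<n. C k * (1 / (1 - r)))"
  have le: "cmod (interp s b n f z) \<le> D * hp_norm p f" if "f \<in> Hp p" "z \<in> disk" for f z
  proof -
    have "cmod (interp s b n f z) \<le> (\<Sum>k<n. cmod (interp_coef s b k f * interp_basis b k z))"
      unfolding interp_def by (rule norm_sum)
    also have "\<dots> \<le> (\<Sum>k<n. C k * hp_norm p f * (1 / (1 - r)))"
      unfolding norm_mult using that C s b
      by (intro sum_mono mult_mono norm_interp_basis_le) (auto)
    also have "\<dots> = D * hp_norm p f"
      unfolding D_def sum_distrib_right by (intro sum.cong) auto
    finally show ?thesis .
  qed
  have hol: "interp s b n f holomorphic_on disk" for f
    unfolding interp_def by (intro holomorphic_intros interp_basis_holomorphic) (auto intro: bd)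
  have im: "\<phi> z \<in> disk" if "z \<in> disk" for z using that \<phi> by auto
  have *: "comp_op \<phi> (interp s b n f) \<in> Hp p" "hp_norm p (comp_op \<phi> (interp s b n f)) \<le> D * hp_norm p f"
    if f: "f \<in> Hp p" for f
    by (intro bounded_holomorphic_in_Hp[OF p comp_op_holomorphic[OF \<phi> hol]];
        use le[OF f] im in \<open>auto simp: comp_op_def\<close>)+
  have add: "interp s b n (\<lambda>z. f z + g z) w = interp s b n f w + interp s b n g w"
    if "f \<in> Hp p" "g \<in> Hp p" for f g w
  proof -
    have "interp_coef s b k (\<lambda>z. f z + g z) = interp_coef s b k f + interp_coef s b k g" if "k < n" for k
      using that bs by (intro interp_coef_add[OF \<open>f \<in> Hp p\<close> \<open>g \<in> Hp p\<close> s0 s(3)]) auto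
    then show ?thesis by (simp add: interp_def sum.distrib distrib_right)
  qed
  have mult: "interp s b n (\<lambda>z. c * f z) w = c * interp s b n f w" if "f \<in> Hp p" for f c w
  proof -
    have "interp_coef s b k (\<lambda>z. c * f z) = c * interp_coef s b k f" if "k < n" for k
      using that bs by (intro interp_coef_cmult[OF \<open>f \<in> Hp p\<close> s0 s(3)]) auto
    then show ?thesis by (simp add: interp_def sum_distrib_left mult.assoc)
  qed
  show ?thesis
    unfolding bounded_op_def
    by (intro conjI exI[of _ D]) (use * add mult in \<open>auto simp: comp_op_def fun_eq_iff\<close>)
qed

lemma rank_lt_interp: "rank_lt p (\<lambda>f. comp_op \<phi> (interp s b n f)) (Suc n)"
  unfolding rank_lt_def
  by (intro exI[of _ n] conjI exI[of _ "\<lambda>i. comp_op \<phi> (interp_basis b i)"] ballI, simp)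
     (rule_tac x = "\<lambda>k. interp_coef s b k f" in exI, auto simp: comp_op_def interp_def)

section \<open>Admissible competitors for approximation numbers\<close>

lemma zero_in_Hp: "p \<ge> 1 \<Longrightarrow> (\<lambda>_. 0) \<in> Hp p" "p \<ge> 1 \<Longrightarrow> hp_norm p (\<lambda>_. 0) = 0"
  using bounded_holomorphic_in_Hp[of p "\<lambda>_. 0" 0] by (auto simp: order_antisym)

lemma bdd_above_op_diff:
  assumes p: "p \<ge> 1" and T: "bounded_op p T" and R: "bounded_op p R"
  shows "bdd_above ((\<lambda>f. hp_norm p (\<lambda>z. T f z - R f z)) ` {f \<in> Hp p. hp_norm p f \<le> 1})"
proof -
  obtain C D where C: "\<And>f. f \<in> Hp p \<Longrightarrow> hp_norm p (T f) \<le> C * hp_norm p f"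
    and D: "\<And>f. f \<in> Hp p \<Longrightarrow> hp_norm p (R f) \<le> D * hp_norm p f"
    using T R unfolding bounded_op_def by metis
  show ?thesis
  proof (rule bdd_aboveI[of _ "4 * (\<bar>C\<bar> + \<bar>D\<bar>)"], clarify)
    fix f assume f: "f \<in> Hp p" "hp_norm p f \<le> 1"
    have "hp_norm p (\<lambda>z. T f z - R f z) \<le> 4 * (hp_norm p (T f) + hp_norm p (R f))"
      using T R f by (intro hp_norm_diff_le p) (auto simp: bounded_op_def)
    also have "\<dots> \<le> 4 * (\<bar>C\<bar> + \<bar>D\<bar>)"
    proof -
      have "C * hp_norm p f \<le> \<bar>C\<bar> * 1" "D * hp_norm p f \<le> \<bar>D\<bar> * 1"
        using f by (intro mult_mono; simp)+
      then have "hp_norm p (T f) \<le> \<bar>C\<bar>" "hp_norm p (R f) \<le> \<bar>D\<bar>" using C[OF f(1)] D[OF f(1)] by linarith+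
      then show ?thesis by simp
    qed
    finally show "hp_norm p (\<lambda>z. T f z - R f z) \<le> 4 * (\<bar>C\<bar> + \<bar>D\<bar>)" .
  qed
qed

lemma op_norm_diff_ge:
  assumes "p \<ge> 1" "bounded_op p T" "bounded_op p R" "f \<in> Hp p" "hp_norm p f \<le> 1"
  shows "hp_norm p (\<lambda>z. T f z - R f z) \<le> op_norm p (\<lambda>f z. T f z - R f z)"
  unfolding op_norm_def using assms by (intro cSUP_upper bdd_above_op_diff) auto

lemma op_norm_diff_nonneg:
  assumes "p \<ge> 1" "bounded_op p T" "bounded_op p R"
  shows "0 \<le> op_norm p (\<lambda>f z. T f z - R f z)"
  by (rule order_trans[OF hp_norm_nonneg op_norm_diff_ge[OF assms zero_in_Hp(1)]])
     (use assms zero_in_Hp in auto)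

lemma op_norm_diff_le:
  assumes "p \<ge> 1" "\<And>f. f \<in> Hp p \<Longrightarrow> hp_norm p f \<le> 1 \<Longrightarrow> hp_norm p (\<lambda>z. T f z - R f z) \<le> C"
  shows "op_norm p (\<lambda>f z. T f z - R f z) \<le> C"
  unfolding op_norm_def using assms zero_in_Hp[OF assms(1)] by (intro cSUP_least) (auto simp: exI[of _ "\<lambda>_. 0"])

lemma approx_num_le:
  assumes "p \<ge> 1" "bounded_op p T" "bounded_op p R" "rank_lt p R n"
    "\<And>f. f \<in> Hp p \<Longrightarrow> hp_norm p f \<le> 1 \<Longrightarrow> hp_norm p (\<lambda>z. T f z - R f z) \<le> C"
  shows "approx_num p T n \<le> C"
proof -
  have "approx_num p T n \<le> op_norm p (\<lambda>f z. T f z - R f z)"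
    unfolding approx_num_def using assms op_norm_diff_nonneg[OF assms(1,2)]
    by (intro cInf_lower bdd_belowI[of _ 0]) auto
  also have "\<dots> \<le> C" by (rule op_norm_diff_le[OF assms(1,5)])
  finally show ?thesis .
qed

lemma bounded_op_zero: "p \<ge> 1 \<Longrightarrow> bounded_op p (\<lambda>f z. 0)"
  unfolding bounded_op_def using zero_in_Hp[of p] by (auto intro!: exI[of _ 0])

lemma approx_num_ge:
  assumes "p \<ge> 1" "n > 0" "bounded_op p T"
    "\<And>R. bounded_op p R \<Longrightarrow> rank_lt p R n \<Longrightarrow>
       \<exists>f\<in>Hp p. hp_norm p f \<le> 1 \<and> c \<le> hp_norm p (\<lambda>z. T f z - R f z)"
  shows "c \<le> approx_num p T n"
  unfolding approx_num_def
proof (rule cInf_greatest)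
  \<comment> \<open>As n > 0, the zero operator is a competitor and the infimum runs over a nonempty
    set.\<close>
  have "rank_lt p (\<lambda>f z. 0) n" unfolding rank_lt_def using assms(2) by (intro exI[of _ 0]) auto
  then show "{op_norm p (\<lambda>f z. T f z - R f z) | R. bounded_op p R \<and> rank_lt p R n} \<noteq> {}"
    using bounded_op_zero[OF assms(1)] by blast
  fix x assume "x \<in> {op_norm p (\<lambda>f z. T f z - R f z) | R. bounded_op p R \<and> rank_lt p R n}"
  then obtain R where R: "x = op_norm p (\<lambda>f z. T f z - R f z)" "bounded_op p R" "rank_lt p R n" by auto
  from assms(4)[OF R(2,3)] obtain f where "f \<in> Hp p" "hp_norm p f \<le> 1" "c \<le> hp_norm p (\<lambda>z. T f z - R f z)" by auto
  then show "c \<le> x" using op_norm_diff_ge[OF assms(1,3) R(2)] R(1) by fastforce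
qed

text \<open>After composition the error is evaluated at points of \<phi>(D), so the Blaschke product
  has to be small there while staying large on the circle |z| = s. With n nodes the rank is at most
  n, hence the index Suc n.\<close>

lemma approx_num_comp_op_le:
  assumes p: "p \<ge> 1" and \<phi>: "\<phi> holomorphic_on disk"
    and r: "\<And>z. z \<in> disk \<Longrightarrow> cmod (\<phi> z) \<le> r" and s: "r < s" "s < 1"
    and b: "\<And>i. i < n \<Longrightarrow> cmod (b i) \<le> r"
    and \<kappa>: "0 < \<kappa>" "\<And>i z. i < n \<Longrightarrow> cmod z = s \<Longrightarrow> \<kappa> \<le> pdist z (b i)"
    and D: "\<And>z. z \<in> disk \<Longrightarrow> (\<Prod>i<n. pdist (\<phi> z) (b i)) \<le> D"
  shows "approx_num p (comp_op \<phi>) (Suc n) \<le> 4 / ((1 - s) * (s - r) * \<kappa> ^ n) * D"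
proof -
  have r0: "0 \<le> r" using r[of 0] norm_ge_zero[of "\<phi> 0"] by (auto simp: mem_disk_iff simp del: norm_ge_zero)
  have im: "\<phi> ` disk \<subseteq> disk" using r s by (force simp: mem_disk_iff)
  define Q where "Q = 4 / ((1 - s) * (s - r) * \<kappa> ^ n)"
  have Q: "Q \<ge> 0" using s \<kappa> by (simp add: Q_def)
  have R: "bounded_op p (\<lambda>f. comp_op \<phi> (interp s b n f))"
    by (rule bounded_op_interp[OF p \<phi> im r0 s b])
  show ?thesis
    unfolding Q_def[symmetric]
  proof (rule approx_num_le[OF p bounded_op_comp_op[OF p \<phi> im] R rank_lt_interp])
    fix f assume f: "f \<in> Hp p" "hp_norm p f \<le> 1"
    have holR: "comp_op \<phi> (interp s b n f) \<in> Hp p" using R f by (simp add: bounded_op_def)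
    show "hp_norm p (\<lambda>z. comp_op \<phi> f z - comp_op \<phi> (interp s b n f) z) \<le> Q * D"
    proof (rule bounded_holomorphic_in_Hp(2)[OF p])
      show "(\<lambda>z. comp_op \<phi> f z - comp_op \<phi> (interp s b n f) z) holomorphic_on disk"
        by (intro holomorphic_on_diff comp_op_holomorphic[OF \<phi> im Hp_holo[OF f(1)]] Hp_holo[OF holR])
      fix z assume z: "z \<in> disk"
      have P0: "0 \<le> (\<Prod>i<n. pdist (\<phi> z) (b i))" by (intro prod_nonneg) auto
      have "cmod (f (\<phi> z) - interp s b n f (\<phi> z)) \<le> Q * (\<Prod>i<n. pdist (\<phi> z) (b i)) * hp_norm p f"
        unfolding Q_def by (rule interp_error[OF p f(1) s r[OF z] b \<kappa>])
      also have "\<dots> \<le> Q * (\<Prod>i<n. pdist (\<phi> z) (b i)) * 1"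
        using f Q P0 by (intro mult_left_mono mult_nonneg_nonneg) auto
      also have "\<dots> \<le> Q * D" using D[OF z] Q by (simp add: mult_left_mono)
      finally show "cmod (comp_op \<phi> f z - comp_op \<phi> (interp s b n f) z) \<le> Q * D"
        using z by (simp add: comp_op_def)
    qed (simp add: comp_op_def)
  qed
qed

section \<open>Lower bounds for approximation numbers\<close>

text \<open>Gaussian elimination on the last equation. If it is trivial on J it is dropped;
  otherwise it is solved for one unknown j0, and the remaining equations involve one unknown
  fewer.\<close>

lemma underdetermined_system:
  fixes A :: "nat \<Rightarrow> 'a \<Rightarrow> 'b::field"
  assumes "finite J" "m < card J"
  shows "\<exists>c. (\<exists>j\<in>J. c j \<noteq> 0) \<and> (\<forall>i<m. (\<Sum>j\<in>J. A i j * c j) = 0)"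
  using assms
proof (induction m arbitrary: J A)
  case 0
  then have "J \<noteq> {}" by auto
  then show ?case by (intro exI[of _ "\<lambda>_. 1"]) auto
next
  case (Suc m)
  show ?case
  proof (cases "\<exists>j0\<in>J. A m j0 \<noteq> 0")
    case False
    obtain c where "\<exists>j\<in>J. c j \<noteq> 0" "\<forall>i<m. (\<Sum>j\<in>J. A i j * c j) = 0"
      using Suc.IH[of J A] Suc.prems by auto
    then show ?thesis using False by (intro exI[of _ c]) (auto simp: less_Suc_eq)
  next
    case True
    then obtain j0 where j0: "j0 \<in> J" "A m j0 \<noteq> 0" by auto
    define J' where "J' = J - {j0}"
    define A' where "A' i j = A i j - A i j0 * A m j / A m j0" for i j
    have "finite J'" "m < card J'" using Suc.prems j0 by (auto simp: J'_def)
    then obtain c where c: "\<exists>j\<in>J'. c j \<noteq> 0" "\<forall>i<m. (\<Sum>j\<in>J'. A' i j * c j) = 0"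
      using Suc.IH[of J' A'] by auto
    define S where "S = (\<Sum>j\<in>J'. A m j * c j)"
    define c' where "c' = c(j0 := - S / A m j0)"
    have sum: "(\<Sum>j\<in>J. A i j * c' j) = (\<Sum>j\<in>J'. A i j * c j) - A i j0 * S / A m j0" for i
    proof -
      have "(\<Sum>j\<in>J. A i j * c' j) = A i j0 * c' j0 + (\<Sum>j\<in>J'. A i j * c' j)"
        unfolding J'_def using j0 Suc.prems by (intro sum.remove) auto
      also have "(\<Sum>j\<in>J'. A i j * c' j) = (\<Sum>j\<in>J'. A i j * c j)"
        by (intro sum.cong) (auto simp: J'_def c'_def)
      finally show ?thesis by (simp add: c'_def)
    qed
    have "(\<Sum>j\<in>J. A i j * c' j) = 0" if "i < Suc m" for i
    proof (cases "i = m")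
      case True
      then show ?thesis using sum[of m] j0 by (simp add: S_def)
    next
      case False
      then have "0 = (\<Sum>j\<in>J'. A' i j * c j)" using c that by simp
      also have "\<dots> = (\<Sum>j\<in>J'. A i j * c j) - A i j0 / A m j0 * S"
        unfolding A'_def S_def left_diff_distrib sum_subtractf sum_distrib_left
        by (intro arg_cong2[where f = minus] sum.cong) auto
      finally show ?thesis using sum[of i] by simp
    qed
    moreover have "\<exists>j\<in>J. c' j \<noteq> 0" using c(1) by (auto simp: J'_def c'_def)
    ultimately show ?thesis by blast
  qed
qed

text \<open>Linearity of R holds on \<open>Hp p\<close> only, so every partial sum must be shown to
  lie there before R is distributed over it.\<close>

lemma bounded_op_sum:
  assumes p: "p \<ge> 1" and R: "bounded_op p R" and "finite J"
    and f: "\<And>j. j \<in> J \<Longrightarrow> f j holomorphic_on disk" "\<And>j z. j \<in> J \<Longrightarrow> z \<notin> disk \<Longrightarrow> f j z = 0"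
      "\<And>j z. j \<in> J \<Longrightarrow> z \<in> disk \<Longrightarrow> cmod (f j z) \<le> 1"
  shows "(\<lambda>z. \<Sum>j\<in>J. c j * f j z) \<in> Hp p" "hp_norm p (\<lambda>z. \<Sum>j\<in>J. c j * f j z) \<le> (\<Sum>j\<in>J. cmod (c j))"
    "R (\<lambda>z. \<Sum>j\<in>J. c j * f j z) = (\<lambda>z. \<Sum>j\<in>J. c j * R (f j) z)"
proof -
  have Hp: "(\<lambda>z. \<Sum>j\<in>I. c j * f j z) \<in> Hp p \<and> hp_norm p (\<lambda>z. \<Sum>j\<in>I. c j * f j z) \<le> (\<Sum>j\<in>I. cmod (c j))"
    if I: "I \<subseteq> J" for I
  proof -
    have hol: "(\<lambda>z. \<Sum>j\<in>I. c j * f j z) holomorphic_on disk"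
      using f(1) I by (intro holomorphic_intros) auto
    have out: "(\<Sum>j\<in>I. c j * f j z) = 0" if "z \<notin> disk" for z
      using f(2) I that by (intro sum.neutral) auto
    have le: "cmod (\<Sum>j\<in>I. c j * f j z) \<le> (\<Sum>j\<in>I. cmod (c j))" if "z \<in> disk" for z
    proof -
      have "cmod (\<Sum>j\<in>I. c j * f j z) \<le> (\<Sum>j\<in>I. cmod (c j) * cmod (f j z))"
        by (rule order_trans[OF norm_sum]) (simp add: norm_mult)
      also have "\<dots> \<le> (\<Sum>j\<in>I. cmod (c j) * 1)"
        using f(3) that I by (intro sum_mono mult_left_mono) auto
      finally show ?thesis by simp
    qed
    show ?thesis using bounded_holomorphic_in_Hp[OF p hol out le] by blast
  qed
  show "(\<lambda>z. \<Sum>j\<in>J. c j * f j z) \<in> Hp p" "hp_norm p (\<lambda>z. \<Sum>j\<in>J. c j * f j z) \<le> (\<Sum>j\<in>J. cmod (c j))"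
    using Hp[of J] by auto
  have fHp: "f j \<in> Hp p" if "j \<in> J" for j
    using bounded_holomorphic_in_Hp(1)[OF p f(1)[OF that] f(2)[OF that] f(3)[OF that]] by blast
  have add: "R (\<lambda>z. f z + g z) = (\<lambda>z. R f z + R g z)" if "f \<in> Hp p" "g \<in> Hp p" for f g
    using R that by (simp add: bounded_op_def)
  have mult: "R (\<lambda>z. c * f z) = (\<lambda>z. c * R f z)" if "f \<in> Hp p" for f c
    using R that by (simp add: bounded_op_def)
  show "R (\<lambda>z. \<Sum>j\<in>J. c j * f j z) = (\<lambda>z. \<Sum>j\<in>J. c j * R (f j) z)"
    using \<open>finite J\<close> subset_refl[of J]
  proof (induction J rule: finite_subset_induct')
    case empty
    then show ?case using mult[OF zero_in_Hp(1)[OF p], of 0] by simp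
  next
    case (insert a F)
    have "(\<lambda>z. c a * f a z) \<in> Hp p" using Hp[of "{a}"] insert by simp
    moreover have "(\<lambda>z. \<Sum>j\<in>F. c j * f j z) \<in> Hp p" using Hp[of F] insert by simp
    ultimately have "R (\<lambda>z. c a * f a z + (\<Sum>j\<in>F. c j * f j z)) = (\<lambda>z. R (\<lambda>z. c a * f a z) z + R (\<lambda>z. \<Sum>j\<in>F. c j * f j z) z)"
      by (rule add)
    then show ?case
      using insert mult[OF fHp, of a "c a"] by simp
  qed
qed

text \<open>The Blaschke product f j vanishes at every w i with i \<noteq> j. R annihilates a
  nontrivial combination F of these n functions; normalised to coefficients of l1 norm 1, F is
  bounded by 1 and some coefficient has modulus at least 1/n, so |F (w j)| \<ge> \<tau>/n.
  Evaluation at \<zeta> j turns this into a lower bound for the norm of F composed with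
  \<phi>.\<close>

lemma approx_num_comp_op_ge:
  assumes p: "p \<ge> 1" and \<phi>: "\<phi> holomorphic_on disk" "\<phi> ` disk \<subseteq> disk" and n: "n > 0"
    and r: "r < 1" and \<zeta>: "\<And>i. i < n \<Longrightarrow> cmod (\<zeta> i) \<le> r" and w: "\<And>i. i < n \<Longrightarrow> w i = \<phi> (\<zeta> i)"
    and \<tau>: "0 \<le> \<tau>" "\<And>j. j < n \<Longrightarrow> \<tau> \<le> point_prod n w j"
  shows "(1 - r) / 4 * (\<tau> / real n) \<le> approx_num p (comp_op \<phi>) n"
proof (rule approx_num_ge[OF p n bounded_op_comp_op[OF p \<phi>]])
  fix R assume R: "bounded_op p R" "rank_lt p R n"
  have \<zeta>d: "\<zeta> i \<in> disk" if "i < n" for i using \<zeta>[OF that] r by (simp add: mem_disk_iff)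
  have wd: "w i \<in> disk" if "i < n" for i using \<zeta>d[OF that] w[OF that] \<phi> by auto
  define f where "f j z = (if z \<in> disk then \<Prod>i\<in>{..<n}-{j}. blaschke (w i) z else 0)" for j z
  have hol: "f j holomorphic_on disk" if "j < n" for j
  proof -
    have "(\<lambda>z. \<Prod>i\<in>{..<n}-{j}. blaschke (w i) z) holomorphic_on disk"
      by (intro holomorphic_intros blaschke_holomorphic) (auto intro: wd)
    then show ?thesis by (rule holomorphic_transform) (simp add: f_def)
  qed
  have out: "f j z = 0" if "z \<notin> disk" for j z using that by (simp add: f_def)
  have f1: "cmod (f j z) \<le> 1" if "z \<in> disk" for j z
    using that wd unfolding f_def by (auto simp: prod_norm[symmetric] norm_blaschke intro!: prod_pdist_le_1)
  have fHp: "f j \<in> Hp p" if "j < n" for j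
    by (rule bounded_holomorphic_in_Hp(1)[OF p hol[OF that] out f1])
  obtain m g where mg: "m < n" "\<And>f. f \<in> Hp p \<Longrightarrow> \<exists>c. R f = (\<lambda>z. \<Sum>i<m. c i * g i z)"
    using R(2) unfolding rank_lt_def by blast
  \<comment> \<open>\<open>rank_lt\<close> does not ask for coefficients linear in f. The n
    functions f j are expanded one by one; linearity enters through R itself.\<close>
  have "\<forall>j\<in>{..<n}. \<exists>c. R (f j) = (\<lambda>z. \<Sum>i<m. c i * g i z)"
    using mg(2) fHp by blast
  then obtain A where A: "\<And>j. j < n \<Longrightarrow> R (f j) = (\<lambda>z. \<Sum>i<m. A j i * g i z)"
    by (subst (asm) bchoice_iff) auto
  obtain c where c: "\<exists>j<n. c j \<noteq> 0" "\<And>i. i < m \<Longrightarrow> (\<Sum>j<n. A j i * c j) = 0"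
    using underdetermined_system[of "{..<n}" m "\<lambda>i j. A j i"] mg(1) by auto
  define \<sigma> where "\<sigma> = (\<Sum>j<n. cmod (c j))"
  have \<sigma>: "\<sigma> > 0"
    using c(1) unfolding \<sigma>_def by (auto intro!: sum_pos2)
  define F where "F z = (\<Sum>j<n. (c j / of_real \<sigma>) * f j z)" for z
  have "(\<Sum>j<n. cmod (c j / of_real \<sigma>)) = 1"
    using \<sigma> by (simp add: norm_divide sum_divide_distrib[symmetric] \<sigma>_def[symmetric])
  then have F: "F \<in> Hp p" "hp_norm p F \<le> 1" "R F = (\<lambda>z. \<Sum>j<n. (c j / of_real \<sigma>) * R (f j) z)"
    using bounded_op_sum[OF p R(1), of "{..<n}" f "\<lambda>j. c j / of_real \<sigma>"] hol out f1
    unfolding F_def by auto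
  have "R F z = 0" for z
  proof -
    have "R F z = (\<Sum>j<n. \<Sum>i<m. (A j i * c j) * (g i z / of_real \<sigma>))"
      unfolding F(3) by (intro sum.cong refl) (simp add: A sum_distrib_left mult_ac)
    also have "\<dots> = (\<Sum>i<m. (\<Sum>j<n. A j i * c j) * (g i z / of_real \<sigma>))"
      unfolding sum_distrib_right by (rule sum.swap)
    finally show ?thesis using c(2) by simp
  qed
  then have TR: "(\<lambda>z. comp_op \<phi> F z - R F z) = comp_op \<phi> F" by simp
  have "\<exists>j<n. \<sigma> / real n \<le> cmod (c j)"
  proof (rule ccontr)
    assume "\<not> ?thesis"
    then have "\<sigma> < (\<Sum>j<n. \<sigma> / real n)"
      using n by (subst \<sigma>_def) (intro sum_strict_mono, auto simp: not_le)
    then show False using n by simp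
  qed
  then obtain j where j: "j < n" "\<sigma> / real n \<le> cmod (c j)" by auto
  have "F (w j) = (c j / of_real \<sigma>) * f j (w j) + (\<Sum>k\<in>{..<n}-{j}. (c k / of_real \<sigma>) * f k (w j))"
    unfolding F_def using j by (intro sum.remove) auto
  also have "(\<Sum>k\<in>{..<n}-{j}. (c k / of_real \<sigma>) * f k (w j)) = 0"
  proof (intro sum.neutral ballI)
    fix k assume "k \<in> {..<n}-{j}"
    then have "(\<Prod>i\<in>{..<n}-{k}. blaschke (w i) (w j)) = 0"
      using j by (intro prod_zero) (auto simp: blaschke_def)
    then show "c k / complex_of_real \<sigma> * f k (w j) = 0" by (simp add: f_def)
  qed
  finally have "cmod (F (w j)) = cmod (c j) / \<sigma> * point_prod n w j"
    using \<sigma> wd[OF j(1)] by (simp add: norm_mult norm_divide f_def prod_norm[symmetric] norm_blaschke point_prod_def)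
  moreover have "1 / real n * \<tau> \<le> cmod (c j) / \<sigma> * point_prod n w j"
    using j n \<sigma> \<tau> by (intro mult_mono) (auto simp: field_simps)
  moreover have "cmod (comp_op \<phi> F (\<zeta> j)) \<le> 4 / (1 - r) * hp_norm p (comp_op \<phi> F)"
    using bounded_op_comp_op[OF p \<phi>] F(1) j \<zeta> r
    by (intro cmod_le_hp_norm p) (auto simp: bounded_op_def)
  moreover have "comp_op \<phi> F (\<zeta> j) = F (w j)" using \<zeta>d[OF j(1)] w[OF j(1)] by (simp add: comp_op_def)
  ultimately have "\<tau> / real n \<le> 4 / (1 - r) * hp_norm p (comp_op \<phi> F)"
    by simp
  then have "(1 - r) / 4 * (\<tau> / real n) \<le> (1 - r) / 4 * (4 / (1 - r) * hp_norm p (comp_op \<phi> F))"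
    using r by (intro mult_left_mono) auto
  then have "(1 - r) / 4 * (\<tau> / real n) \<le> hp_norm p (comp_op \<phi> F)"
    using r by simp
  then show "\<exists>f\<in>Hp p. hp_norm p f \<le> 1 \<and> (1 - r) / 4 * (\<tau> / real n) \<le> hp_norm p (\<lambda>z. comp_op \<phi> f z - R f z)"
    using F TR by (intro bexI[of _ F]) auto
qed

section \<open>Comparing products of distances along a continuum\<close>

lemma continuous_on_pdist: "K \<subseteq> disk \<Longrightarrow> w \<in> disk \<Longrightarrow> continuous_on K (pdist w)"
  unfolding pdist_def using one_minus_cnj_mult_nz
  by (intro continuous_intros) auto

lemma pdist_intermediate_value:
  assumes "connected K" "K \<subseteq> disk" "w \<in> disk" "x1 \<in> K" "x2 \<in> K" "pdist w x1 \<le> s" "s \<le> pdist w x2"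
  shows "\<exists>x\<in>K. pdist w x = s"
proof -
  have "connected (pdist w ` K)"
    by (intro connected_continuous_image continuous_on_pdist assms)
  from connectedD_interval[OF this, of "pdist w x1" "pdist w x2" s] assms show ?thesis by auto
qed

text \<open>The radial estimate centred at a gives |\<rho>(a,b) - \<rho>(a,w)| \<le>
  \<rho>(b,w).\<close>

lemma pdist_triangle:
  assumes "a \<in> disk" "b \<in> disk" "w \<in> disk"
  shows "pdist a b \<le> pdist w a + pdist w b"
proof -
  have "pdist a b * pdist a w < 1 * 1"
    using assms by (intro mult_strict_mono') (auto intro: pdist_less_1)
  then have "\<bar>pdist a b - pdist a w\<bar> / 1 \<le> \<bar>pdist a b - pdist a w\<bar> / (1 - pdist a b * pdist a w)"
    by (intro divide_left_mono) (auto)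
  also have "\<dots> \<le> pdist b w" by (rule pdist_ge_radial_center) (use assms in auto)
  finally show ?thesis by (simp add: pdist_commute[of w])
qed

lemma pdist_far_point:
  assumes "a \<in> disk" "b \<in> disk" "w \<in> disk"
  shows "pdist a b / 2 \<le> pdist w a \<or> pdist a b / 2 \<le> pdist w b"
  using pdist_triangle[OF assms] by linarith

lemma ln_div_mult_exp: "(d::real) > 0 \<Longrightarrow> ln (d / (d * exp y)) = - y"
  by (simp add: ln_div ln_mult)

text \<open>Near-extremality compares any point of K with each w j, but at w k the full product is
  zero. Moving from w k to a point x of K at distance at least \<eta> loses only exp(-\<epsilon> n)
  in the other factors and makes the factor \<rho>(x, w k) at least \<eta>. Leaving out the factor
  for j instead of the one for k at x then compares the two potentials.\<close>

lemma point_prod_lower_bound: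
  assumes K: "connected K" "K \<subseteq> disk" and ab: "a \<in> K" "b \<in> K" "a \<noteq> b" and \<epsilon>: "\<epsilon> > 0"
    and w: "\<And>i. i < n \<Longrightarrow> w i \<in> K"
    and F: "\<And>z j. z \<in> K \<Longrightarrow> j < n \<Longrightarrow> (\<Prod>i\<in>{..<n}-{j}. pdist z (w i)) \<le> 2 * point_prod n w j"
    and jk: "j < n" "k < n"
  shows "pdist a b / 4 * exp (- 4 / \<epsilon>) * exp (- \<epsilon> * real n) * point_prod n w k \<le> point_prod n w j"
proof -
  \<comment> \<open>Of two points at distance 2 d one is at distance at least d from w k, so K
    reaches every circle up to d.\<close>
  define d where "d = pdist a b / 2"
  \<comment> \<open>Makes ln (d/\<eta>) = 4/\<epsilon>, so the averaging loss is exp(-\<epsilon>)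
    per point.\<close>
  define \<eta> where "\<eta> = d * exp (- 4 / \<epsilon>)"
  have ad: "a \<in> disk" "b \<in> disk" "w k \<in> disk" using ab K w jk by auto
  have d: "0 < d" using pdist_pos[OF ad(1,2) ab(3)] by (simp add: d_def)
  have \<eta>: "0 < \<eta>" "\<eta> < d" using d \<epsilon> by (auto simp: \<eta>_def)
  have L: "ln (d / \<eta>) = 4 / \<epsilon>" using d ln_div_mult_exp[of d "- 4 / \<epsilon>"] by (simp add: \<eta>_def)
  have ex: "\<exists>x\<in>K. pdist (w k) x = s" if "\<eta> \<le> s" "s \<le> d" for s
  proof -
    obtain x2 where "x2 \<in> K" "d \<le> pdist (w k) x2"
      using pdist_far_point[OF ad] ab by (auto simp: d_def)
    moreover have "pdist (w k) (w k) \<le> s" using that \<eta> by (simp add: pdist_def)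
    ultimately show ?thesis
      using that w jk by (intro pdist_intermediate_value[OF K ad(3)]) auto
  qed
  obtain x where x: "x \<in> K" "\<eta> \<le> pdist (w k) x" and
    le: "exp (- 4 * real (card ({..<n}-{k})) / ln (d / \<eta>)) * (\<Prod>i\<in>{..<n}-{k}. pdist (w k) (w i)) \<le> (\<Prod>i\<in>{..<n}-{k}. pdist x (w i))"
    using exists_prod_pdist_ge_center[of "{..<n}-{k}" w "w k" K \<eta> d] ad K w ex \<eta> by (auto simp: subset_iff)
  have xd: "x \<in> disk" using x K by auto
  have "exp (- \<epsilon> * real n) \<le> exp (- 4 * real (card ({..<n}-{k})) / ln (d / \<eta>))"
  proof -
    have "real (card ({..<n}-{k})) \<le> real n" using jk by simp
    then show ?thesis unfolding L using \<epsilon> by (simp add: mult.commute mult_left_mono)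
  qed
  then have "exp (- \<epsilon> * real n) * point_prod n w k \<le> (\<Prod>i\<in>{..<n}-{k}. pdist x (w i))"
    by (rule order_trans[OF mult_right_mono[OF _ point_prod_nonneg] le[folded point_prod_def]])
  then have "\<eta> * (exp (- \<epsilon> * real n) * point_prod n w k) \<le> pdist x (w k) * (\<Prod>i\<in>{..<n}-{k}. pdist x (w i))"
    using x \<eta> by (intro mult_mono) (auto simp: pdist_commute point_prod_nonneg)
  also have "\<dots> = (\<Prod>i<n. pdist x (w i))"
    using jk by (intro prod.remove[symmetric]) auto
  also have "\<dots> = pdist x (w j) * (\<Prod>i\<in>{..<n}-{j}. pdist x (w i))"
    using jk by (intro prod.remove) auto
  also have "\<dots> \<le> 1 * (\<Prod>i\<in>{..<n}-{j}. pdist x (w i))"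
    using xd w jk K by (intro mult_right_mono prod_nonneg less_imp_le[OF pdist_less_1]) auto
  also have "\<dots> \<le> 2 * point_prod n w j" using F[OF x(1) jk(1)] by simp
  finally show ?thesis by (simp add: \<eta>_def d_def mult_ac)
qed

text \<open>If K comes within \<eta> of w, it meets all circles about w between \<eta> and d. At a
  point of K on one of them the product is at least exp(-\<epsilon> card I) times its value at w,
  and it is at most D there.\<close>

lemma prod_pdist_extend:
  assumes K: "connected K" "K \<subseteq> disk" and ab: "a \<in> K" "b \<in> K" "a \<noteq> b" and \<epsilon>: "\<epsilon> > 0"
    and w: "w \<in> disk" and near: "x1 \<in> K" "pdist w x1 \<le> pdist a b / 2 * exp (- 4 / \<epsilon>)"
    and I: "finite I" "\<And>i. i \<in> I \<Longrightarrow> z i \<in> disk"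
    and D: "\<And>x. x \<in> K \<Longrightarrow> (\<Prod>i\<in>I. pdist x (z i)) \<le> D"
  shows "(\<Prod>i\<in>I. pdist w (z i)) \<le> exp (\<epsilon> * real (card I)) * D"
proof -
  define d where "d = pdist a b / 2"
  define \<eta> where "\<eta> = d * exp (- 4 / \<epsilon>)"
  have ad: "a \<in> disk" "b \<in> disk" using ab K by auto
  have d: "0 < d" using pdist_pos[OF ad ab(3)] by (simp add: d_def)
  have \<eta>: "0 < \<eta>" "\<eta> < d" using d \<epsilon> by (auto simp: \<eta>_def)
  have L: "ln (d / \<eta>) = 4 / \<epsilon>" using d ln_div_mult_exp[of d "- 4 / \<epsilon>"] by (simp add: \<eta>_def)
  have ex: "\<exists>x\<in>K. pdist w x = s" if "\<eta> \<le> s" "s \<le> d" for s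
  proof -
    obtain x2 where "x2 \<in> K" "d \<le> pdist w x2"
      using pdist_far_point[OF ad w] ab by (auto simp: d_def)
    then show ?thesis
      using that near by (intro pdist_intermediate_value[OF K w near(1)]) (auto simp: \<eta>_def d_def)
  qed
  obtain x where x: "x \<in> K" and
    le: "exp (- 4 * real (card I) / ln (d / \<eta>)) * (\<Prod>i\<in>I. pdist w (z i)) \<le> (\<Prod>i\<in>I. pdist x (z i))"
    using exists_prod_pdist_ge_center[of I z w K \<eta> d] I w K(2) \<eta> ex by blast
  have "exp (- (\<epsilon> * real (card I))) * (\<Prod>i\<in>I. pdist w (z i)) \<le> D"
    using le D[OF x] unfolding L using \<epsilon> by (simp add: mult.commute)
  then show ?thesis
    by (simp add: exp_minus divide_simps mult.commute)
qed

section \<open>Limits\<close>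

text \<open>By the open mapping theorem the images of the disks of radius 1 - 1/(k+1) form an
  increasing open cover of K, so a single one suffices.\<close>

lemma exists_cball_image_superset:
  assumes \<phi>: "\<phi> holomorphic_on disk" and nc: "\<not> \<phi> constant_on disk"
    and K: "compact K" "K \<subseteq> \<phi> ` disk"
  shows "\<exists>r. 0 \<le> r \<and> r < 1 \<and> K \<subseteq> \<phi> ` cball 0 r"
proof -
  define U where "U k = \<phi> ` ball 0 (1 - 1 / real (Suc k))" for k
  have op: "open (U k)" for k
    unfolding U_def
  proof (rule open_mapping_thm[OF \<phi> _ _ _ _ nc])
    show "ball 0 (1 - 1 / real (Suc k)) \<subseteq> disk" unfolding disk_def by (rule subset_ball) simp
  qed (auto simp: disk_def)
  have "K \<subseteq> (\<Union>k. U k)"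
  proof
    fix x assume "x \<in> K"
    then obtain z where z: "z \<in> disk" "x = \<phi> z" using K by auto
    obtain k where "inverse (real (Suc k)) < 1 - cmod z"
      using reals_Archimedean[of "1 - cmod z"] z by (auto simp: mem_disk_iff)
    then have "x \<in> U k" using z by (auto simp: U_def divide_inverse)
    then show "x \<in> (\<Union>k. U k)" by auto
  qed
  then obtain F where F: "finite F" "K \<subseteq> (\<Union>k\<in>F. U k)"
    using compactE_image[OF K(1), of UNIV U] op by auto
  define N where "N = Max (insert 0 F)"
  have "U k \<subseteq> \<phi> ` cball 0 (1 - 1 / real (Suc N))" if "k \<in> F" for k
  proof -
    have "k \<le> N" using F that by (auto simp: N_def)
    then have "1 - 1 / real (Suc k) \<le> 1 - 1 / real (Suc N)" by (simp add: frac_le)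
    then show ?thesis unfolding U_def by (intro image_mono) auto
  qed
  then show ?thesis using F by (intro exI[of _ "1 - 1 / real (Suc N)"]) fastforce
qed

lemma not_constant_on_disk:
  assumes "z \<in> disk" "f z \<noteq> f 0"
  shows "\<not> f constant_on disk"
proof
  assume "f constant_on disk"
  moreover have "0 \<in> disk" by (simp add: mem_disk_iff)
  ultimately show False using assms unfolding constant_on_def by metis
qed

lemma cball_image_facts:
  assumes \<phi>: "\<phi> holomorphic_on disk" "\<phi> ` disk \<subseteq> disk" and r: "0 \<le> r" "r < 1"
  shows "compact (\<phi> ` cball 0 r)" "connected (\<phi> ` cball 0 r)" "\<phi> ` cball 0 r \<subseteq> \<phi> ` disk" "\<phi> ` cball 0 r \<subseteq> disk"
proof -
  have sub: "cball 0 r \<subseteq> disk" using r by (auto simp: mem_disk_iff)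
  have c: "continuous_on (cball 0 r) \<phi>"
    by (rule continuous_on_subset[OF holomorphic_on_imp_continuous_on[OF \<phi>(1)] sub])
  show "compact (\<phi> ` cball 0 r)" by (intro compact_continuous_image c) auto
  show "connected (\<phi> ` cball 0 r)" by (intro connected_continuous_image c) auto
  show "\<phi> ` cball 0 r \<subseteq> \<phi> ` disk" "\<phi> ` cball 0 r \<subseteq> disk" using sub \<phi>(2) by auto
qed

lemma infinite_connected:
  assumes "connected K" "a \<in> K" "b \<in> K" "a \<noteq> (b::complex)"
  shows "infinite K"
  using connected_finite_iff_sing[OF assms(1)] assms by auto

lemma power_quarter_le:
  assumes "n > 0" "(x::real) \<ge> 0"
  shows "(x / 4) ^ n \<le> x ^ n / 4"
proof -
  have "(4::real) ^ 1 \<le> 4 ^ n" using assms by (intro power_increasing) auto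
  then show ?thesis unfolding power_divide using assms by (intro divide_left_mono) auto
qed

text \<open>Points drawn from \<mu> have \<open>fekete\<close> at least exp(-I n^2), and near-Fekete
  points on a larger continuum K do as well up to the factor 4. The geometric mean gives a single k
  with large \<open>point_prod\<close>; \<open>point_prod_lower_bound\<close> spreads this to all n
  points at the price exp(-\<epsilon> n).\<close>

lemma approx_num_lower_energy:
  assumes p: "p \<ge> 1" and \<phi>: "\<phi> holomorphic_on disk" "\<phi> ` disk \<subseteq> disk"
    and z1: "z1 \<in> disk" "\<phi> z1 \<noteq> \<phi> 0" and \<mu>: "\<mu> \<in> adm_measures (\<phi> ` disk)"
    and I: "green_energy \<mu> = ennreal I" "I \<ge> 0" and \<epsilon>: "\<epsilon> > 0"
  shows "\<exists>c>0. \<forall>n>0. c / real n * exp (- (I + \<epsilon>) * real n) \<le> approx_num p (comp_op \<phi>) n"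
proof -
  have nc: "\<not> \<phi> constant_on disk"
    by (rule not_constant_on_disk[OF z1])
  obtain K0 where K0: "compact K0" "K0 \<subseteq> \<phi> ` disk" "emeasure \<mu> K0 = 1"
    and m: "sets \<mu> = sets borel" "prob_space \<mu>"
    using \<mu> by (auto simp: adm_measures_def)
  obtain r0 where r0: "0 \<le> r0" "r0 < 1" "K0 \<subseteq> \<phi> ` cball 0 r0"
    using exists_cball_image_superset[OF \<phi>(1) nc K0(1,2)] by auto
  \<comment> \<open>The image of this disk contains both K0, which carries \<mu>, and the two
    distinct points \<phi>(0) and \<phi>(z1), so K is a nondegenerate continuum.\<close>
  define r where "r = max r0 (cmod z1)"
  have r: "0 \<le> r" "r < 1" using r0 z1 by (auto simp: r_def mem_disk_iff)
  define K where "K = \<phi> ` cball 0 r"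
  note K = cball_image_facts[OF \<phi> r, folded K_def]
  define a b where "a = \<phi> 0" and "b = \<phi> z1"
  have ab: "a \<in> K" "b \<in> K" "a \<noteq> b" using r z1 by (auto simp: K_def a_def b_def r_def)
  have K0K: "K0 \<subseteq> K" using r0(3) by (force simp: K_def r_def)
  have inf: "infinite K" by (rule infinite_connected[OF K(2) ab])
  define q where "q = pdist a b / 4 * exp (- 4 / \<epsilon>)"
  have "pdist a b > 0" using ab K(4) by (intro pdist_pos) auto
  then have q: "q > 0" by (simp add: q_def)
  have main: "(1 - r) / 4 * (q / 4) / real n * exp (- (I + \<epsilon>) * real n) \<le> approx_num p (comp_op \<phi>) n"
    if n: "n > 0" for n
  proof -
    obtain w where w: "\<And>i. i < n \<Longrightarrow> w i \<in> K" "inj_on w {..<n}"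
      "\<And>v. (\<And>i. i < n \<Longrightarrow> v i \<in> K) \<Longrightarrow> fekete n v \<le> 4 * fekete n w"
      "\<And>z j. z \<in> K \<Longrightarrow> j < n \<Longrightarrow> (\<Prod>i\<in>{..<n}-{j}. pdist z (w i)) \<le> 2 * point_prod n w j"
      by (rule near_Fekete[OF K(4) inf, of n]) blast
    obtain v where v: "\<forall>i<n. v i \<in> K0" "exp (- I) ^ (n * n) \<le> fekete n v"
      using exists_points_fekete_ge[OF m(2,1) K0(1,3) _ I, of n] K0 \<phi>(2) by auto
    have "(exp (- I) ^ n / 4) ^ n \<le> (exp (- I) ^ n) ^ n / 4"
      by (rule power_quarter_le[OF n]) simp
    also have "\<dots> = exp (- I) ^ (n * n) / 4" by (simp add: power_mult)
    also have "\<dots> \<le> fekete n w"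
    proof -
      have "fekete n v \<le> 4 * fekete n w" by (rule w(3)) (use v K0K in auto)
      then show ?thesis using v(2) by simp
    qed
    finally obtain k where k: "k < n" "exp (- I) ^ n / 4 \<le> point_prod n w k"
      using exists_point_prod_ge_fekete_root[OF n, of "exp (- I) ^ n / 4" w] by auto
    define \<tau> where "\<tau> = q * exp (- \<epsilon> * real n) * (exp (- I) ^ n / 4)"
    have \<tau>: "\<tau> \<le> point_prod n w j" if "j < n" for j
    proof -
      have "\<tau> \<le> q * exp (- \<epsilon> * real n) * point_prod n w k"
        unfolding \<tau>_def using k q by (intro mult_left_mono) auto
      also have "\<dots> \<le> point_prod n w j"
        unfolding q_def by (rule point_prod_lower_bound[OF K(2,4) ab \<epsilon> w(1,4) that k(1)])
      finally show ?thesis .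
    qed
    have "\<forall>i\<in>{..<n}. \<exists>\<zeta>. cmod \<zeta> \<le> r \<and> w i = \<phi> \<zeta>" using w(1) by (force simp: K_def)
    then obtain \<zeta> where \<zeta>: "\<And>i. i < n \<Longrightarrow> cmod (\<zeta> i) \<le> r" "\<And>i. i < n \<Longrightarrow> w i = \<phi> (\<zeta> i)"
      by (subst (asm) bchoice_iff) auto
    have "(1 - r) / 4 * (\<tau> / real n) \<le> approx_num p (comp_op \<phi>) n"
      by (rule approx_num_comp_op_ge[OF p \<phi> n r(2) \<zeta> _ \<tau>]) (use q in \<open>auto simp: \<tau>_def\<close>)
    moreover have "exp (- I) ^ n * exp (- \<epsilon> * real n) = exp (- (I + \<epsilon>) * real n)"
      unfolding exp_of_nat_mult[symmetric] exp_add[symmetric] by (simp add: algebra_simps)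
    then have "(1 - r) / 4 * (\<tau> / real n) = (1 - r) / 4 * (q / 4) / real n * exp (- (I + \<epsilon>) * real n)"
      by (simp add: \<tau>_def mult_ac)
    ultimately show ?thesis by simp
  qed
  show ?thesis
    by (intro exI[of _ "(1 - r) / 4 * (q / 4)"] conjI allI impI main) (use q r in auto)
qed

text \<open>The moduli of the points of K fill the interval from |\<phi>(0)| to |\<phi>(z1)|, whose
  hyperbolic length is so large that for any n - 1 points of the disk some x in K has product at
  least exp(-\<epsilon> n). Near-extremality gives every \<open>point_prod\<close> at least half of
  that.\<close>

lemma approx_num_lower_boundary:
  assumes p: "p \<ge> 1" and \<phi>: "\<phi> holomorphic_on disk" "\<phi> ` disk \<subseteq> disk"
    and sup: "(SUP z\<in>disk. cmod (\<phi> z)) = 1" and \<epsilon>: "\<epsilon> > 0"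
  shows "\<exists>c>0. \<forall>n>0. c / real n * exp (- \<epsilon> * real n) \<le> approx_num p (comp_op \<phi>) n"
proof -
  have d0: "0 \<in> disk" by (simp add: mem_disk_iff)
  define a where "a = cmod (\<phi> 0)"
  have a: "0 \<le> a" "a < 1" using \<phi>(2) d0 by (auto simp: a_def mem_disk_iff image_subset_iff)
  \<comment> \<open>This level makes (1 - a)/(1 - b) \<ge> exp(8/\<epsilon>), so that 8/L \<le>
    \<epsilon> in the averaging bound.\<close>
  have "1 - (1 - a) * exp (- 8 / \<epsilon>) < (SUP z\<in>disk. cmod (\<phi> z))" using sup a by simp
  moreover have "bdd_above ((\<lambda>z. cmod (\<phi> z)) ` disk)"
    using \<phi>(2) by (intro bdd_aboveI[of _ 1]) (auto simp: mem_disk_iff image_subset_iff less_imp_le)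
  ultimately obtain z1 where z1: "z1 \<in> disk" "1 - (1 - a) * exp (- 8 / \<epsilon>) < cmod (\<phi> z1)"
    using d0 by (subst (asm) less_cSUP_iff) auto
  define b where "b = cmod (\<phi> z1)"
  have b1: "b < 1" using \<phi>(2) z1 by (auto simp: b_def mem_disk_iff image_subset_iff)
  have "(1 - a) * exp (- 8 / \<epsilon>) < (1 - a) * 1" using a \<epsilon> by (intro mult_strict_left_mono) auto
  then have ab: "a < b" using z1 by (simp add: b_def)
  define L where "L = ln ((1 - a) / (1 - b))"
  have "8 / \<epsilon> \<le> L"
  proof -
    have "(1 - b) * exp (8 / \<epsilon>) \<le> (1 - a) * exp (- 8 / \<epsilon>) * exp (8 / \<epsilon>)"
      using z1 by (intro mult_right_mono) (auto simp: b_def)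
    also have "\<dots> = 1 - a" by (simp add: mult.assoc exp_add[symmetric])
    finally have "exp (8 / \<epsilon>) \<le> (1 - a) / (1 - b)"
      using b1 by (simp add: pos_le_divide_eq mult.commute)
    then show ?thesis using a b1 by (simp add: L_def ln_ge_iff)
  qed
  then have "8 \<le> L * \<epsilon>" using pos_divide_le_eq[OF \<epsilon>] by blast
  moreover have L0: "L > 0" using ab b1 by (simp add: L_def)
  ultimately have L: "L > 0" "8 / L \<le> \<epsilon>" using pos_divide_le_eq[OF L0] by (auto simp: mult.commute)
  define r where "r = cmod z1"
  have r: "0 \<le> r" "r < 1" using z1 by (auto simp: r_def mem_disk_iff)
  define K where "K = \<phi> ` cball 0 r"
  note K = cball_image_facts[OF \<phi> r, folded K_def]
  have inK: "\<phi> 0 \<in> K" "\<phi> z1 \<in> K" using r by (auto simp: K_def r_def)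
  have ex: "\<exists>x\<in>K. cmod x = s" if "a \<le> s" "s \<le> b" for s
    using pdist_intermediate_value[OF K(2,4) d0 inK] that by (auto simp: a_def b_def)
  have inf: "infinite K"
    by (rule infinite_connected[OF K(2) inK]) (use ab in \<open>auto simp: a_def b_def\<close>)
  have main: "(1 - r) / 4 * (1 / 2) / real n * exp (- \<epsilon> * real n) \<le> approx_num p (comp_op \<phi>) n"
    if n: "n > 0" for n
  proof -
    obtain w where w: "\<And>i. i < n \<Longrightarrow> w i \<in> K" 
      "\<And>z j. z \<in> K \<Longrightarrow> j < n \<Longrightarrow> (\<Prod>i\<in>{..<n}-{j}. pdist z (w i)) \<le> 2 * point_prod n w j"
      by (rule near_Fekete[OF K(4) inf, of n]) blast
    have \<tau>: "exp (- \<epsilon> * real n) / 2 \<le> point_prod n w j" if j: "j < n" for j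
    proof -
      obtain x where x: "x \<in> K" "exp (- 8 * real (card ({..<n}-{j})) / L) \<le> (\<Prod>i\<in>{..<n}-{j}. pdist x (w i))"
        using exists_prod_pdist_ge_radial[of "{..<n}-{j}" w K a b] w K a ab b1 ex by (auto simp: L_def subset_iff)
      have "8 / L * real (card ({..<n}-{j})) \<le> \<epsilon> * real n"
        using L \<epsilon> j by (intro mult_mono) auto
      then have "exp (- \<epsilon> * real n) \<le> exp (- 8 * real (card ({..<n}-{j})) / L)"
        by simp
      also note x(2)
      also note w(2)[OF x(1) j]
      finally show ?thesis by simp
    qed
    have "\<forall>i\<in>{..<n}. \<exists>\<zeta>. cmod \<zeta> \<le> r \<and> w i = \<phi> \<zeta>" using w(1) by (force simp: K_def)
    then obtain \<zeta> where \<zeta>: "\<And>i. i < n \<Longrightarrow> cmod (\<zeta> i) \<le> r" "\<And>i. i < n \<Longrightarrow> w i = \<phi> (\<zeta> i)"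
      by (subst (asm) bchoice_iff) auto
    have "(1 - r) / 4 * (exp (- \<epsilon> * real n) / 2 / real n) \<le> approx_num p (comp_op \<phi>) n"
      by (rule approx_num_comp_op_ge[OF p \<phi> n r(2) \<zeta> _ \<tau>]) auto
    then show ?thesis by (simp add: mult_ac)
  qed
  show ?thesis
    by (intro exI[of _ "(1 - r) / 4 * (1 / 2)"] conjI allI impI main) (use r in auto)
qed

text \<open>The radial bound (s - t)/(1 - s t) decreases in t = |b|, so t = r is the worst
  case.\<close>

lemma pdist_ge_of_norm_eq:
  assumes r: "0 \<le> r" "r < s" "s < 1" and z: "cmod z = s" and b: "cmod b \<le> r"
  shows "(s - r) / (1 - s * r) \<le> pdist z b"
proof -
  define t where "t = cmod b"
  have t: "0 \<le> t" "t \<le> r" using b by (auto simp: t_def)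
  have "s * r < 1 * 1" "s * t < 1 * 1" using r t by (intro mult_strict_mono'; simp)+
  then have lt: "s * r < 1" "s * t < 1" by auto
  have "s * s \<le> 1 * 1" using r by (intro mult_mono) auto
  then have "0 \<le> (r - t) * (1 - s * s)" using t by simp
  then have "(s - r) * (1 - s * t) \<le> (s - t) * (1 - s * r)" by (simp add: algebra_simps)
  then have "(s - r) / (1 - s * r) \<le> (s - t) / (1 - s * t)"
    using lt by (simp add: divide_simps mult.commute)
  also have "\<dots> \<le> pdist z b"
    using pdist_ge_radial[of z b] z r t by (simp add: mem_disk_iff t_def)
  finally show ?thesis .
qed

text \<open>Three losses of \<epsilon> occur: smearing in the bound for \<open>fekete\<close>,
  extension of the Blaschke bound from K to \<phi>(D), and the size q^m of the Blaschke product on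
  the integration circle. All radii and constants may depend on \<epsilon> but not on n.\<close>

lemma approx_num_upper:
  assumes p: "p \<ge> 1" and \<phi>: "\<phi> holomorphic_on disk" and cl: "closure (\<phi> ` disk) \<subseteq> disk"
    and z1: "z1 \<in> disk" "\<phi> z1 \<noteq> \<phi> 0" and A: "ennreal A \<le> green_V (\<phi> ` disk)" "A \<ge> 0" and \<epsilon>: "\<epsilon> > 0"
  shows "\<exists>C>0. \<forall>n>0. approx_num p (comp_op \<phi>) n \<le> C * exp ((3 * \<epsilon> - A) * real n)"
proof -
  have im: "\<phi> ` disk \<subseteq> disk" by (rule order_trans[OF closure_subset cl])
  have nc: "\<not> \<phi> constant_on disk"
    by (rule not_constant_on_disk[OF z1])
  define \<Omega> where "\<Omega> = \<phi> ` disk"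
  have d0: "0 \<in> disk" by (simp add: mem_disk_iff)
  have op: "open \<Omega>" unfolding \<Omega>_def by (rule open_mapping_thm[OF \<phi> _ _ _ _ nc]) (auto simp: disk_def)
  have "bounded \<Omega>" using im by (auto simp: \<Omega>_def disk_def intro: bounded_subset[OF bounded_ball])
  then have ccl: "compact (closure \<Omega>)" by simp
  obtain R0 where R0: "0 \<le> R0" "R0 < 1" "\<And>x. x \<in> \<Omega> \<Longrightarrow> cmod x \<le> R0"
  proof -
    have "closure \<Omega> \<noteq> {}" using d0 by (auto simp: \<Omega>_def)
    then obtain x0 where "x0 \<in> closure \<Omega>" "\<And>x. x \<in> closure \<Omega> \<Longrightarrow> cmod x \<le> cmod x0"
      using continuous_attains_sup[OF ccl _ continuous_on_norm[OF continuous_on_id]] by auto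
    then show thesis using cl closure_subset[of \<Omega>]
      by (intro that[of "cmod x0"]) (auto simp: \<Omega>_def[symmetric] mem_disk_iff subset_iff)
  qed
  define a b where "a = \<phi> 0" and "b = \<phi> z1"
  have ab\<Omega>: "a \<in> disk" "b \<in> disk" "a \<noteq> b" using d0 z1 im by (auto simp: a_def b_def)
  define \<eta>0 where "\<eta>0 = pdist a b / 2 * exp (- 4 / \<epsilon>)"
  have \<eta>0: "\<eta>0 > 0" using pdist_pos[OF ab\<Omega>] by (simp add: \<eta>0_def)
  \<comment> \<open>Euclidean distance below \<delta> forces \<rho> \<le> \<eta>0 on the disk of
    radius R0, where |1 - cnj x * y| \<ge> 1 - R0^2.\<close>
  define \<delta> where "\<delta> = \<eta>0 * (1 - R0\<^sup>2)"
  have R2: "0 < 1 - R0\<^sup>2" using R0 by (simp add: power_less_one_iff)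
  have \<delta>: "\<delta> > 0" using \<eta>0 R2 by (simp add: \<delta>_def)
  \<comment> \<open>Compactness of the closure gives a finite \<delta>-net inside the image, so one
    closed disk has an image coming within \<eta>0 of every point of \<phi>(D).\<close>
  obtain F where F: "finite F" "F \<subseteq> \<Omega>" "\<Omega> \<subseteq> (\<Union>x\<in>F. ball x \<delta>)"
  proof -
    have "closure \<Omega> \<subseteq> (\<Union>x\<in>\<Omega>. ball x \<delta>)"
    proof
      fix y assume "y \<in> closure \<Omega>"
      then obtain x where "x \<in> \<Omega>" "dist x y < \<delta>" using \<delta> by (auto simp: closure_approachable)
      then show "y \<in> (\<Union>x\<in>\<Omega>. ball x \<delta>)" by auto
    qed
    then obtain F where "F \<subseteq> \<Omega>" "finite F" "closure \<Omega> \<subseteq> (\<Union>x\<in>F. ball x \<delta>)"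
      using compactE_image[OF ccl, of \<Omega> "\<lambda>x. ball x \<delta>"] by auto
    then show thesis using closure_subset[of \<Omega>] by (intro that[of F]) auto
  qed
  obtain r0 where r0: "0 \<le> r0" "r0 < 1" "F \<subseteq> \<phi> ` cball 0 r0"
    using exists_cball_image_superset[OF \<phi> nc finite_imp_compact[OF F(1)]] F(2) by (auto simp: \<Omega>_def)
  define r where "r = max r0 (cmod z1)"
  have r: "0 \<le> r" "r < 1" using r0 z1 by (auto simp: r_def mem_disk_iff)
  define K where "K = \<phi> ` cball 0 r"
  note K = cball_image_facts[OF \<phi> im r, folded K_def \<Omega>_def]
  have ab: "a \<in> K" "b \<in> K" using r z1 by (auto simp: K_def a_def b_def r_def)
  have FK: "F \<subseteq> K" using r0(3) by (force simp: K_def r_def)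
  have inf: "infinite K" by (rule infinite_connected[OF K(2) ab ab\<Omega>(3)])
  have near: "\<exists>x\<in>K. pdist y x \<le> \<eta>0" if y: "y \<in> \<Omega>" for y
  proof -
    obtain x where x: "x \<in> F" "dist x y < \<delta>" using F(3) y by auto
    have le: "cmod x \<le> R0" "cmod y \<le> R0" using x y F R0 by auto
    have "cmod x * cmod y \<le> R0 * R0" using le R0 by (intro mult_mono) auto
    then have "1 - R0\<^sup>2 \<le> cmod (1 - cnj x * y)"
      using norm_triangle_ineq2[of 1 "cnj x * y"] by (simp add: norm_mult power2_eq_square)
    then have "pdist y x \<le> \<delta> / (1 - R0\<^sup>2)"
      unfolding pdist_def norm_divide using x R2 \<delta>
      by (intro frac_le) (auto simp: dist_norm norm_minus_commute)
    also have "\<dots> = \<eta>0" using R2 by (simp add: \<delta>_def)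
    finally show ?thesis using x FK by auto
  qed
  obtain e where e: "e > 0" "\<And>x y. x \<in> K \<Longrightarrow> dist x y < e \<Longrightarrow> y \<in> \<Omega>"
  proof -
    obtain e where "e > 0" "(\<Union>x\<in>K. ball x e) \<subseteq> \<Omega>"
      using compact_subset_open_imp_ball_epsilon_subset[OF K(1) op K(3)] by auto
    then show thesis by (intro that[of e]) (auto simp: subset_iff)
  qed
  \<comment> \<open>By \<open>dist_moebius_le\<close> smearing moves points by at most 2 d < e, so
    they stay in the image.\<close>
  define d where "d = min (1/2) (e / 4)"
  have d: "0 < d" "d < 1" "2 * d < e" using e by (auto simp: d_def)
  \<comment> \<open>Chosen so that the smearing loss 8 / ln (d/\<eta>) is exactly
    \<epsilon>.\<close>
  define \<eta> where "\<eta> = d * exp (- 8 / \<epsilon>)"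
  have \<eta>: "0 < \<eta>" "\<eta> < d" using d \<epsilon> by (auto simp: \<eta>_def)
  have L: "8 / ln (d / \<eta>) = \<epsilon>" using d ln_div_mult_exp[of d "- 8 / \<epsilon>"] by (simp add: \<eta>_def)
  have E: "moebius x (of_real s) \<in> \<phi> ` disk" if "x \<in> K" "0 \<le> s" "s \<le> d" for x s
  proof -
    have "cmod (moebius x (of_real s) - x) \<le> 2 * s" using that K d by (intro dist_moebius_le) auto
    then have "dist x (moebius x (of_real s)) < e" using that d by (simp add: dist_norm norm_minus_commute)
    then show ?thesis using e(2)[OF that(1)] by (simp add: \<Omega>_def)
  qed
  define q where "q = exp (- \<epsilon>)"
  have q: "0 < q" "q < 1" using \<epsilon> by (auto simp: q_def)
  \<comment> \<open>So close to 1 that (s - R0)/(1 - s R0) \<ge> q: every Blaschke factor with zero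
    in the closed disk of radius R0 has modulus at least exp(-\<epsilon>) on |z| = s.\<close>
  define s where "s = 1 - (1 - q) * (1 - R0) / 2"
  have s1: "s < 1" using q R0 by (simp add: s_def)
  have "(1 - q) * (1 - R0) < 1 * (1 - R0)" using q R0 by (intro mult_strict_right_mono) auto
  then have sR: "R0 < s" using R0 unfolding s_def by argo
  have \<kappa>: "q \<le> pdist z x" if "cmod z = s" "cmod x \<le> R0" for z x
  proof -
    have sr: "s * R0 \<le> 1 * R0" using s1 R0 by (intro mult_right_mono) auto
    have "(1 - s) * (1 + R0) \<le> (1 - s) * 2" using s1 R0 by (intro mult_left_mono) auto
    also have "\<dots> = (1 - q) * (1 - R0)" by (simp add: s_def)
    also have "\<dots> \<le> (1 - q) * (1 - s * R0)" using sr q by (intro mult_left_mono) auto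
    finally have "q * (1 - s * R0) \<le> s - R0" by (simp add: algebra_simps)
    then have "q \<le> (s - R0) / (1 - s * R0)" using sr R0 by (simp add: pos_le_divide_eq)
    also have "\<dots> \<le> pdist z x" by (rule pdist_ge_of_norm_eq[OF R0(1) sR s1 that])
    finally show ?thesis .
  qed
  define C where "C = 4 / ((1 - s) * (s - R0)) * (2 / \<eta>)"
  have C: "C > 0" using s1 sR \<eta> by (simp add: C_def)
  have "approx_num p (comp_op \<phi>) n \<le> C * exp ((3 * \<epsilon> - A) * real n)" if n: "n > 0" for n
  proof -
    obtain w where w: "\<And>i. i < n \<Longrightarrow> w i \<in> K" "inj_on w {..<n}"
      "\<And>z j. z \<in> K \<Longrightarrow> j < n \<Longrightarrow> (\<Prod>i\<in>{..<n}-{j}. pdist z (w i)) \<le> 2 * point_prod n w j"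
      by (rule near_Fekete[OF K(4) inf, of n]) blast
    define T where "T = exp (real n * (\<epsilon> - A)) / \<eta>"
    have "fekete n w \<le> T ^ n"
      using fekete_le_of_green_V[OF \<eta> d(2) n w(1,2) K(1,4) E A] unfolding L T_def .
    moreover have "T > 0" using \<eta> by (simp add: T_def)
    \<comment> \<open>The point with small product is removed: near-extremality bounds the product
      over the other n - 1 points on all of K by 2 T, and n - 1 nodes give rank less than n.\<close>
    ultimately obtain j where j: "j < n" "point_prod n w j \<le> T"
      using exists_point_prod_le_fekete_root[OF n] by blast
    define m where "m = n - 1"
    have m: "Suc m = n" using n by (simp add: m_def)
    have cardJ: "card ({..<n}-{j}) = m" using j by (simp add: m_def)
    obtain h where h: "bij_betw h {..<m} ({..<n}-{j})"
      using ex_bij_betw_nat_finite[of "{..<n}-{j}"] cardJ by (auto simp: atLeast0LessThan)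
    define bb where "bb i = w (h i)" for i
    have bbK: "bb i \<in> K" if "i < m" for i
      unfolding bb_def using that h by (intro w(1)) (auto dest: bij_betwE)
    have prod: "(\<Prod>i<m. pdist x (bb i)) = (\<Prod>i\<in>{..<n}-{j}. pdist x (w i))" for x
      unfolding bb_def by (rule prod.reindex_bij_betw[OF h])
    have DK: "(\<Prod>i<m. pdist x (bb i)) \<le> 2 * T" if "x \<in> K" for x
      unfolding prod using w(3)[OF that j(1)] j(2) by simp
    have D: "(\<Prod>i<m. pdist (\<phi> z) (bb i)) \<le> exp (\<epsilon> * real m) * (2 * T)" if "z \<in> disk" for z
    proof -
      have \<phi>z: "\<phi> z \<in> \<Omega>" "\<phi> z \<in> disk" using that im by (auto simp: \<Omega>_def)
      obtain x1 where x1: "x1 \<in> K" "pdist (\<phi> z) x1 \<le> pdist a b / 2 * exp (- 4 / \<epsilon>)"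
        using near[OF \<phi>z(1)] by (auto simp: \<eta>0_def)
      have "(\<Prod>i<m. pdist (\<phi> z) (bb i)) \<le> exp (\<epsilon> * real (card {..<m})) * (2 * T)"
        by (rule prod_pdist_extend[OF K(2,4) ab ab\<Omega>(3) \<epsilon> \<phi>z(2) x1 _ _ DK]) (use bbK K in auto)
      then show ?thesis by simp
    qed
    have "approx_num p (comp_op \<phi>) (Suc m) \<le> 4 / ((1 - s) * (s - R0) * q ^ m) * (exp (\<epsilon> * real m) * (2 * T))"
    proof (rule approx_num_comp_op_le[OF p \<phi> _ sR s1 _ q(1) _ D])
      show "cmod (\<phi> z) \<le> R0" if "z \<in> disk" for z using R0(3) that by (auto simp: \<Omega>_def)
      show "cmod (bb i) \<le> R0" if "i < m" for i using R0(3) bbK[OF that] K(3) by auto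
      then show "q \<le> pdist z (bb i)" if "i < m" "cmod z = s" for i z using that by (intro \<kappa>) auto
    qed
    also have "\<dots> = C * (exp (\<epsilon> * real m) * exp (\<epsilon> * real m) * exp (real n * (\<epsilon> - A)))"
    proof -
      have "1 / q ^ m = exp (\<epsilon> * real m)"
        unfolding q_def by (simp add: exp_minus power_inverse exp_of_nat_mult mult.commute[of \<epsilon>] divide_inverse)
      moreover have "4 / ((1 - s) * (s - R0) * q ^ m) * (exp (\<epsilon> * real m) * (2 * T))
          = C * (1 / q ^ m * exp (\<epsilon> * real m) * exp (real n * (\<epsilon> - A)))"
        by (simp add: C_def T_def)
      ultimately show ?thesis by (simp only:)
    qed
    also have "\<dots> \<le> C * exp ((3 * \<epsilon> - A) * real n)"
    proof (rule mult_left_mono)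
      have "\<epsilon> * real m \<le> \<epsilon> * real n" using \<epsilon> by (intro mult_left_mono) (auto simp: m_def)
      then have "\<epsilon> * real m + \<epsilon> * real m + real n * (\<epsilon> - A) \<le> (3 * \<epsilon> - A) * real n"
        by (simp add: algebra_simps)
      then show "exp (\<epsilon> * real m) * exp (\<epsilon> * real m) * exp (real n * (\<epsilon> - A)) \<le> exp ((3 * \<epsilon> - A) * real n)"
        unfolding exp_add[symmetric] by simp
    qed (use C in simp)
    finally show ?thesis using m by simp
  qed
  then show ?thesis using C by blast
qed

section \<open>Passage to n-th roots\<close>

lemma approx_num_nonneg:
  assumes "p \<ge> 1" "n > 0" "bounded_op p T"
  shows "0 \<le> approx_num p T n"
proof (rule approx_num_ge[OF assms])
  fix R
  show "\<exists>f\<in>Hp p. hp_norm p f \<le> 1 \<and> 0 \<le> hp_norm p (\<lambda>z. T f z - R f z)"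
    using zero_in_Hp[OF assms(1)] by (intro bexI[of _ "\<lambda>_. 0"]) auto
qed

lemma eventually_root_less:
  fixes a :: "nat \<Rightarrow> real"
  assumes nn: "\<And>n. n > 0 \<Longrightarrow> 0 \<le> a n"
    and le: "\<And>\<epsilon>. \<epsilon> > 0 \<Longrightarrow> \<exists>C>0. \<forall>n>0. a n \<le> C * exp ((3 * \<epsilon> - A) * real n)"
    and u: "exp (- A) < u"
  shows "eventually (\<lambda>n. a n powr (1 / real n) < u) sequentially"
proof -
  have u0: "u > 0" using u less_trans[OF exp_gt_zero] by blast
  then have lnu: "- A < ln u" using u ln_less_cancel_iff[of "exp (- A)" u] by simp
  \<comment> \<open>Puts 3 \<epsilon> - A halfway between -A and ln u.\<close>
  define \<epsilon> where "\<epsilon> = (ln u + A) / 6"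
  have \<epsilon>: "\<epsilon> > 0" using lnu by (simp add: \<epsilon>_def)
  have "3 * \<epsilon> - A = (ln u - A) / 2" by (simp add: \<epsilon>_def field_simps)
  then have "3 * \<epsilon> - A < ln u" using lnu by simp
  then have lt: "exp (3 * \<epsilon> - A) < u" using u0 by (metis exp_less_cancel_iff exp_ln)
  obtain C where C: "C > 0" "\<And>n. n > 0 \<Longrightarrow> a n \<le> C * exp ((3 * \<epsilon> - A) * real n)" using le[OF \<epsilon>] by auto
  have "(\<lambda>n. C powr (1 / real n) * exp (3 * \<epsilon> - A)) \<longlonglongrightarrow> C powr 0 * exp (3 * \<epsilon> - A)"
    using C(1) by (intro tendsto_intros lim_1_over_n) auto
  then have "(\<lambda>n. C powr (1 / real n) * exp (3 * \<epsilon> - A)) \<longlonglongrightarrow> exp (3 * \<epsilon> - A)"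
    using C(1) by simp
  then have "eventually (\<lambda>n. C powr (1 / real n) * exp (3 * \<epsilon> - A) < u) sequentially"
    using lt by (rule order_tendstoD)
  with eventually_gt_at_top[of 0] show ?thesis
  proof eventually_elim
    case (elim n)
    have "a n powr (1 / real n) \<le> (C * exp ((3 * \<epsilon> - A) * real n)) powr (1 / real n)"
      using elim C nn by (intro powr_mono2) auto
    also have "\<dots> = C powr (1 / real n) * exp (3 * \<epsilon> - A)"
      using elim C by (simp add: powr_mult exp_powr_real)
    finally show ?case using elim by simp
  qed
qed

lemma eventually_root_greater:
  fixes a :: "nat \<Rightarrow> real"
  assumes ge: "\<And>\<epsilon>. \<epsilon> > 0 \<Longrightarrow> \<exists>c>0. \<forall>n>0. c / real n * exp (- (X + \<epsilon>) * real n) \<le> a n"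
    and l: "l < exp (- X)"
  shows "eventually (\<lambda>n. l < a n powr (1 / real n)) sequentially"
proof -
  \<comment> \<open>Raises l to a positive number still below exp(-X), so that its logarithm makes
    sense; l itself may be negative.\<close>
  define l' where "l' = max l (exp (- X - 1))"
  have l': "0 < l'" "l' < exp (- X)" "l \<le> l'" using l by (auto simp: l'_def less_max_iff_disj)
  then have lnl: "ln l' < - X" by (metis ln_exp ln_less_cancel_iff exp_gt_zero)
  define \<epsilon> where "\<epsilon> = (- X - ln l') / 2"
  have \<epsilon>: "\<epsilon> > 0" using lnl by (simp add: \<epsilon>_def)
  have "ln l' < - (X + \<epsilon>)" using lnl by (simp add: \<epsilon>_def field_simps)
  then have lt: "l' < exp (- (X + \<epsilon>))" using l'(1) by (metis exp_less_cancel_iff exp_ln)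
  obtain c where c: "c > 0" "\<And>n. n > 0 \<Longrightarrow> c / real n * exp (- (X + \<epsilon>) * real n) \<le> a n" using ge[OF \<epsilon>] by auto
  have "(\<lambda>n. (c / real n) powr (1 / real n)) \<longlonglongrightarrow> 1"
    using c(1) by real_asymp
  then have "(\<lambda>n. (c / real n) powr (1 / real n) * exp (- (X + \<epsilon>))) \<longlonglongrightarrow> 1 * exp (- (X + \<epsilon>))"
    by (intro tendsto_intros)
  then have "eventually (\<lambda>n. l' < (c / real n) powr (1 / real n) * exp (- (X + \<epsilon>))) sequentially"
    using lt by (intro order_tendstoD(1)) auto
  with eventually_gt_at_top[of 0] show ?thesis
  proof eventually_elim
    case (elim n)
    have "(c / real n) powr (1 / real n) * exp (- (X + \<epsilon>)) = (c / real n * exp (- (X + \<epsilon>) * real n)) powr (1 / real n)"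
    proof -
      have "exp (- (X + \<epsilon>) * real n) powr (1 / real n) = exp (- (X + \<epsilon>))"
        using elim by (simp add: exp_powr_real)
      then show ?thesis by (simp only: powr_mult)
    qed
    also have "\<dots> \<le> a n powr (1 / real n)"
      using elim c by (intro powr_mono2) auto
    finally show ?case using elim l' by simp
  qed
qed

text \<open>An admissible measure is the unit mass at a and charges the diagonal, where
  \<open>green\<close> is infinite. So a constant symbol has capacity zero and limit 0.\<close>

lemma green_V_singleton: "green_V {a} = \<infinity>"
proof -
  have "green_energy \<mu> = \<infinity>" if \<mu>: "\<mu> \<in> adm_measures {a}" for \<mu>
  proof -
    obtain K where K: "K \<subseteq> {a}" "emeasure \<mu> K = 1" and m: "sets \<mu> = sets borel" "prob_space \<mu>"
      using \<mu> by (auto simp: adm_measures_def)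
    interpret prob_space \<mu> by fact
    have "K = {a}" using K by (metis emeasure_empty subset_singletonD zero_neq_one)
    then have "AE z in \<mu>. z \<in> {a}"
      using K m by (subst AE_in_set_eq_1) (auto simp: measure_def)
    then have AE: "AE z in \<mu>. z = a" by simp
    have "(\<integral>\<^sup>+w. green a w \<partial>\<mu>) = (\<integral>\<^sup>+w. \<infinity> \<partial>\<mu>)"
      by (rule nn_integral_cong_AE) (use AE in \<open>auto simp: green_def\<close>)
    also have "\<dots> = \<infinity>" by (simp add: emeasure_space_1)
    finally have *: "(\<integral>\<^sup>+w. green a w \<partial>\<mu>) = \<infinity>" .
    have "green_energy \<mu> = (\<integral>\<^sup>+z. \<infinity> \<partial>\<mu>)"
      unfolding green_energy_def by (rule nn_integral_cong_AE) (use AE * in auto)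
    then show ?thesis by (simp add: emeasure_space_1)
  qed
  then show ?thesis unfolding green_V_def by (intro antisym INF_greatest) auto
qed

text \<open>Evaluation at a followed by the constant function has rank at most one, so from n = 2 on
  the operator is its own approximant.\<close>

lemma approx_num_constant_symbol:
  assumes p: "p \<ge> 1" and \<phi>: "\<phi> holomorphic_on disk" "\<phi> ` disk \<subseteq> disk"
    and c: "\<And>z. z \<in> disk \<Longrightarrow> \<phi> z = a" and n: "n \<ge> 2"
  shows "approx_num p (comp_op \<phi>) n = 0"
proof (rule antisym)
  have T: "bounded_op p (comp_op \<phi>)" by (rule bounded_op_comp_op[OF p \<phi>])
  have "rank_lt p (comp_op \<phi>) n"
    unfolding rank_lt_def using n c
    by (intro exI[of _ 1] conjI exI[of _ "\<lambda>_ z. if z \<in> disk then 1 else 0"] ballI exI[of _ "\<lambda>_. _ a"])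
       (auto simp: comp_op_def fun_eq_iff)
  then show "approx_num p (comp_op \<phi>) n \<le> 0"
    using zero_in_Hp(2)[OF p] by (intro approx_num_le[OF p T T]) auto
  show "0 \<le> approx_num p (comp_op \<phi>) n"
    using n by (intro approx_num_nonneg[OF p _ T]) auto
qed

text \<open>Reconciles the conventions at the ends: V = 0 gives infinite capacity and the value 1 =
  exp 0, while infinite V gives capacity 0 and the value 0, the limit of exp(-V).\<close>

lemma exp_neg_inv_inverse:
  "exp_neg_inv (1 / V) = (if V = \<infinity> then 0 else exp (- enn2real V))"
proof (cases V)
  case (real v)
  show ?thesis
  proof (cases "v = 0")
    case True
    then show ?thesis using real by (simp add: exp_neg_inv_def ennreal_divide_zero)
  next
    case False
    then have "v > 0" using real by simp
    then have "1 / V = ennreal (1 / v)" using real divide_ennreal[of 1 v] by simp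
    then show ?thesis using real \<open>v > 0\<close> by (simp add: exp_neg_inv_def)
  qed
next
  case top
  then show ?thesis by (simp add: exp_neg_inv_def)
qed

lemma approx_num_limit_interior:
  assumes p: "p \<ge> 1" and \<phi>: "\<phi> holomorphic_on disk" and cl: "closure (\<phi> ` disk) \<subseteq> disk"
    and z1: "z1 \<in> disk" "\<phi> z1 \<noteq> \<phi> 0"
  shows "(\<lambda>n. approx_num p (comp_op \<phi>) n powr (1 / real n)) \<longlonglongrightarrow> exp_neg_inv (green_cap (\<phi> ` disk))"
proof -
  define V where "V = green_V (\<phi> ` disk)"
  have im: "\<phi> ` disk \<subseteq> disk" by (rule order_trans[OF closure_subset cl])
  have nn: "0 \<le> approx_num p (comp_op \<phi>) n" if "n > 0" for n
    by (rule approx_num_nonneg[OF p that bounded_op_comp_op[OF p \<phi> im]])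
  have upper: "eventually (\<lambda>n. approx_num p (comp_op \<phi>) n powr (1 / real n) < u) sequentially"
    if "ennreal A \<le> V" "A \<ge> 0" "exp (- A) < u" for A u
    by (rule eventually_root_less[OF nn approx_num_upper[OF p \<phi> cl z1 _ that(2)] that(3)])
       (use that in \<open>auto simp: V_def\<close>)
  have lim: "exp_neg_inv (green_cap (\<phi> ` disk)) = (if V = \<infinity> then 0 else exp (- enn2real V))"
    unfolding green_cap_def V_def[symmetric] by (rule exp_neg_inv_inverse)
  show ?thesis
    unfolding lim
  proof (rule order_tendstoI)
    fix u assume u: "(if V = \<infinity> then 0 else exp (- enn2real V)) < u"
    show "eventually (\<lambda>n. approx_num p (comp_op \<phi>) n powr (1 / real n) < u) sequentially"
    proof (cases "V = \<infinity>")
      case True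
      then have u0: "u > 0" using u by simp
      \<comment> \<open>As V is infinite, any real A is a lower bound for it; this one makes exp(-A)
        < u.\<close>
      define A where "A = \<bar>ln u\<bar> + 1"
      have "exp (- A) < exp (ln u)" by (simp add: A_def)
      then show ?thesis using True u0 by (intro upper[of A]) (auto simp: A_def)
    next
      case False
      then have "exp (- enn2real V) < u" using u by simp
      then show ?thesis using False by (intro upper[of "enn2real V"]) (auto simp: less_top)
    qed
  next
    fix l assume l: "l < (if V = \<infinity> then 0 else exp (- enn2real V))"
    show "eventually (\<lambda>n. l < approx_num p (comp_op \<phi>) n powr (1 / real n)) sequentially"
    proof (cases "V = \<infinity>")
      case True
      then have "l < 0" using l by simp
      then show ?thesis by (intro always_eventually allI) (simp add: less_le_trans)
    next
      case False
      define v where "v = enn2real V"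
      have v: "V = ennreal v" "v \<ge> 0" using False by (auto simp: v_def less_top)
      have "\<exists>c>0. \<forall>n>0. c / real n * exp (- (v + \<epsilon>) * real n) \<le> approx_num p (comp_op \<phi>) n"
        if \<epsilon>: "\<epsilon> > 0" for \<epsilon>
      proof -
        \<comment> \<open>\<open>green_V\<close> is an infimum which need not be attained: half of
          \<epsilon> goes to a nearly minimal \<mu>, the other half to the loss in
          \<open>approx_num_lower_energy\<close>.\<close>
        have "V < ennreal (v + \<epsilon> / 2)" unfolding v(1) using v \<epsilon> by (intro ennreal_lessI) auto
        then obtain \<mu> where \<mu>: "\<mu> \<in> adm_measures (\<phi> ` disk)" "green_energy \<mu> < ennreal (v + \<epsilon> / 2)"
          unfolding V_def green_V_def by (auto simp: INF_less_iff)
        define I where "I = enn2real (green_energy \<mu>)"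
        have I: "green_energy \<mu> = ennreal I" "I \<ge> 0"
          using \<mu>(2) by (auto simp: I_def intro!: ennreal_enn2real[symmetric] intro: less_trans)
        have Ilt: "I < v + \<epsilon> / 2" using \<mu>(2) I v \<epsilon> by (simp add: ennreal_less_iff del: ennreal_plus)
        obtain c where c: "c > 0" "\<And>n. n > 0 \<Longrightarrow> c / real n * exp (- (I + \<epsilon> / 2) * real n) \<le> approx_num p (comp_op \<phi>) n"
          using approx_num_lower_energy[OF p \<phi> im z1 \<mu>(1) I, of "\<epsilon> / 2"] \<epsilon> by auto
        have "c / real n * exp (- (v + \<epsilon>) * real n) \<le> approx_num p (comp_op \<phi>) n" if n: "n > 0" for n
        proof -
          have "(I + \<epsilon> / 2) * real n \<le> (v + \<epsilon>) * real n"
            using Ilt by (intro mult_right_mono) auto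
          then have "- (v + \<epsilon>) * real n \<le> - (I + \<epsilon> / 2) * real n" by linarith
          then have "c / real n * exp (- (v + \<epsilon>) * real n) \<le> c / real n * exp (- (I + \<epsilon> / 2) * real n)"
            using c n by (intro mult_left_mono) auto
          also have "\<dots> \<le> approx_num p (comp_op \<phi>) n" by (rule c(2)[OF n])
          finally show ?thesis .
        qed
        then show ?thesis using c(1) by blast
      qed
      then show ?thesis using l False by (intro eventually_root_greater[of v]) (auto simp: v_def)
    qed
  qed
qed

text \<open>Comparison with the zero operator bounds the approximation numbers by a constant, so the
  roots cannot exceed 1 in the limit; the lower estimate \<open>approx_num_lower_boundary\<close>
  has rate 0.\<close>

lemma approx_num_limit_boundary:
  assumes p: "p \<ge> 1" and \<phi>: "\<phi> holomorphic_on disk" "\<phi> ` disk \<subseteq> disk"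
    and sup: "(SUP z\<in>disk. cmod (\<phi> z)) = 1"
  shows "(\<lambda>n. approx_num p (comp_op \<phi>) n powr (1 / real n)) \<longlonglongrightarrow> 1"
proof (rule order_tendstoI)
  have T: "bounded_op p (comp_op \<phi>)" by (rule bounded_op_comp_op[OF p \<phi>])
  obtain C where C: "\<And>f. f \<in> Hp p \<Longrightarrow> hp_norm p (comp_op \<phi> f) \<le> C * hp_norm p f"
    using T unfolding bounded_op_def by blast
  have le: "approx_num p (comp_op \<phi>) n \<le> \<bar>C\<bar> + 1" if n: "n > 0" for n
  proof (rule approx_num_le[OF p T bounded_op_zero[OF p]])
    show "rank_lt p (\<lambda>f z. 0) n" unfolding rank_lt_def using n by (intro exI[of _ 0]) auto
    fix f assume f: "f \<in> Hp p" "hp_norm p f \<le> 1"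
    have "hp_norm p (comp_op \<phi> f) \<le> C * hp_norm p f" by (rule C[OF f(1)])
    also have "\<dots> \<le> \<bar>C\<bar> * 1" using f by (intro mult_mono) auto
    finally show "hp_norm p (\<lambda>z. comp_op \<phi> f z - 0) \<le> \<bar>C\<bar> + 1" by simp
  qed
  show "eventually (\<lambda>n. approx_num p (comp_op \<phi>) n powr (1 / real n) < u) sequentially" if "1 < u" for u
  proof (rule eventually_root_less[of _ 0])
    show "0 \<le> approx_num p (comp_op \<phi>) n" if "n > 0" for n by (rule approx_num_nonneg[OF p that T])
    show "\<exists>C>0. \<forall>n>0. approx_num p (comp_op \<phi>) n \<le> C * exp ((3 * \<epsilon> - 0) * real n)" if \<epsilon>: "\<epsilon> > 0" for \<epsilon>
    proof (intro exI[of _ "\<bar>C\<bar> + 1"] conjI allI impI)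
      fix n :: nat assume n: "n > 0"
      have "(\<bar>C\<bar> + 1) * 1 \<le> (\<bar>C\<bar> + 1) * exp ((3 * \<epsilon> - 0) * real n)"
        using \<epsilon> by (intro mult_left_mono) auto
      then show "approx_num p (comp_op \<phi>) n \<le> (\<bar>C\<bar> + 1) * exp ((3 * \<epsilon> - 0) * real n)"
        using le[OF n] by simp
    qed simp
  qed (use that in simp)
  show "eventually (\<lambda>n. l < approx_num p (comp_op \<phi>) n powr (1 / real n)) sequentially" if "l < 1" for l
    by (rule eventually_root_greater[of 0]) (use approx_num_lower_boundary[OF p \<phi> sup] that in auto)
qed

theorem theorem4p1:
  fixes p :: real and \<phi> :: "complex \<Rightarrow> complex"
  assumes "1 \<le> p"
    and "\<phi> holomorphic_on disk"
    and "\<phi> ` disk \<subseteq> disk"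
  shows "(closure (\<phi> ` disk) \<subseteq> disk \<longrightarrow>
            (\<lambda>n. approx_num p (comp_op \<phi>) n powr (1 / real n))
              \<longlonglongrightarrow> exp_neg_inv (green_cap (\<phi> ` disk)))
       \<and> ((SUP z\<in>disk. cmod (\<phi> z)) = 1 \<longrightarrow>
            (\<lambda>n. approx_num p (comp_op \<phi>) n powr (1 / real n)) \<longlonglongrightarrow> 1)"
proof (intro conjI impI)
  assume cl: "closure (\<phi> ` disk) \<subseteq> disk"
  show "(\<lambda>n. approx_num p (comp_op \<phi>) n powr (1 / real n)) \<longlonglongrightarrow> exp_neg_inv (green_cap (\<phi> ` disk))"
  \<comment> \<open>Nonconstancy of \<phi> makes its image open and the continua nondegenerate; the
    constant symbol is treated apart.\<close>
  proof (cases "\<exists>z1\<in>disk. \<phi> z1 \<noteq> \<phi> 0")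
    case True
    then show ?thesis using approx_num_limit_interior[OF assms(1,2) cl] by auto
  next
    case False
    have "\<phi> ` disk = (\<lambda>_. \<phi> 0) ` disk" using False by (intro image_cong) auto
    also have "\<dots> = {\<phi> 0}" by (simp add: image_constant_conv disk_def)
    finally have "\<phi> ` disk = {\<phi> 0}" .
    then have "exp_neg_inv (green_cap (\<phi> ` disk)) = 0"
      unfolding green_cap_def exp_neg_inv_inverse by (simp add: green_V_singleton)
    moreover have "eventually (\<lambda>n. approx_num p (comp_op \<phi>) n powr (1 / real n) = 0) sequentially"
      using eventually_ge_at_top[of 2]
    proof eventually_elim
      case (elim n)
      then show ?case
        using approx_num_constant_symbol[OF assms, of "\<phi> 0" n] False by auto
    qed
    ultimately show ?thesis by (simp add: tendsto_eventually)
  qed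
next
  assume "(SUP z\<in>disk. cmod (\<phi> z)) = 1"
  then show "(\<lambda>n. approx_num p (comp_op \<phi>) n powr (1 / real n)) \<longlonglongrightarrow> 1"
    by (rule approx_num_limit_boundary[OF assms])
qed

end
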